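(* Let $N\ge3$, $\lambda<\left(\frac{N-1}{2}\right)^2$, and let $u\in H^1(\mathbb{B}^N)$ be a weak solution of $-\Delta_{\mathbb{B}^N}u-\lambda u=|u|^{2^*-2}u$. Then $|u(x)|+|\nabla_{\mathbb{B}^N}u(x)|_g^2\to0$ as $|x|\to1$. If moreover $\lambda\le\frac{N(N-2)}{4}$, then there is a constant $C>0$ such that for all $x\in\mathbb{B}^N$ $$|u(x)|\le C\left(\frac{1-|x|^2}{2}\right)^{c_\lambda},\qquad c_\lambda=\min\left\{\frac{(N-1)+\sqrt{(N-1)^2-4\lambda}}{2},\ \frac{N+2}{2}\right\}.$$
   Context: $\mathbb{B}^N=\{x\in\mathbb{R}^N:|x|<1\}$ with the hyperbolic metric $g_{ij}=\left(\frac{2}{1-|x|^2}\right)^2\delta_{ij}$; $dV_{\mathbb{B}^N}=\left(\frac{2}{1-|x|^2}\right)^N dx$; $|\nabla_{\mathbb{B}^N}u|_g^2=\left(\frac{1-|x|^2}{2}\right)^2|\nabla u|^2$; $\Delta_{\mathbb{B}^N}u=\left(\frac{1-|x|^2}{2}\right)^2\Delta u+(N-2)\frac{1-|x|^2}{2}\,x\cdot\nabla u$. $H^1(\mathbb{B}^N)$ is the completion of $C_c^\infty(\mathbb{B}^N)$ under $\left(\int(|\nabla_{\mathbb{B}^N}u|_g^2+u^2)\,dV_{\mathbb{B}^N}\right)^{1/2}$; $2^*=\frac{2N}{N-2}$. Weak solutions are $C^2$ in $\mathbb{B}^N$ by elliptic regularity. *)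

theory Defs
  imports "HOL-Analysis.Analysis"
begin

text \<open>Points of the Poincare ball model are vectors x :: real^'n, N = CARD('n).\<close>

definition ballN :: "(real^'n) set" where
  "ballN = ball 0 1"

definition pd :: "(real^'n \<Rightarrow> real) \<Rightarrow> 'n \<Rightarrow> real^'n \<Rightarrow> real" where
  "pd f i x = deriv (\<lambda>t. f (x + t *\<^sub>R axis i 1)) 0"

definition egrad :: "(real^'n \<Rightarrow> real) \<Rightarrow> real^'n \<Rightarrow> real^'n" where
  "egrad f x = (\<chi> i. pd f i x)"

fun Ck_on :: "nat \<Rightarrow> (real^'n) set \<Rightarrow> (real^'n \<Rightarrow> real) \<Rightarrow> bool" where
  "Ck_on 0 S f = continuous_on S f"
| "Ck_on (Suc k) S f = (continuous_on S f \<and> f differentiable_on S \<and> (\<forall>i. Ck_on k S (pd f i)))"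

definition smooth_on :: "(real^'n) set \<Rightarrow> (real^'n \<Rightarrow> real) \<Rightarrow> bool" where
  "smooth_on S f = (\<forall>k. Ck_on k S f)"

definition test_fun :: "(real^'n \<Rightarrow> real) \<Rightarrow> bool" where
  "test_fun \<phi> = (smooth_on UNIV \<phi> \<and>
      (\<exists>K. compact K \<and> K \<subseteq> ballN \<and> (\<forall>x. x \<notin> K \<longrightarrow> \<phi> x = 0)))"

definition rho :: "real^'n \<Rightarrow> real" where
  "rho x = (1 - (norm x)\<^sup>2) / 2"

definition vol_dens :: "real^'n \<Rightarrow> real" where
  "vol_dens x = (2 / (1 - (norm x)\<^sup>2)) ^ CARD('n)"

definition hgrad_sq :: "(real^'n \<Rightarrow> real) \<Rightarrow> real^'n \<Rightarrow> real" where
  "hgrad_sq u x = (rho x)\<^sup>2 * (norm (egrad u x))\<^sup>2"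

definition hgrad_inner :: "(real^'n \<Rightarrow> real) \<Rightarrow> (real^'n \<Rightarrow> real) \<Rightarrow> real^'n \<Rightarrow> real" where
  "hgrad_inner u v x = (rho x)\<^sup>2 * (egrad u x \<bullet> egrad v x)"

definition H1_normsq :: "(real^'n \<Rightarrow> real) \<Rightarrow> ennreal" where
  "H1_normsq u = (\<integral>\<^sup>+ x. indicator ballN x * ennreal ((hgrad_sq u x + (u x)\<^sup>2) * vol_dens x) \<partial>lborel)"

text \<open>Membership in H^1(B^N), the completion of C_c^infinity(B^N) under the H^1 norm.
  It is applied to functions u that are C^2 in the ball (by elliptic regularity, as
  stated in the context), so the gradient of u - phi_k is the classical one.\<close>
definition in_H1 :: "(real^'n \<Rightarrow> real) \<Rightarrow> bool" where
  "in_H1 u = (\<exists>\<phi>. (\<forall>k. test_fun (\<phi> k)) \<and>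
      ((\<lambda>k. H1_normsq (\<lambda>x. u x - \<phi> k x)) \<longlonglongrightarrow> 0))"

text \<open>Weak solution of -Delta_{B^N} u - lambda u = |u|^{2^*-2} u, with 2^* - 2 = 4/(N-2).\<close>
definition weak_solution :: "real \<Rightarrow> (real^'n \<Rightarrow> real) \<Rightarrow> bool" where
  "weak_solution lam u = (\<forall>\<phi>. test_fun \<phi> \<longrightarrow>
      (LINT x:ballN|lborel.
         (hgrad_inner u \<phi> x - lam * u x * \<phi> x
          - \<bar>u x\<bar> powr (4 / (real CARD('n) - 2)) * u x * \<phi> x) * vol_dens x) = 0)"

end

theory Submission
  imports Defs
begin

text \<open>
  After the conformal change \<open>w = rho\<^sup>-\<^sup>a u\<close>, \<open>a = (N - 2) / 2\<close>, the equation becomes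
  \<open>\<Delta> w + (lam - N (N - 2) / 4) rho\<^sup>-\<^sup>2 w + |w|\<^bsup>4/(N-2)\<^esup> w = 0\<close> on the Euclidean ball, and the \<open>H\<^sup>1\<close> energy of
  \<open>u\<close> on a ball of radius comparable to \<open>1 - |x|\<close> around \<open>x\<close> tends to \<open>0\<close> at the boundary.
  Weighted means of \<open>w\<close> over balls of radius \<open>r\<close> are bounded by \<open>r\<^sup>-\<^sup>a\<close> times the square root of the
  energy, and they control \<open>w\<close> at the centre up to \<open>r\<^sup>2 sup |\<Delta> w|\<close>. A point-picking argument turns
  this into a small-energy bound, hence \<open>u\<close> and then its gradient tend to \<open>0\<close>.

  For the rate, put \<open>b = (N - 1) / 2\<close>. Since \<open>rho\<^sup>b\<close> is a strict supersolution of the linearised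
  operator near the boundary, writing \<open>u - M \<Phi> = rho\<^sup>b h\<close> turns the inequality satisfied by the
  difference into \<open>rho div (rho \<nabla>h) \<ge> q h\<close> where \<open>h > 0\<close>; testing with a cut-off positive part
  of \<open>h\<close> and using only that \<open>u\<close> is square integrable gives \<open>h \<le> 0\<close>. The barrier \<open>\<Phi> = rho\<^sup>b\<close>
  makes the nonlinear term \<open>O(rho)\<close>, after which \<open>\<Phi> = rho\<^sup>c - rho\<^bsup>c+1/2\<^esup>\<close> is a barrier, where
  \<open>c (N - 1 - c) = lam\<close> is the larger root.
\<close>

section \<open>Gradients, divergences and Laplacians\<close>

text \<open>The power \<open>4/(N-2) = 2/a\<close> is critical: the equation for \<open>w\<close>
  and its Dirichlet energy are invariant under the same rescaling, so a bound at one scale does not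
  improve at a smaller one. The mean bound \<open>r^-a\<close> is borderline, because a function of
  height \<open>M\<close> has \<open>M^(1 + 2/a) r^2 = M\<close> at \<open>r = M^(-1/a)\<close>.
  Only small energy breaks the tie, and the tail of the \<open>H^1\<close> norm supplies it near the
  sphere.

  Conjugation by \<open>rho^c\<close> produces the zero-order coefficient
  \<open>c (N - 1 - c)\<close>, largest at \<open>c = b\<close> with value \<open>b^2\<close>, the
  bottom of the spectrum; \<open>lam < b^2\<close> is the room that remains once \<open>|u|\<close>
  is small. The same \<open>b\<close> turns \<open>h^2 / rho\<close> into
  \<open>rho^-N (u - M \<Phi>)^2\<close>, which is at most the hyperbolic \<open>L^2\<close> density
  of \<open>u\<close> where \<open>u > M \<Phi>\<close>. Hence the barrier may vanish at the sphere
  at any rate, and no boundary values of \<open>u\<close> enter. At the exact root \<open>c\<close>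
  the leading terms cancel and leave no slack; the term \<open>- rho^(c+1/2)\<close> creates a gain
  of order \<open>rho^(c+1/2)\<close> against errors of order \<open>rho^(c+1)\<close>.\<close>

definition has_grad_on :: "('a::euclidean_space \<Rightarrow> real) \<Rightarrow> ('a \<Rightarrow> 'a) \<Rightarrow> 'a set \<Rightarrow> bool" where
  "has_grad_on f Df S \<longleftrightarrow>
     (\<forall>x\<in>S. (f has_derivative (\<lambda>h. Df x \<bullet> h)) (at x)) \<and> continuous_on S Df"

text \<open>The derivative is existentially bound because only its trace enters later statements.
  Continuity of every column makes the field C^1, so its partial derivatives can be integrated over
  compact sets.\<close>

definition has_div_on :: "('a::euclidean_space \<Rightarrow> 'a) \<Rightarrow> ('a \<Rightarrow> real) \<Rightarrow> 'a set \<Rightarrow> bool" where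
  "has_div_on X dX S \<longleftrightarrow>
     (\<exists>X'. (\<forall>x\<in>S. (X has_derivative X' x) (at x) \<and> dX x = (\<Sum>b\<in>Basis. X' x b \<bullet> b)) \<and>
           (\<forall>b\<in>Basis. continuous_on S (\<lambda>x. X' x b)))"

definition has_laplacian_on ::
  "('a::euclidean_space \<Rightarrow> real) \<Rightarrow> ('a \<Rightarrow> 'a) \<Rightarrow> ('a \<Rightarrow> real) \<Rightarrow> 'a set \<Rightarrow> bool" where
  "has_laplacian_on f Df Lf S \<longleftrightarrow> has_grad_on f Df S \<and> has_div_on Df Lf S"

lemma has_grad_onD: "has_grad_on f Df S \<Longrightarrow> x \<in> S \<Longrightarrow> (f has_derivative (\<lambda>h. Df x \<bullet> h)) (at x)"
  and has_grad_on_continuous_grad: "has_grad_on f Df S \<Longrightarrow> continuous_on S Df"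
  by (auto simp: has_grad_on_def)

lemma has_grad_on_continuous: "has_grad_on f Df S \<Longrightarrow> continuous_on S f"
  unfolding has_grad_on_def
  by (meson continuous_at_imp_continuous_on has_derivative_continuous)

lemma has_div_on_continuous: "has_div_on X dX S \<Longrightarrow> continuous_on S X"
  unfolding has_div_on_def
  by (meson continuous_at_imp_continuous_on has_derivative_continuous)

lemma has_div_on_continuous_div:
  assumes "has_div_on X dX S"
  shows "continuous_on S dX"
proof -
  from assms obtain X' where X': "\<And>x. x \<in> S \<Longrightarrow> (X has_derivative X' x) (at x)"
      "\<And>x. x \<in> S \<Longrightarrow> dX x = (\<Sum>b\<in>Basis. X' x b \<bullet> b)"
    and c: "\<And>b. b \<in> Basis \<Longrightarrow> continuous_on S (\<lambda>x. X' x b)"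
    unfolding has_div_on_def by blast
  have "continuous_on S (\<lambda>x. \<Sum>b\<in>Basis. X' x b \<bullet> b)"
    by (intro continuous_intros c)
  then show ?thesis
    using X'(2) by (simp cong: continuous_on_cong)
qed

lemma has_grad_on_cong:
  "has_grad_on f Df S \<Longrightarrow> (\<And>x. x \<in> S \<Longrightarrow> Df x = Dg x) \<Longrightarrow> has_grad_on f Dg S"
  unfolding has_grad_on_def by (metis continuous_on_cong)

lemma has_div_on_cong:
  "has_div_on X dX S \<Longrightarrow> (\<And>x. x \<in> S \<Longrightarrow> dX x = dY x) \<Longrightarrow> has_div_on X dY S"
  by (simp add: has_div_on_def)

lemma has_grad_on_subset: "has_grad_on f Df S \<Longrightarrow> T \<subseteq> S \<Longrightarrow> has_grad_on f Df T"
  unfolding has_grad_on_def by (meson continuous_on_subset subsetD)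

lemma has_grad_on_mult:
  assumes "has_grad_on f Df S" "has_grad_on g Dg S"
  shows "has_grad_on (\<lambda>x. f x * g x) (\<lambda>x. f x *\<^sub>R Dg x + g x *\<^sub>R Df x) S"
  unfolding has_grad_on_def
proof (intro conjI ballI)
  fix x assume "x \<in> S"
  show "((\<lambda>x. f x * g x) has_derivative (\<lambda>h. (f x *\<^sub>R Dg x + g x *\<^sub>R Df x) \<bullet> h)) (at x)"
    by (rule has_derivative_eq_rhs[OF has_derivative_mult[OF assms[THEN has_grad_onD, OF \<open>x \<in> S\<close>]]])
      (auto simp: inner_add_left fun_eq_iff)
next
  show "continuous_on S (\<lambda>x. f x *\<^sub>R Dg x + g x *\<^sub>R Df x)"
    by (intro continuous_intros has_grad_on_continuous_grad has_grad_on_continuous)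
      (use assms in auto)
qed

lemma has_grad_on_diff:
  assumes "has_grad_on f Df S" "has_grad_on g Dg S"
  shows "has_grad_on (\<lambda>x. f x - g x) (\<lambda>x. Df x - Dg x) S"
  using assms unfolding has_grad_on_def
  by (auto intro!: continuous_intros derivative_eq_intros simp: inner_diff_left)

lemma has_grad_on_cmult:
  assumes "has_grad_on f Df S"
  shows "has_grad_on (\<lambda>x. c * f x) (\<lambda>x. c *\<^sub>R Df x) S"
  using assms unfolding has_grad_on_def
  by (auto intro!: continuous_intros derivative_eq_intros)

lemma has_grad_on_inner_right: "has_grad_on (\<lambda>x. x \<bullet> b) (\<lambda>x. b) S"
  unfolding has_grad_on_def
  by (auto intro!: continuous_intros derivative_eq_intros simp: inner_commute)

lemma has_grad_on_inner_self: "has_grad_on (\<lambda>x. x \<bullet> x) (\<lambda>x. 2 *\<^sub>R x) S"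
  unfolding has_grad_on_def
  by (auto intro!: continuous_intros derivative_eq_intros simp: inner_commute)

lemma has_grad_on_compose:
  assumes "has_grad_on f Df S"
    and "\<And>x. x \<in> S \<Longrightarrow> (\<phi> has_real_derivative \<phi>' (f x)) (at (f x))"
    and "continuous_on (f ` S) \<phi>'"
  shows "has_grad_on (\<lambda>x. \<phi> (f x)) (\<lambda>x. \<phi>' (f x) *\<^sub>R Df x) S"
  unfolding has_grad_on_def
proof (intro conjI ballI)
  fix x assume "x \<in> S"
  show "((\<lambda>x. \<phi> (f x)) has_derivative (\<lambda>h. (\<phi>' (f x) *\<^sub>R Df x) \<bullet> h)) (at x)"
    using has_derivative_compose[OF has_grad_onD[OF assms(1) \<open>x \<in> S\<close>]
        assms(2)[OF \<open>x \<in> S\<close>, unfolded has_field_derivative_def]] by simp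
next
  have "continuous_on S (\<lambda>x. \<phi>' (f x))"
    by (rule continuous_on_compose2[OF assms(3) has_grad_on_continuous[OF assms(1)]]) auto
  then show "continuous_on S (\<lambda>x. \<phi>' (f x) *\<^sub>R Df x)"
    by (intro continuous_intros has_grad_on_continuous_grad[OF assms(1)])
qed

lemma has_div_on_scaleR:
  assumes f: "has_grad_on f Df S" and X: "has_div_on X dX S"
  shows "has_div_on (\<lambda>x. f x *\<^sub>R X x) (\<lambda>x. f x * dX x + Df x \<bullet> X x) S"
proof -
  from X obtain X' where X': "\<And>x. x \<in> S \<Longrightarrow> (X has_derivative X' x) (at x)"
      "\<And>x. x \<in> S \<Longrightarrow> dX x = (\<Sum>b\<in>Basis. X' x b \<bullet> b)"
    and c: "\<And>b. b \<in> Basis \<Longrightarrow> continuous_on S (\<lambda>x. X' x b)"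
    unfolding has_div_on_def by blast
  have 1: "((\<lambda>x. f x *\<^sub>R X x) has_derivative (\<lambda>h. f x *\<^sub>R X' x h + (Df x \<bullet> h) *\<^sub>R X x)) (at x)"
    if "x \<in> S" for x
    by (rule has_derivative_scaleR[OF has_grad_onD[OF f that] X'(1)[OF that]])
  have 2: "f x * dX x + Df x \<bullet> X x = (\<Sum>b\<in>Basis. (f x *\<^sub>R X' x b + (Df x \<bullet> b) *\<^sub>R X x) \<bullet> b)"
    if "x \<in> S" for x
    by (simp add: X'(2)[OF that] inner_add_left sum.distrib sum_distrib_left
        euclidean_inner[of "Df x" "X x"])
  have 3: "continuous_on S (\<lambda>x. f x *\<^sub>R X' x b + (Df x \<bullet> b) *\<^sub>R X x)" if "b \<in> Basis" for b
    by (intro continuous_intros c that has_grad_on_continuous[OF f] has_grad_on_continuous_grad[OF f]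
        has_div_on_continuous[OF X])
  show ?thesis
    unfolding has_div_on_def
    by (rule exI[of _ "\<lambda>x h. f x *\<^sub>R X' x h + (Df x \<bullet> h) *\<^sub>R X x"]) (use 1 2 3 in auto)
qed

lemma has_div_on_add:
  assumes X: "has_div_on X dX S" and Y: "has_div_on Y dY S"
  shows "has_div_on (\<lambda>x. X x + Y x) (\<lambda>x. dX x + dY x) S"
proof -
  from X obtain X' where X': "\<And>x. x \<in> S \<Longrightarrow> (X has_derivative X' x) (at x)"
      "\<And>x. x \<in> S \<Longrightarrow> dX x = (\<Sum>b\<in>Basis. X' x b \<bullet> b)"
      "\<And>b. b \<in> Basis \<Longrightarrow> continuous_on S (\<lambda>x. X' x b)"
    unfolding has_div_on_def by blast
  from Y obtain Y' where Y': "\<And>x. x \<in> S \<Longrightarrow> (Y has_derivative Y' x) (at x)"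
      "\<And>x. x \<in> S \<Longrightarrow> dY x = (\<Sum>b\<in>Basis. Y' x b \<bullet> b)"
      "\<And>b. b \<in> Basis \<Longrightarrow> continuous_on S (\<lambda>x. Y' x b)"
    unfolding has_div_on_def by blast
  show ?thesis
    unfolding has_div_on_def
    by (rule exI[of _ "\<lambda>x h. X' x h + Y' x h"])
      (use X' Y' in \<open>auto intro!: has_derivative_add continuous_on_add simp: inner_add_left sum.distrib\<close>)
qed

lemma has_grad_on_const: "has_grad_on (\<lambda>x. c) (\<lambda>x. 0) S"
  unfolding has_grad_on_def by (auto intro!: continuous_intros derivative_eq_intros)

lemma has_div_on_const: "has_div_on (\<lambda>x. c) (\<lambda>x. 0) S"
  unfolding has_div_on_def
  by (rule exI[of _ "\<lambda>x h. 0"]) (auto intro!: continuous_intros derivative_eq_intros)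

lemma has_div_on_cmult:
  assumes "has_div_on X dX S"
  shows "has_div_on (\<lambda>x. c *\<^sub>R X x) (\<lambda>x. c * dX x) S"
  using has_div_on_scaleR[OF has_grad_on_const assms, of c] by simp

lemma has_div_on_diff:
  assumes X: "has_div_on X dX S" and Y: "has_div_on Y dY S"
  shows "has_div_on (\<lambda>x. X x - Y x) (\<lambda>x. dX x - dY x) S"
  using has_div_on_add[OF X has_div_on_cmult[OF Y, of "-1"]] by simp

lemma has_div_on_id: "has_div_on (\<lambda>x. x) (\<lambda>x. real DIM('a)) (S :: 'a::euclidean_space set)"
  unfolding has_div_on_def
  by (rule exI[of _ "\<lambda>x h. h"]) (auto intro!: continuous_intros derivative_eq_intros)

lemma has_laplacian_on_mult:
  assumes "has_laplacian_on f Df Lf S" "has_laplacian_on g Dg Lg S"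
  shows "has_laplacian_on (\<lambda>x. f x * g x) (\<lambda>x. f x *\<^sub>R Dg x + g x *\<^sub>R Df x)
           (\<lambda>x. f x * Lg x + g x * Lf x + 2 * (Df x \<bullet> Dg x)) S"
proof -
  have f: "has_grad_on f Df S" "has_div_on Df Lf S" and g: "has_grad_on g Dg S" "has_div_on Dg Lg S"
    using assms by (auto simp: has_laplacian_on_def)
  have "has_div_on (\<lambda>x. f x *\<^sub>R Dg x + g x *\<^sub>R Df x)
     (\<lambda>x. (f x * Lg x + Df x \<bullet> Dg x) + (g x * Lf x + Dg x \<bullet> Df x)) S"
    by (intro has_div_on_add has_div_on_scaleR f g)
  then show ?thesis
    unfolding has_laplacian_on_def
    by (intro conjI has_grad_on_mult f g) (erule has_div_on_cong, simp add: inner_commute)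
qed

lemma has_laplacian_on_diff:
  assumes "has_laplacian_on f Df Lf S" "has_laplacian_on g Dg Lg S"
  shows "has_laplacian_on (\<lambda>x. f x - g x) (\<lambda>x. Df x - Dg x) (\<lambda>x. Lf x - Lg x) S"
  using assms unfolding has_laplacian_on_def
  by (auto intro: has_grad_on_diff has_div_on_diff)

lemma has_laplacian_on_cmult:
  assumes "has_laplacian_on f Df Lf S"
  shows "has_laplacian_on (\<lambda>x. c * f x) (\<lambda>x. c *\<^sub>R Df x) (\<lambda>x. c * Lf x) S"
  using assms unfolding has_laplacian_on_def
  by (auto intro: has_grad_on_cmult has_div_on_cmult)

lemma has_grad_on_affine:
  assumes "has_grad_on f Df T" "\<And>y. y \<in> S \<Longrightarrow> x + r *\<^sub>R y \<in> T"
  shows "has_grad_on (\<lambda>y. f (x + r *\<^sub>R y)) (\<lambda>y. r *\<^sub>R Df (x + r *\<^sub>R y)) S"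
  unfolding has_grad_on_def
proof (intro conjI ballI)
  fix y assume "y \<in> S"
  have "((\<lambda>y. x + r *\<^sub>R y) has_derivative (\<lambda>h. r *\<^sub>R h)) (at y)"
    by (auto intro!: derivative_eq_intros)
  from has_derivative_compose[OF this has_grad_onD[OF assms(1) assms(2)[OF \<open>y \<in> S\<close>]]]
  show "((\<lambda>y. f (x + r *\<^sub>R y)) has_derivative (\<lambda>h. (r *\<^sub>R Df (x + r *\<^sub>R y)) \<bullet> h)) (at y)"
    by simp
next
  have "continuous_on S (\<lambda>y. Df (x + r *\<^sub>R y))"
    by (rule continuous_on_compose2[OF has_grad_on_continuous_grad[OF assms(1)]])
      (use assms(2) in \<open>auto intro!: continuous_intros\<close>)
  then show "continuous_on S (\<lambda>y. r *\<^sub>R Df (x + r *\<^sub>R y))"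
    by (intro continuous_intros)
qed

lemma has_div_on_affine:
  assumes "has_div_on X dX T" "\<And>y. y \<in> S \<Longrightarrow> x + r *\<^sub>R y \<in> T"
  shows "has_div_on (\<lambda>y. X (x + r *\<^sub>R y)) (\<lambda>y. r * dX (x + r *\<^sub>R y)) S"
proof -
  from assms(1) obtain X' where X': "\<And>x. x \<in> T \<Longrightarrow> (X has_derivative X' x) (at x)"
      "\<And>x. x \<in> T \<Longrightarrow> dX x = (\<Sum>b\<in>Basis. X' x b \<bullet> b)"
      "\<And>b. b \<in> Basis \<Longrightarrow> continuous_on T (\<lambda>x. X' x b)"
    unfolding has_div_on_def by blast
  have 1: "((\<lambda>y. X (x + r *\<^sub>R y)) has_derivative (\<lambda>h. X' (x + r *\<^sub>R y) (r *\<^sub>R h))) (at y)"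
    if "y \<in> S" for y
  proof -
    have "((\<lambda>y. x + r *\<^sub>R y) has_derivative (\<lambda>h. r *\<^sub>R h)) (at y)"
      by (auto intro!: derivative_eq_intros)
    from has_derivative_compose[OF this X'(1)[OF assms(2)[OF that]]] show ?thesis .
  qed
  have lin: "X' (x + r *\<^sub>R y) (r *\<^sub>R h) = r *\<^sub>R X' (x + r *\<^sub>R y) h" if "y \<in> S" for y h
    using X'(1)[OF assms(2)[OF that]] by (simp add: has_derivative_def bounded_linear.linear linear_scale)
  have 2: "((\<lambda>y. X (x + r *\<^sub>R y)) has_derivative (\<lambda>h. r *\<^sub>R X' (x + r *\<^sub>R y) h)) (at y)"
    if "y \<in> S" for y
    using 1[OF that] lin[OF that] by simp
  have 3: "continuous_on S (\<lambda>y. X' (x + r *\<^sub>R y) b)" if "b \<in> Basis" for b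
    by (rule continuous_on_compose2[OF X'(3)[OF that]])
      (use assms(2) in \<open>auto intro!: continuous_intros\<close>)
  show ?thesis
    unfolding has_div_on_def
    by (rule exI[of _ "\<lambda>y h. r *\<^sub>R X' (x + r *\<^sub>R y) h"])
      (use 2 3 in \<open>auto intro!: continuous_on_scaleR continuous_on_const simp: X'(2) assms(2) sum_distrib_left\<close>)
qed

text \<open>Meant for \<open>X = Df\<close>: a directional derivative of a C^2 function is C^1, so
  its weighted means can themselves be differentiated in the radius.\<close>

lemma has_grad_on_component:
  assumes "has_div_on X dX S"
  obtains Dg where "has_grad_on (\<lambda>x. X x \<bullet> v) Dg S"
proof -
  from assms obtain X' where X': "\<And>x. x \<in> S \<Longrightarrow> (X has_derivative X' x) (at x)"
    and c: "\<And>b. b \<in> Basis \<Longrightarrow> continuous_on S (\<lambda>x. X' x b)"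
    unfolding has_div_on_def by blast
  define Dg where "Dg x = (\<Sum>b\<in>Basis. (X' x b \<bullet> v) *\<^sub>R b)" for x
  have "((\<lambda>x. X x \<bullet> v) has_derivative (\<lambda>h. Dg x \<bullet> h)) (at x)" if "x \<in> S" for x
  proof (rule has_derivative_eq_rhs[OF has_derivative_inner_left[OF X'[OF that]]], rule ext)
    fix h
    have lin: "linear (X' x)"
      using X'[OF that] by (simp add: has_derivative_def bounded_linear.linear)
    have "X' x h = X' x (\<Sum>b\<in>Basis. (h \<bullet> b) *\<^sub>R b)"
      by (simp add: euclidean_representation)
    also have "\<dots> = (\<Sum>b\<in>Basis. (h \<bullet> b) *\<^sub>R X' x b)"
      by (simp add: linear_sum[OF lin] linear_scale[OF lin])
    finally show "X' x h \<bullet> v = Dg x \<bullet> h"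
      by (auto simp: Dg_def inner_sum_left inner_commute[of h] mult.commute intro!: sum.cong)
  qed
  moreover have "continuous_on S Dg"
    unfolding Dg_def by (intro continuous_intros c)
  ultimately show ?thesis
    by (intro that[of Dg]) (auto simp: has_grad_on_def)
qed

section \<open>Integration by parts\<close>

lemma integral_lborel_translate:
  fixes f :: "'a::euclidean_space \<Rightarrow> real"
  assumes [measurable]: "f \<in> borel_measurable borel"
  shows "(\<integral>x. f (c + x) \<partial>lborel) = (\<integral>x. f x \<partial>lborel)"
proof -
  have "(\<integral>x. f x \<partial>lborel) = (\<integral>x. f x \<partial>(distr lborel borel ((+) c)))"
    by (simp only: lborel_distr_plus)
  also have "\<dots> = (\<integral>x. f (c + x) \<partial>lborel)"
    by (rule integral_distr) auto
  finally show ?thesis ..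
qed

lemma integrable_compact_support:
  fixes f :: "'a::euclidean_space \<Rightarrow> real"
  assumes "continuous_on UNIV f" "compact K" "\<And>x. x \<notin> K \<Longrightarrow> f x = 0"
  shows "integrable lborel f"
proof -
  have "integrable lborel (\<lambda>x. indicat_real K x *\<^sub>R f x)"
    by (intro borel_integrable_compact continuous_on_subset[OF assms(1)]) (use assms in auto)
  moreover have "(\<lambda>x. indicat_real K x *\<^sub>R f x) = f"
    using assms(3) by (auto simp: indicator_def fun_eq_iff)
  ultimately show ?thesis by simp
qed

lemma bounded_compact_support:
  fixes f :: "'a::euclidean_space \<Rightarrow> real"
  assumes "continuous_on UNIV f" "compact K" "\<And>x. x \<notin> K \<Longrightarrow> f x = 0"
  obtains B where "B \<ge> 0" "\<And>x. \<bar>f x\<bar> \<le> B"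
proof -
  have "compact (f ` K)"
    using assms continuous_on_subset compact_continuous_image by blast
  then obtain B where "\<And>y. y \<in> f ` K \<Longrightarrow> \<bar>y\<bar> \<le> B"
    by (metis bounded_real compact_imp_bounded)
  then have "\<bar>f x\<bar> \<le> max B 0" for x
    using assms(3)[of x] by (cases "x \<in> K") (auto simp: le_max_iff_disj)
  then show ?thesis
    by (intro that[of "max B 0"]) auto
qed

text \<open>The difference quotients of g in the direction b have integral zero by translation invariance.\<close>

lemma integral_directional_derivative_eq_0:
  fixes g :: "'a::euclidean_space \<Rightarrow> real"
  assumes g: "continuous_on UNIV g" and K: "compact K" "\<And>x. x \<notin> K \<Longrightarrow> g x = 0"
    and g': "\<And>x. ((\<lambda>t. g (x + t *\<^sub>R b)) has_real_derivative g' x) (at 0)"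
    and cg': "continuous_on UNIV g'" and g'0: "\<And>x. x \<notin> K \<Longrightarrow> g' x = 0"
  shows "(\<integral>x. g' x \<partial>lborel) = 0"
proof -
  have [measurable]: "g \<in> borel_measurable borel" "g' \<in> borel_measurable borel"
    using g cg' by (auto intro: borel_measurable_continuous_onI)
  obtain B where B: "B \<ge> 0" "\<And>x. \<bar>g' x\<bar> \<le> B"
    using bounded_compact_support[OF cg' K(1) g'0] by blast
  obtain R where R: "\<And>x. x \<in> K \<Longrightarrow> norm x \<le> R"
    using compact_imp_bounded[OF K(1)] by (auto simp: bounded_iff)
  define t :: "nat \<Rightarrow> real" where "t n = 1 / real (Suc n)" for n
  have t: "t n > 0" "t n \<le> 1" for n
    by (auto simp: t_def)
  have t0: "t \<longlonglongrightarrow> 0"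
    unfolding t_def using LIMSEQ_inverse_real_of_nat by (simp add: inverse_eq_divide)
  define s where "s n x = (g (x + t n *\<^sub>R b) - g x) / t n" for n x
  have lim: "(\<lambda>n. s n x) \<longlonglongrightarrow> g' x" for x
  proof -
    have "((\<lambda>h. (g (x + h *\<^sub>R b) - g x) / h) \<longlongrightarrow> g' x) (at 0)"
      using g'[of x] by (simp add: DERIV_def)
    moreover have "filterlim t (at 0) sequentially"
      using t0 t(1) by (auto simp: filterlim_at intro!: always_eventually) (metis less_irrefl)
    ultimately show ?thesis
      unfolding s_def by (rule filterlim_compose)
  qed
  have deriv: "((\<lambda>t. g (x + t *\<^sub>R b)) has_real_derivative g' (x + r *\<^sub>R b)) (at r)" for x r
    using DERIV_shift[of "\<lambda>t. g (x + t *\<^sub>R b)" "g' (x + r *\<^sub>R b)" 0 r] g'[of "x + r *\<^sub>R b"]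
    by (simp add: algebra_simps)
  \<comment> \<open>Dominating function: the mean value theorem bounds the quotient by
    \<open>B\<close>, and since \<open>t n \<le> 1\<close> the quotient vanishes off the ball of
    radius \<open>R + |b|\<close>.\<close>
  have bound: "\<bar>s n x\<bar> \<le> B * indicat_real (cball 0 (R + norm b)) x" for n x
  proof (cases "x \<in> cball 0 (R + norm b)")
    case True
    obtain z where "g (x + t n *\<^sub>R b) - g (x + 0 *\<^sub>R b) = (t n - 0) * g' (x + z *\<^sub>R b)"
      using MVT2[of 0 "t n" "\<lambda>t. g (x + t *\<^sub>R b)" "\<lambda>r. g' (x + r *\<^sub>R b)"] deriv t(1)[of n] by blast
    then have "s n x = g' (x + z *\<^sub>R b)"
      using t(1)[of n] by (simp add: s_def)
    then show ?thesis
      using True B(2) by simp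
  next
    case False
    have nb: "norm (t n *\<^sub>R b) \<le> norm b"
      using t[of n] by (simp add: mult_left_le_one_le)
    have "norm x > R + norm b"
      using False by simp
    moreover have "norm x \<le> norm (x + t n *\<^sub>R b) + norm (t n *\<^sub>R b)"
      by (metis add_diff_cancel norm_triangle_ineq4)
    ultimately have "norm (x + t n *\<^sub>R b) > R" "norm x > R"
      using nb norm_ge_zero[of b] by linarith+
    then have "x \<notin> K" "x + t n *\<^sub>R b \<notin> K"
      using R by force+
    then have "s n x = 0"
      using K(2) by (simp add: s_def)
    then show ?thesis
      using B(1) by simp
  qed
  have int0: "(\<integral>x. s n x \<partial>lborel) = 0" for n
  proof -
    have i: "integrable lborel g"
      using integrable_compact_support[OF g K] .
    have "continuous_on UNIV (\<lambda>x. g (x + t n *\<^sub>R b))"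
      by (rule continuous_on_compose2[OF g]) (auto intro!: continuous_intros)
    then have i2: "integrable lborel (\<lambda>x. g (x + t n *\<^sub>R b))"
      by (rule integrable_compact_support[of _ "(\<lambda>x. - (t n *\<^sub>R b) + x) ` K"])
        (use K in \<open>auto intro!: compact_continuous_image continuous_intros simp: image_iff algebra_simps\<close>)
    have "(\<integral>x. s n x \<partial>lborel) = ((\<integral>x. g (x + t n *\<^sub>R b) \<partial>lborel) - (\<integral>x. g x \<partial>lborel)) / t n"
      unfolding s_def using i i2 by simp
    also have "(\<integral>x. g (x + t n *\<^sub>R b) \<partial>lborel) = (\<integral>x. g x \<partial>lborel)"
      using integral_lborel_translate[of g "t n *\<^sub>R b"] by (simp add: add.commute)
    finally show ?thesis by simp
  qed
  have "(\<lambda>n. \<integral>x. s n x \<partial>lborel) \<longlonglongrightarrow> (\<integral>x. g' x \<partial>lborel)"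
  proof (rule integral_dominated_convergence[where w = "\<lambda>x. B * indicat_real (cball 0 (R + norm b)) x"])
    show "integrable lborel (\<lambda>x. B * indicat_real (cball (0::'a) (R + norm b)) x)"
      using borel_integrable_compact[of "cball (0::'a) (R + norm b)" "\<lambda>x. B"]
      by (simp add: mult.commute)
  qed (use lim bound in \<open>auto simp: s_def\<close>)
  then show ?thesis
    using LIMSEQ_const_iff[of "0::real"] int0 by simp
qed

lemma integral_divergence_eq_0:
  fixes Z :: "'a::euclidean_space \<Rightarrow> 'a"
  assumes Z: "has_div_on Z dZ UNIV" and K: "compact K" "\<And>x. x \<notin> K \<Longrightarrow> Z x = 0"
  shows "(\<integral>x. dZ x \<partial>lborel) = 0"
proof -
  from Z obtain Z' where Z': "\<And>x. (Z has_derivative Z' x) (at x)"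
      "\<And>x. dZ x = (\<Sum>b\<in>Basis. Z' x b \<bullet> b)"
    and c: "\<And>b. b \<in> Basis \<Longrightarrow> continuous_on UNIV (\<lambda>x. Z' x b)"
    unfolding has_div_on_def by blast
  \<comment> \<open>The complement of \<open>K\<close> is open and \<open>Z\<close> vanishes on it,
    so the derivative has support in \<open>K\<close> as well.\<close>
  have Z'0: "Z' x b = 0" if "x \<notin> K" for x b
  proof -
    have "open (- K)"
      using K(1) by (simp add: compact_imp_closed open_Compl)
    then have "((\<lambda>x. 0) has_derivative Z' x) (at x)"
      by (rule has_derivative_transform_within_open[OF Z'(1)]) (use that K in auto)
    then have "Z' x = (\<lambda>h. 0)"
      using has_derivative_unique has_derivative_const by blast
    then show ?thesis by simp
  qed
  have *: "(\<integral>x. Z' x b \<bullet> b \<partial>lborel) = 0" "integrable lborel (\<lambda>x. Z' x b \<bullet> b)" if "b \<in> Basis" for b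
  proof -
    show "integrable lborel (\<lambda>x. Z' x b \<bullet> b)"
      by (rule integrable_compact_support[OF _ K(1)]) (use that Z'0 c in \<open>auto intro!: continuous_intros\<close>)
    show "(\<integral>x. Z' x b \<bullet> b \<partial>lborel) = 0"
    proof (rule integral_directional_derivative_eq_0[where g = "\<lambda>x. Z x \<bullet> b" and b = b, OF _ K(1)])
      show "continuous_on UNIV (\<lambda>x. Z x \<bullet> b)"
        by (intro continuous_intros has_div_on_continuous[OF Z])
      fix x
      have "((\<lambda>t. x + t *\<^sub>R b) has_derivative (\<lambda>t. t *\<^sub>R b)) (at 0)"
        by (auto intro!: derivative_eq_intros)
      from has_derivative_compose[OF this, of Z "Z' x"] Z'(1)[of x]
      have "((\<lambda>t. Z (x + t *\<^sub>R b)) has_derivative (\<lambda>t. Z' x (t *\<^sub>R b))) (at 0)"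
        by simp
      then have "((\<lambda>t. Z (x + t *\<^sub>R b) \<bullet> b) has_derivative (\<lambda>t. Z' x (t *\<^sub>R b) \<bullet> b)) (at 0)"
        by (rule has_derivative_inner_left)
      moreover have "Z' x (t *\<^sub>R b) = t *\<^sub>R Z' x b" for t
        using Z'(1)[of x] by (simp add: has_derivative_def bounded_linear.linear linear_scale)
      ultimately show "((\<lambda>t. Z (x + t *\<^sub>R b) \<bullet> b) has_real_derivative Z' x b \<bullet> b) (at 0)"
        by (auto simp: has_field_derivative_def mult.commute elim!: has_derivative_eq_rhs)
    qed (use c that Z'0 K in \<open>auto intro!: continuous_intros\<close>)
  qed
  have "(\<integral>x. dZ x \<partial>lborel) = (\<integral>x. (\<Sum>b\<in>Basis. Z' x b \<bullet> b) \<partial>lborel)"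
    by (simp add: Z'(2))
  also have "\<dots> = (\<Sum>b\<in>Basis. \<integral>x. Z' x b \<bullet> b \<partial>lborel)"
    by (rule Bochner_Integration.integral_sum) (use * in auto)
  also have "\<dots> = 0"
    using * by simp
  finally show ?thesis .
qed

text \<open>The open sets \<open>S\<close> and \<open>- K\<close> cover the space. On their overlap
  both candidate derivatives are derivatives of the same function, so they agree by uniqueness and
  glue continuously.\<close>

lemma has_div_on_extend_zero:
  fixes Z :: "'a::euclidean_space \<Rightarrow> 'a"
  assumes Z: "has_div_on Z dZ S" and S: "open S" and K: "compact K" "K \<subseteq> S"
    and Z0: "\<And>x. x \<in> S - K \<Longrightarrow> Z x = 0"
  shows "has_div_on (\<lambda>x. if x \<in> K then Z x else 0) (\<lambda>x. if x \<in> K then dZ x else 0) UNIV"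
proof -
  let ?Y = "\<lambda>x. if x \<in> K then Z x else 0"
  from Z obtain Z' where Z': "\<And>x. x \<in> S \<Longrightarrow> (Z has_derivative Z' x) (at x)"
      "\<And>x. x \<in> S \<Longrightarrow> dZ x = (\<Sum>b\<in>Basis. Z' x b \<bullet> b)"
    and c: "\<And>b. b \<in> Basis \<Longrightarrow> continuous_on S (\<lambda>x. Z' x b)"
    unfolding has_div_on_def by blast
  have oK: "open (- K)"
    using K(1) by (simp add: compact_imp_closed open_Compl)
  have d1: "(?Y has_derivative Z' x) (at x)" if "x \<in> S" for x
    by (rule has_derivative_transform_within_open[OF Z'(1)[OF that] S that]) (use Z0 in auto)
  have d2: "(?Y has_derivative (\<lambda>h. 0)) (at x)" if "x \<in> - K" for x
    by (rule has_derivative_transform_within_open[OF has_derivative_const oK that]) auto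
  have eq: "Z' x = (\<lambda>h. 0)" if "x \<in> S - K" for x
    using d1[of x] d2[of x] that has_derivative_unique by blast
  define Y' where "Y' x = (if x \<in> K then Z' x else (\<lambda>h. 0))" for x
  have 1: "(?Y has_derivative Y' x) (at x)" for x
    using d1[of x] d2[of x] K(2) by (auto simp: Y'_def)
  have 2: "continuous_on UNIV (\<lambda>x. Y' x b)" if "b \<in> Basis" for b
  proof -
    have "continuous_on S (\<lambda>x. Y' x b)"
      using c[OF that] by (rule continuous_on_eq) (use eq in \<open>auto simp: Y'_def fun_eq_iff\<close>)
    moreover have "continuous_on (- K) (\<lambda>x. Y' x b)"
      using continuous_on_const by (rule continuous_on_eq[of _ "\<lambda>x. 0"]) (auto simp: Y'_def)
    ultimately have "continuous_on (S \<union> - K) (\<lambda>x. Y' x b)"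
      using S oK by (simp add: continuous_on_open_Un)
    moreover have "S \<union> - K = UNIV"
      using K(2) by auto
    ultimately show ?thesis by simp
  qed
  show ?thesis
    unfolding has_div_on_def
    by (rule exI[of _ Y']) (use 1 2 Z'(2) K(2) in \<open>auto simp: Y'_def\<close>)
qed

text \<open>\<open>K\<close> only carries the support: the product \<open>f X\<close> is zero on
  \<open>S - K\<close>, so its extension by zero is C^1 and no boundary term arises.\<close>

lemma integral_by_parts_divergence:
  fixes X :: "'a::euclidean_space \<Rightarrow> 'a"
  assumes f: "has_grad_on f Df S" and X: "has_div_on X dX S"
    and S: "open S" and K: "compact K" "K \<subseteq> S"
    and 0: "\<And>x. x \<in> S - K \<Longrightarrow> f x *\<^sub>R X x = 0"
  shows "(LINT x:K|lborel. f x * dX x + Df x \<bullet> X x) = 0"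
proof -
  have "(\<integral>x. (if x \<in> K then f x * dX x + Df x \<bullet> X x else 0) \<partial>lborel) = 0"
    by (rule integral_divergence_eq_0[OF has_div_on_extend_zero[OF has_div_on_scaleR[OF f X] S K 0] K(1)])
      auto
  moreover have "(\<lambda>x. if x \<in> K then f x * dX x + Df x \<bullet> X x else 0)
      = (\<lambda>x. indicat_real K x *\<^sub>R (f x * dX x + Df x \<bullet> X x))"
    by (auto simp: fun_eq_iff)
  ultimately show ?thesis
    by (simp add: set_lebesgue_integral_def)
qed

section \<open>Weighted means over balls\<close>

lemma set_integrable_compact:
  fixes f :: "'a::euclidean_space \<Rightarrow> real"
  assumes "compact K" "continuous_on K f"
  shows "set_integrable lborel K f"
  using borel_integrable_compact[OF assms] by (simp add: set_integrable_def)

lemma set_integral_const_compact: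
  fixes K :: "'a::euclidean_space set"
  assumes "compact K"
  shows "(LINT x:K|lborel. c) = c * measure lborel K"
proof -
  have "(LINT x:K|lborel. c) = (LINT x|lborel. indicat_real K x * c)"
    by (simp add: set_lebesgue_integral_def)
  also have "\<dots> = measure lborel K * c"
    using assms by (simp add: borel_compact)
  finally show ?thesis by simp
qed

lemma abs_set_integral_le:
  fixes f :: "'a::euclidean_space \<Rightarrow> real"
  assumes "compact K" "continuous_on K f"
  shows "\<bar>LINT x:K|lborel. f x\<bar> \<le> (LINT x:K|lborel. \<bar>f x\<bar>)"
  using set_integral_norm_bound[OF set_integrable_compact[OF assms]] by simp

lemma set_integral_abs_le_compact:
  fixes f :: "'a::euclidean_space \<Rightarrow> real"
  assumes K: "compact K" and f: "continuous_on K f" and B: "\<And>x. x \<in> K \<Longrightarrow> \<bar>f x\<bar> \<le> B"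
  shows "\<bar>LINT x:K|lborel. f x\<bar> \<le> B * measure lborel K"
proof -
  have "\<bar>LINT x:K|lborel. f x\<bar> \<le> (LINT x:K|lborel. \<bar>f x\<bar>)"
    by (rule abs_set_integral_le[OF K f])
  also have "\<dots> \<le> (LINT x:K|lborel. B)"
    by (intro set_integral_mono set_integrable_compact K continuous_intros f) (use B in auto)
  finally show ?thesis
    by (simp add: set_integral_const_compact K)
qed

lemma set_integral_ge_cball:
  fixes f :: "'a::euclidean_space \<Rightarrow> real"
  assumes f: "set_integrable lborel K f"
    and nonneg: "\<And>x. x \<in> K \<Longrightarrow> 0 \<le> f x" and sub: "cball z d \<subseteq> K"
    and m: "\<And>x. x \<in> cball z d \<Longrightarrow> m \<le> f x"
  shows "m * measure lborel (cball z d) \<le> (LINT x:K|lborel. f x)"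
proof -
  have "m * measure lborel (cball z d) = (LINT x:cball z d|lborel. m)"
    by (simp add: set_integral_const_compact)
  also have "\<dots> \<le> (LINT x:cball z d|lborel. f x)"
    by (intro set_integral_mono set_integrable_compact set_integrable_subset[OF f] continuous_intros)
      (use m sub in auto)
  also have "\<dots> \<le> (LINT x:K|lborel. f x)"
    unfolding set_lebesgue_integral_def
  proof (rule integral_mono)
    show "integrable lborel (\<lambda>x. indicat_real (cball z d) x *\<^sub>R f x)"
      using set_integrable_subset[OF f _ sub] by (simp add: set_integrable_def)
    show "integrable lborel (\<lambda>x. indicat_real K x *\<^sub>R f x)"
      using f by (simp add: set_integrable_def)
    show "indicat_real (cball z d) x *\<^sub>R f x \<le> indicat_real K x *\<^sub>R f x" for x
      using nonneg[of x] sub by (auto simp: indicator_def)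
  qed
  finally show ?thesis .
qed

lemma measure_cball_pos: "0 < d \<Longrightarrow> 0 < measure lborel (cball (z::'a::euclidean_space) d)"
  using content_cball_pos[of d z] by (simp add: measure_completion)

lemma set_integral_affine_cball:
  fixes g :: "'a::euclidean_space \<Rightarrow> real"
  assumes t: "0 < t" and g: "continuous_on (cball x t) g"
  shows "(LINT y:cball 0 1|lborel. g (x + t *\<^sub>R y)) = (LINT z:cball x t|lborel. g z) / t ^ DIM('a)"
proof -
  let ?g = "\<lambda>z. indicat_real (cball x t) z *\<^sub>R g z"
  have [measurable]: "?g \<in> borel_measurable borel"
    by (rule borel_measurable_continuous_on_indicator[OF _ g]) simp
  have m: "(\<lambda>y. x + t *\<^sub>R y) \<in> lborel \<rightarrow>\<^sub>M borel"
    by simp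
  have t0: "t \<noteq> 0" using t by simp
  have "(\<integral>z. ?g z \<partial>lborel)
      = (\<integral>z. ?g z \<partial>(density (distr lborel borel (\<lambda>y. x + t *\<^sub>R y)) (\<lambda>_. ennreal (\<bar>t\<bar> ^ DIM('a)))))"
    using lborel_affine[OF t0, of x] by simp
  also have "\<dots> = (\<integral>z. \<bar>t\<bar> ^ DIM('a) *\<^sub>R ?g z \<partial>(distr lborel borel (\<lambda>y. x + t *\<^sub>R y)))"
    by (rule integral_density) (use t in \<open>auto simp del: real_scaleR_def\<close>)
  also have "\<dots> = (\<integral>y. \<bar>t\<bar> ^ DIM('a) *\<^sub>R ?g (x + t *\<^sub>R y) \<partial>lborel)"
    by (rule integral_distr[OF m]) measurable
  also have "\<dots> = t ^ DIM('a) * (\<integral>y. ?g (x + t *\<^sub>R y) \<partial>lborel)"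
    using t by simp
  also have "(\<lambda>y. ?g (x + t *\<^sub>R y)) = (\<lambda>y. indicat_real (cball 0 1) y *\<^sub>R g (x + t *\<^sub>R y))"
    using t by (auto simp: fun_eq_iff indicator_def dist_norm)
  finally show ?thesis
    using t by (simp add: set_lebesgue_integral_def field_simps)
qed

lemma affine_in_cball: "y \<in> cball 0 1 \<Longrightarrow> 0 \<le> t \<Longrightarrow> t \<le> R \<Longrightarrow> x + t *\<^sub>R y \<in> cball x R"
  for x y :: "'a::real_normed_vector"
  using mult_mono[of t R "norm y" 1] by (simp add: dist_norm)

text \<open>Cauchy--Schwarz, in the form of Young's inequality with the optimal weight.\<close>

lemma set_integral_affine_abs_le:
  fixes g :: "'a::euclidean_space \<Rightarrow> real"
  assumes t: "0 < t" and g: "continuous_on (cball x t) g" and e: "0 < e"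
    and E: "(LINT z:cball x t|lborel. (g z)\<^sup>2) \<le> e\<^sup>2"
  shows "(LINT y:cball 0 1|lborel. \<bar>g (x + t *\<^sub>R y)\<bar>)
    \<le> (1 + measure lborel (cball (0::'a) 1)) * e * t powr (- real DIM('a) / 2)"
proof -
  let ?v = "measure lborel (cball (0::'a) 1)"
  \<comment> \<open>The balancing weight: in \<open>|s| \<le> s^2 / q + q\<close> the first term
    then integrates to at most \<open>e^2 t^-N / q = q\<close>, of the same order as the
    second.\<close>
  define q where "q = e * t powr (- real DIM('a) / 2)"
  have q: "q > 0" using e t by (simp add: q_def)
  have cg: "continuous_on (cball 0 1) (\<lambda>y. g (x + t *\<^sub>R y))"
    by (rule continuous_on_compose2[OF g])
      (use affine_in_cball[of _ t t x] t in \<open>auto intro!: continuous_intros\<close>)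
  have young: "\<bar>s\<bar> \<le> s\<^sup>2 / q + q" for s
  proof -
    have "0 \<le> (\<bar>s\<bar> - q)\<^sup>2 + \<bar>s\<bar> * q"
      using q by simp
    then have "\<bar>s\<bar> * q \<le> s\<^sup>2 + q\<^sup>2"
      by (simp add: power2_diff mult.commute)
    then show ?thesis
      using q by (simp add: field_simps power2_eq_square)
  qed
  have "(LINT y:cball 0 1|lborel. \<bar>g (x + t *\<^sub>R y)\<bar>)
      \<le> (LINT y:cball 0 1|lborel. (g (x + t *\<^sub>R y))\<^sup>2 / q + q)"
    by (intro set_integral_mono set_integrable_compact continuous_intros cg young) (use q in auto)
  also have "\<dots> = (LINT y:cball 0 1|lborel. (g (x + t *\<^sub>R y))\<^sup>2) / q + (LINT y:cball (0::'a) 1|lborel. q)"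
    by (subst set_integral_add) (auto intro!: set_integrable_compact continuous_intros cg simp: q[THEN less_imp_neq, symmetric])
  also have "(LINT y:cball 0 1|lborel. (g (x + t *\<^sub>R y))\<^sup>2)
      = (LINT z:cball x t|lborel. (g z)\<^sup>2) / t ^ DIM('a)"
    by (rule set_integral_affine_cball[OF t]) (intro continuous_intros g)
  also have "\<dots> / q \<le> e\<^sup>2 / t ^ DIM('a) / q"
    using E t q by (intro divide_right_mono) auto
  also have "\<dots> = q"
  proof -
    have "q * q = e\<^sup>2 * (t powr (- real DIM('a) / 2) * t powr (- real DIM('a) / 2))"
      by (simp add: q_def power2_eq_square)
    also have "\<dots> = e\<^sup>2 * t powr (- real DIM('a))"
      by (simp flip: powr_add)
    also have "\<dots> = e\<^sup>2 / t ^ DIM('a)"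
      using t by (simp add: powr_minus powr_realpow divide_inverse)
    finally show ?thesis
      using q by (metis less_irrefl nonzero_eq_divide_eq)
  qed
  also have "(LINT y:cball (0::'a) 1|lborel. q) = q * ?v"
    by (simp add: set_integral_const_compact)
  finally show ?thesis
    by (simp add: q_def algebra_simps)
qed

section \<open>Polynomial cutoffs on the unit ball and means over dilated balls\<close>

lemma has_real_derivative_max_0_power:
  assumes "1 \<le> k"
  shows "((\<lambda>s::real. max 0 s ^ Suc k) has_real_derivative real (Suc k) * max 0 s ^ k) (at s)"
proof -
  consider "s > 0" | "s < 0" | "s = 0" by linarith
  then show ?thesis
  proof cases
    case 1
    have "((\<lambda>s::real. s ^ Suc k) has_real_derivative real (Suc k) * max 0 s ^ k) (at s)"
      using 1 DERIV_pow[of "Suc k" s UNIV] by simp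
    then show ?thesis
      by (rule has_field_derivative_transform_within_open[where S = "{0<..}"]) (use 1 in auto)
  next
    case 2
    have "((\<lambda>s::real. 0) has_real_derivative real (Suc k) * max 0 s ^ k) (at s)"
      using 2 assms by (auto intro!: derivative_eq_intros simp: max_def)
    then show ?thesis
      by (rule has_field_derivative_transform_within_open[where S = "{..<0}"]) (use 2 in auto)
  next
    case 3
    have "((\<lambda>h::real. max 0 h ^ Suc k / h) \<longlongrightarrow> 0) (at 0)"
    proof (rule Lim_null_comparison)
      show "\<forall>\<^sub>F h::real in at 0. norm (max 0 h ^ Suc k / h) \<le> \<bar>h\<bar> ^ k"
        by (rule always_eventually) (auto simp: max_def power_abs)
      have "((\<lambda>h::real. \<bar>h\<bar> ^ k) \<longlongrightarrow> \<bar>0\<bar> ^ k) (at 0)"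
        by (intro tendsto_intros)
      then show "((\<lambda>h::real. \<bar>h\<bar> ^ k) \<longlongrightarrow> 0) (at 0)"
        using assms by (simp add: zero_power)
    qed
    then show ?thesis
      using 3 assms by (simp add: DERIV_def zero_power)
  qed
qed

text \<open>The family is linked by its gradients: that of \<open>bump (k+1)\<close> is a multiple
  of \<open>bump k y *\<^sub>R y\<close>. So \<open>bump 3\<close> times the position field is
  itself a gradient, with a potential that vanishes on the sphere.\<close>

definition bump :: "nat \<Rightarrow> 'a::euclidean_space \<Rightarrow> real" where
  "bump k y = max 0 (1 - y \<bullet> y) ^ k"

lemma continuous_on_bump: "continuous_on S (bump k)"
  unfolding bump_def by (intro continuous_intros)

lemma bump_nonneg: "0 \<le> bump k y"
  and bump_le_1: "bump k y \<le> 1"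
  by (auto simp: bump_def power_le_one)

lemma bump_eq_0: "1 \<le> norm y \<Longrightarrow> 1 \<le> k \<Longrightarrow> bump k y = 0"
  using power_mono[of 1 "norm y" 2] by (simp add: bump_def power2_norm_eq_inner max_def)

lemma has_grad_on_bump:
  assumes "1 \<le> k"
  shows "has_grad_on (bump (Suc k)) (\<lambda>y. (- 2 * real (Suc k) * bump k y) *\<^sub>R y) S"
proof -
  have 1: "has_grad_on (\<lambda>y. 1 - y \<bullet> y) (\<lambda>y. 0 - 2 *\<^sub>R y) S"
    by (intro has_grad_on_diff has_grad_on_const has_grad_on_inner_self)
  have "has_grad_on (\<lambda>y. max 0 (1 - y \<bullet> y) ^ Suc k)
     (\<lambda>y. (real (Suc k) * max 0 (1 - y \<bullet> y) ^ k) *\<^sub>R (0 - 2 *\<^sub>R y)) S"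
    by (rule has_grad_on_compose[OF 1, where \<phi> = "\<lambda>s. max 0 s ^ Suc k" and \<phi>' = "\<lambda>s. real (Suc k) * max 0 s ^ k"])
      (intro has_real_derivative_max_0_power assms continuous_intros)+
  then have "has_grad_on (bump (Suc k))
     (\<lambda>y. (real (Suc k) * max 0 (1 - y \<bullet> y) ^ k) *\<^sub>R (0 - 2 *\<^sub>R y)) S"
    by (simp add: bump_def[abs_def])
  then show ?thesis
    by (rule has_grad_on_cong) (simp add: bump_def algebra_simps)
qed

lemma cball_subset_cbox_One: "cball (0::'a::euclidean_space) 1 \<subseteq> cbox (- One) One"
proof
  fix y :: 'a assume "y \<in> cball 0 1"
  then have "\<bar>y \<bullet> b\<bar> \<le> 1" if "b \<in> Basis" for b
    using Basis_le_norm[OF that, of y] by simp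
  then show "y \<in> cbox (- One) One"
    by (auto simp: mem_box abs_le_iff minus_le_iff)
qed

text \<open>Turns the integral over the ball into one over a box, the form to which the Leibniz rule
  for differentiation under the integral applies.\<close>

lemma set_integral_cball_eq_integral_cbox:
  fixes g :: "'a::euclidean_space \<Rightarrow> real"
  assumes "continuous_on (cball 0 1) g"
  shows "(LINT y:cball 0 1|lborel. g y) = integral (cbox (- One) One) (\<lambda>y. if y \<in> cball 0 1 then g y else 0)"
proof -
  have "(LINT y:cball 0 1|lborel. g y) = integral (cball 0 1) g"
    by (rule set_borel_integral_eq_integral(2)[OF set_integrable_compact]) (use assms in auto)
  also have "\<dots> = integral (cbox (- One) One) (\<lambda>y. if y \<in> cball 0 1 then g y else 0)"
    unfolding integral_restrict_Int using cball_subset_cbox_One[where 'a='a]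
    by (simp add: Int_absorb1 Int_absorb2)
  finally show ?thesis .
qed

text \<open>Since \<open>k\<close> vanishes on the unit sphere, the differentiated integrand
  extended by zero is jointly continuous on the whole box, as the Leibniz rule demands. The radius
  \<open>0\<close> is included so that the value at the centre can be compared with a mean.\<close>

lemma integral_dilation_has_real_derivative:
  fixes f :: "'a::euclidean_space \<Rightarrow> real"
  assumes f: "has_grad_on f Df S" and sub: "cball x R \<subseteq> S"
    and k: "continuous_on UNIV k" and k0: "\<And>y. norm y = 1 \<Longrightarrow> k y = 0" and r: "r \<in> {0..R}"
  shows "((\<lambda>r. LINT y:cball 0 1|lborel. f (x + r *\<^sub>R y) * k y) has_real_derivative
    (LINT y:cball 0 1|lborel. (Df (x + r *\<^sub>R y) \<bullet> y) * k y)) (at r within {0..R})"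
proof -
  let ?B = "cbox (- One) (One::'a)"
  define g where "g t y = (if y \<in> cball 0 1 then f (x + t *\<^sub>R y) * k y else 0)" for t y
  define g' where "g' t y = (if y \<in> cball 0 1 then (Df (x + t *\<^sub>R y) \<bullet> y) * k y else 0)" for t y
  have inS: "x + t *\<^sub>R y \<in> S" if "t \<in> {0..R}" "y \<in> cball 0 1" for t y
    using affine_in_cball[of y t R x] sub that by auto
  have cS: "continuous_on S f" "continuous_on S Df"
    using has_grad_on_continuous[OF f] has_grad_on_continuous_grad[OF f] .
  have ck: "continuous_on T (\<lambda>z. k (h z))" if "continuous_on T h" for T and h :: "'b::topological_space \<Rightarrow> 'a"
    by (rule continuous_on_compose2[OF k that]) auto
  have cont: "continuous_on (cball 0 1) (\<lambda>y. f (x + t *\<^sub>R y) * k y)"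
      "continuous_on (cball 0 1) (\<lambda>y. (Df (x + t *\<^sub>R y) \<bullet> y) * k y)" if "t \<in> {0..R}" for t
    by (intro continuous_intros ck continuous_on_compose2[OF cS(1)] continuous_on_compose2[OF cS(2)];
        use inS[OF that] in force)+
  have "((\<lambda>t. integral ?B (g t)) has_real_derivative integral ?B (g' r)) (at r within {0..R})"
  proof (rule leibniz_rule_field_derivative)
    fix t y assume t: "t \<in> {0..R}"
    show "((\<lambda>t. g t y) has_real_derivative g' t y) (at t within {0..R})"
    proof (cases "y \<in> cball 0 1")
      case True
      have "((\<lambda>t. x + t *\<^sub>R y) has_derivative (\<lambda>h. h *\<^sub>R y)) (at t within {0..R})"
        by (auto intro!: derivative_eq_intros)
      from has_derivative_compose[OF this has_grad_onD[OF f inS[OF t True]]]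
      have "((\<lambda>t. f (x + t *\<^sub>R y)) has_real_derivative (Df (x + t *\<^sub>R y) \<bullet> y)) (at t within {0..R})"
        by (auto simp: has_field_derivative_def mult.commute elim!: has_derivative_eq_rhs)
      then show ?thesis
        using True by (auto simp: g_def g'_def intro!: DERIV_cmult_right)
    next
      case False
      then show ?thesis by (simp add: g_def g'_def)
    qed
  next
    fix t assume t: "t \<in> {0..R}"
    have "(\<lambda>y. f (x + t *\<^sub>R y) * k y) integrable_on cball 0 1"
      by (rule set_borel_integral_eq_integral(1)[OF set_integrable_compact[OF compact_cball cont(1)[OF t]]])
    then show "g t integrable_on ?B"
      unfolding g_def using cball_subset_cbox_One[where 'a='a]
      unfolding integrable_restrict_Int by (simp add: Int_absorb1 Int_absorb2)
  next
    have "continuous_on ({0..R} \<times> ?B) (\<lambda>p. if norm (snd p) \<le> 1 then (Df (x + fst p *\<^sub>R snd p) \<bullet> snd p) * k (snd p) else 0)"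
    proof (rule continuous_on_cases_le)
      show "continuous_on {p \<in> {0..R} \<times> ?B. norm (snd p) \<le> 1} (\<lambda>p. (Df (x + fst p *\<^sub>R snd p) \<bullet> snd p) * k (snd p))"
        by (intro continuous_intros ck continuous_on_compose2[OF cS(2)]) (use inS in force)
    qed (use k0 in \<open>auto intro!: continuous_intros\<close>)
    then show "continuous_on ({0..R} \<times> ?B) (\<lambda>(t, y). g' t y)"
      by (simp add: g'_def case_prod_beta)
  qed (use r in auto)
  moreover have "integral ?B (g t) = (LINT y:cball 0 1|lborel. f (x + t *\<^sub>R y) * k y)"
    if "t \<in> {0..R}" for t
    unfolding g_def by (rule set_integral_cball_eq_integral_cbox[OF cont(1)[OF that], symmetric])
  moreover have "integral ?B (g' r) = (LINT y:cball 0 1|lborel. (Df (x + r *\<^sub>R y) \<bullet> y) * k y)"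
    unfolding g'_def by (rule set_integral_cball_eq_integral_cbox[OF cont(2)[OF r], symmetric])
  ultimately show ?thesis
    unfolding has_field_derivative_def using r
    by (auto intro: has_derivative_transform[where f = "\<lambda>t. integral ?B (g t)"])
qed

lemma open_affine_vimage:
  fixes x :: "'a::real_normed_vector"
  assumes "open S" shows "open {y. x + t *\<^sub>R y \<in> S}"
proof -
  have "continuous_on UNIV (\<lambda>y. x + t *\<^sub>R y)"
    by (intro continuous_intros)
  then show ?thesis
    using open_vimage[OF assms] by (simp add: vimage_def)
qed

lemma norm_eq_1_bump: "norm y = 1 \<Longrightarrow> bump 3 y = 0"
  by (simp add: bump_eq_0)

text \<open>The radial derivative of the mean is a flux: \<open>bump 3 y *\<^sub>R y\<close> is the
  gradient of \<open>- bump 4 / 8\<close>, so integration by parts turns it into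
  \<open>t / 8\<close> times the integral of \<open>bump 4\<close> against the Laplacian.
  Integrating this from \<open>0\<close> to \<open>r\<close> gives the factor
  \<open>r^2\<close>.\<close>

lemma mean_value_laplacian_bound:
  fixes f :: "'a::euclidean_space \<Rightarrow> real"
  assumes f: "has_laplacian_on f Df Lf S" and S: "open S" and sub: "cball x R \<subseteq> S"
    and r: "0 \<le> r" "r \<le> R" and B: "\<And>y. y \<in> cball x R \<Longrightarrow> \<bar>Lf y\<bar> \<le> B"
  shows "\<bar>f x * (LINT y:cball (0::'a) 1|lborel. bump 3 y) - (LINT y:cball 0 1|lborel. f (x + r *\<^sub>R y) * bump 3 y)\<bar>
    \<le> measure lborel (cball (0::'a) 1) * B * r\<^sup>2"
proof -
  have grad: "has_grad_on f Df S" and div: "has_div_on Df Lf S"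
    using f by (auto simp: has_laplacian_on_def)
  let ?v = "measure lborel (cball (0::'a) 1)"
  define F where "F t = (LINT y:cball 0 1|lborel. f (x + t *\<^sub>R y) * bump 3 y)" for t
  define F' where "F' t = (LINT y:cball 0 1|lborel. (Df (x + t *\<^sub>R y) \<bullet> y) * bump 3 y)" for t
  have B0: "0 \<le> B"
    using B[of x] r by simp
  have F': "(F has_real_derivative F' t) (at t within {0..r})" if "t \<in> {0..r}" for t
    unfolding F_def F'_def using that sub r
    by (intro integral_dilation_has_real_derivative[OF grad] continuous_on_bump norm_eq_1_bump) auto
  have bnd: "\<bar>F' t\<bar> \<le> r * B * ?v" if "t \<in> {0..r}" for t
  proof -
    let ?S = "{y. x + t *\<^sub>R y \<in> S}"
    have inc: "x + t *\<^sub>R y \<in> cball x R" if "y \<in> cball 0 1" for y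
      using affine_in_cball[of y t R x] that \<open>t \<in> {0..r}\<close> r by auto
    have K: "cball 0 1 \<subseteq> ?S"
      using inc sub by auto
    have g: "has_grad_on (\<lambda>y. - (1/8) * bump 4 y) (\<lambda>y. bump 3 y *\<^sub>R y) ?S"
      using has_grad_on_cmult[OF has_grad_on_bump[of 3 ?S], of "- (1/8)"] by simp
    have d: "has_div_on (\<lambda>y. Df (x + t *\<^sub>R y)) (\<lambda>y. t * Lf (x + t *\<^sub>R y)) ?S"
      by (rule has_div_on_affine[OF div]) auto
    have "(LINT y:cball 0 1|lborel. - (1/8) * bump 4 y * (t * Lf (x + t *\<^sub>R y)) + (bump 3 y *\<^sub>R y) \<bullet> Df (x + t *\<^sub>R y)) = 0"
      by (rule integral_by_parts_divergence[OF g d open_affine_vimage[OF S] compact_cball K])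
        (auto simp: bump_eq_0)
    moreover have cL: "continuous_on (cball 0 1) (\<lambda>y. Lf (x + t *\<^sub>R y))"
      by (rule continuous_on_compose2[OF has_div_on_continuous_div[OF div]])
        (use K in \<open>auto intro!: continuous_intros\<close>)
    moreover have "continuous_on (cball 0 1) (\<lambda>y. Df (x + t *\<^sub>R y))"
      by (rule continuous_on_compose2[OF has_div_on_continuous[OF div]])
        (use K in \<open>auto intro!: continuous_intros\<close>)
    ultimately have "(LINT y:cball 0 1|lborel. - (1/8) * bump 4 y * (t * Lf (x + t *\<^sub>R y))) + (LINT y:cball 0 1|lborel. (bump 3 y *\<^sub>R y) \<bullet> Df (x + t *\<^sub>R y)) = 0"
      by (subst (asm) set_integral_add)
        (auto intro!: set_integrable_compact continuous_intros continuous_on_bump)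
    then have "F' t = - (LINT y:cball 0 1|lborel. - (1/8) * bump 4 y * (t * Lf (x + t *\<^sub>R y)))"
      by (simp add: F'_def inner_commute mult.commute)
    also have "\<bar>\<dots>\<bar> \<le> r * B * ?v"
      unfolding abs_minus
    proof (rule set_integral_abs_le_compact)
      fix y :: 'a assume y: "y \<in> cball 0 1"
      have "\<bar>- (1/8) * bump 4 y * (t * Lf (x + t *\<^sub>R y))\<bar> = (1/8 * bump 4 y) * (t * \<bar>Lf (x + t *\<^sub>R y)\<bar>)"
        using \<open>t \<in> {0..r}\<close> by (simp add: abs_mult bump_nonneg)
      also have "\<dots> \<le> 1 * (r * B)"
        using \<open>t \<in> {0..r}\<close> B[OF inc[OF y]] B0 bump_le_1[of 4 y] bump_nonneg[of 4 y]
        by (intro mult_mono) auto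
      finally show "\<bar>- (1/8) * bump 4 y * (t * Lf (x + t *\<^sub>R y))\<bar> \<le> r * B" by simp
    qed (auto intro!: continuous_intros continuous_on_bump cL)
    finally show ?thesis .
  qed
  have "norm (F 0 - F r) \<le> (r * B * ?v) * norm (0 - r)"
    by (rule field_differentiable_bound[OF _ F']) (use bnd r in auto)
  moreover have "F 0 = f x * (LINT y:cball (0::'a) 1|lborel. bump 3 y)"
    by (simp add: F_def)
  ultimately show ?thesis
    using r by (simp add: F_def power2_eq_square mult_ac)
qed

text \<open>\<open>F\<close> plus or minus the primitive of the bound is monotone. As
  \<open>t^(-a-1)\<close> is integrable at infinity, the result depends on \<open>r\<close> alone,
  not on the larger radius \<open>R\<close>.\<close>

lemma powr_derivative_bound_imp_diff_bound:
  fixes F :: "real \<Rightarrow> real"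
  assumes "0 < a" "0 < r" "r \<le> R"
    and F': "\<And>t. t \<in> {r..R} \<Longrightarrow> (F has_real_derivative F' t) (at t within {r..R})"
    and b: "\<And>t. t \<in> {r..R} \<Longrightarrow> \<bar>F' t\<bar> \<le> k * t powr (- a - 1)"
  shows "\<bar>F r - F R\<bar> \<le> k / a * r powr (- a)"
proof -
  have k: "0 \<le> k"
    using b[of r] assms(2,3) by (smt (verit) atLeastAtMost_iff powr_gt_zero zero_le_mult_iff)
  have p: "((\<lambda>t. k / a * t powr (- a)) has_real_derivative - (k * t powr (- a - 1))) (at t within {r..R})"
    if "t \<in> {r..R}" for t
    using that assms by (auto intro!: derivative_eq_intros)
  have *: "G r \<le> G R + k / a * r powr (- a)"
    if G': "\<And>t. t \<in> {r..R} \<Longrightarrow> (G has_real_derivative G' t) (at t within {r..R})"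
      and Gb: "\<And>t. t \<in> {r..R} \<Longrightarrow> \<bar>G' t\<bar> \<le> k * t powr (- a - 1)" for G G'
  proof -
    have "G r - k / a * r powr (- a) \<le> G R - k / a * R powr (- a)"
    proof (rule DERIV_nonneg_imp_increasing_open[OF assms(3)])
      fix t assume t: "r < t" "t < R"
      then have i: "at t within {r..R} = at t"
        by (simp add: at_within_Icc_at)
      have "((\<lambda>t. G t - k / a * t powr (- a)) has_real_derivative G' t - - (k * t powr (- a - 1))) (at t)"
        using DERIV_diff[OF G'[of t] p[of t]] t i by simp
      moreover have "G' t - - (k * t powr (- a - 1)) \<ge> 0"
        using Gb[of t] t by simp
      ultimately show "\<exists>y. ((\<lambda>t. G t - k / a * t powr (- a)) has_real_derivative y) (at t) \<and> 0 \<le> y"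
        by blast
    next
      have "continuous_on {r..R} G"
        using DERIV_continuous_on G' by blast
      then show "continuous_on {r..R} (\<lambda>t. G t - k / a * t powr (- a))"
        using assms by (intro continuous_intros) auto
    qed
    moreover have "0 \<le> k / a * R powr (- a)"
      using k assms by simp
    ultimately show ?thesis by simp
  qed
  have "F r \<le> F R + k / a * r powr (- a)"
    by (rule *[OF F' b])
  moreover have "- F r \<le> - F R + k / a * r powr (- a)"
    by (rule *[where G' = "\<lambda>t. - F' t"]) (use F' b in \<open>auto intro!: DERIV_minus\<close>)
  ultimately show ?thesis by linarith
qed

lemma set_integral_mono_set_compact:
  fixes g :: "'a::euclidean_space \<Rightarrow> real"
  assumes "compact K" "compact L" "K \<subseteq> L" "continuous_on L g" "\<And>x. x \<in> L \<Longrightarrow> 0 \<le> g x"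
  shows "(LINT x:K|lborel. g x) \<le> (LINT x:L|lborel. g x)"
  unfolding set_lebesgue_integral_def
proof (rule integral_mono)
  show "integrable lborel (\<lambda>x. indicat_real K x *\<^sub>R g x)"
    by (rule borel_integrable_compact[OF assms(1) continuous_on_subset[OF assms(4,3)]])
  show "integrable lborel (\<lambda>x. indicat_real L x *\<^sub>R g x)"
    by (rule borel_integrable_compact[OF assms(2,4)])
  show "indicat_real K x *\<^sub>R g x \<le> indicat_real L x *\<^sub>R g x" for x
    using assms(3,5) by (auto simp: indicator_def)
qed

text \<open>The scale-invariant bound that replaces the critical Sobolev inequality.\<close>

lemma weighted_mean_energy_bound:
  fixes f :: "'a::euclidean_space \<Rightarrow> real"
  assumes a: "a = (real DIM('a) - 2) / 2" "0 < a"
    and f: "has_grad_on f Df S" and sub: "cball x R \<subseteq> S"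
    and r: "0 < r" "r \<le> R" and e: "0 < e"
    and E1: "(LINT z:cball x R|lborel. (norm (Df z))\<^sup>2) \<le> e\<^sup>2"
    and E2: "(LINT z:cball x R|lborel. (f z)\<^sup>2) \<le> (R * e)\<^sup>2"
  shows "\<bar>LINT y:cball 0 1|lborel. f (x + r *\<^sub>R y) * bump 3 y\<bar>
    \<le> (1 + 1 / a) * (1 + measure lborel (cball (0::'a) 1)) * e * r powr (- a)"
proof -
  let ?v = "measure lborel (cball (0::'a) 1)"
  define F where "F t = (LINT y:cball 0 1|lborel. f (x + t *\<^sub>R y) * bump 3 y)" for t
  define F' where "F' t = (LINT y:cball 0 1|lborel. (Df (x + t *\<^sub>R y) \<bullet> y) * bump 3 y)" for t
  have cS: "continuous_on S f" "continuous_on S Df"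
    using has_grad_on_continuous[OF f] has_grad_on_continuous_grad[OF f] .
  have inS: "x + t *\<^sub>R y \<in> S" if "t \<in> {r..R}" "y \<in> cball 0 1" for t y
    using affine_in_cball[of y t R x] sub that r by auto
  have aff: "continuous_on (cball 0 1) (\<lambda>y. f (x + t *\<^sub>R y))" "continuous_on (cball 0 1) (\<lambda>y. Df (x + t *\<^sub>R y))"
    if "t \<in> {r..R}" for t
    by (rule continuous_on_compose2[OF cS(1)] continuous_on_compose2[OF cS(2)];
        use inS[OF that] in \<open>auto intro!: continuous_intros\<close>)+
  have F': "(F has_real_derivative F' t) (at t within {r..R})" if "t \<in> {r..R}" for t
  proof -
    have "(F has_real_derivative F' t) (at t within {0..R})"
      unfolding F_def F'_def using that sub r
      by (intro integral_dilation_has_real_derivative[OF f] continuous_on_bump norm_eq_1_bump) auto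
    then show ?thesis
      by (rule DERIV_subset) (use r in auto)
  qed
  \<comment> \<open>Only the gradient energy matters below the radius \<open>R\<close>; the power
    \<open>- N / 2 = - a - 1\<close> that it yields is the one integrated in the preceding
    lemma.\<close>
  have bF': "\<bar>F' t\<bar> \<le> ((1 + ?v) * e) * t powr (- a - 1)" if t: "t \<in> {r..R}" for t
  proof -
    have t0: "t > 0" using t r by auto
    have c: "continuous_on (cball x t) (\<lambda>z. norm (Df z))"
      using t by (intro continuous_intros continuous_on_subset[OF cS(2)] order_trans[OF _ sub]) auto
    have cR: "continuous_on (cball x R) (\<lambda>z. norm (Df z))"
      by (intro continuous_intros continuous_on_subset[OF cS(2)] sub)
    have E: "(LINT z:cball x t|lborel. (norm (Df z))\<^sup>2) \<le> e\<^sup>2"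
      by (rule order_trans[OF set_integral_mono_set_compact E1])
        (use t cR in \<open>auto intro!: continuous_intros\<close>)
    have "\<bar>F' t\<bar> \<le> (LINT y:cball 0 1|lborel. \<bar>(Df (x + t *\<^sub>R y) \<bullet> y) * bump 3 y\<bar>)"
      unfolding F'_def
      by (intro abs_set_integral_le compact_cball continuous_intros continuous_on_bump aff t)
    also have "\<dots> \<le> (LINT y:cball 0 1|lborel. \<bar>norm (Df (x + t *\<^sub>R y))\<bar>)"
    proof (intro set_integral_mono set_integrable_compact continuous_intros continuous_on_bump aff t)
      fix y :: 'a assume "y \<in> cball 0 1"
      have "\<bar>(Df (x + t *\<^sub>R y) \<bullet> y) * bump 3 y\<bar> = \<bar>Df (x + t *\<^sub>R y) \<bullet> y\<bar> * bump 3 y"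
        by (simp add: abs_mult bump_nonneg)
      also have "\<dots> \<le> (norm (Df (x + t *\<^sub>R y)) * norm y) * 1"
        by (intro mult_mono Cauchy_Schwarz_ineq2 bump_le_1) (auto simp: bump_nonneg)
      also have "\<dots> \<le> norm (Df (x + t *\<^sub>R y))"
        using \<open>y \<in> cball 0 1\<close> by (simp add: mult_left_le)
      finally show "\<bar>(Df (x + t *\<^sub>R y) \<bullet> y) * bump 3 y\<bar> \<le> \<bar>norm (Df (x + t *\<^sub>R y))\<bar>" by simp
    qed auto
    also have "\<dots> \<le> (1 + ?v) * e * t powr (- real DIM('a) / 2)"
      by (rule set_integral_affine_abs_le[OF t0 c e E])
    also have "- real DIM('a) / 2 = - a - 1"
      by (simp add: a field_simps)
    finally show ?thesis .
  qed
  have "\<bar>F r - F R\<bar> \<le> ((1 + ?v) * e) / a * r powr (- a)"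
    by (rule powr_derivative_bound_imp_diff_bound[OF a(2) r F' bF'])
  \<comment> \<open>The \<open>L^2\<close> bound is used at the single radius \<open>R\<close>,
    where its factor \<open>R\<close> lifts \<open>R^(-N/2)\<close> to \<open>R^-a\<close>, which is
    at most \<open>r^-a\<close>.\<close>
  moreover have "\<bar>F R\<bar> \<le> (1 + ?v) * e * r powr (- a)"
  proof -
    have R: "R \<in> {r..R}" "R > 0" using r by auto
    have "\<bar>F R\<bar> \<le> (LINT y:cball 0 1|lborel. \<bar>f (x + R *\<^sub>R y) * bump 3 y\<bar>)"
      unfolding F_def
      by (intro abs_set_integral_le compact_cball continuous_intros continuous_on_bump aff R(1))
    also have "\<dots> \<le> (LINT y:cball 0 1|lborel. \<bar>f (x + R *\<^sub>R y)\<bar>)"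
      by (intro set_integral_mono set_integrable_compact continuous_intros continuous_on_bump aff R(1))
        (auto simp: abs_mult bump_nonneg bump_le_1 mult_left_le)
    also have "\<dots> \<le> (1 + ?v) * (R * e) * R powr (- real DIM('a) / 2)"
      by (rule set_integral_affine_abs_le[OF R(2) continuous_on_subset[OF cS(1) sub] _ E2])
        (use R(2) e in auto)
    also have "\<dots> = (1 + ?v) * e * R powr (- a)"
    proof -
      have "R * R powr (- real DIM('a) / 2) = R powr (1 + - real DIM('a) / 2)"
        using R(2) by (simp only: powr_add powr_one)
      also have "1 + - real DIM('a) / 2 = - a"
        by (simp add: a field_simps)
      finally show ?thesis by (simp add: mult_ac)
    qed
    also have "\<dots> \<le> (1 + ?v) * e * r powr (- a)"
      using r a e by (intro mult_left_mono powr_mono2') auto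
    finally show ?thesis .
  qed
  ultimately have "\<bar>F r\<bar> \<le> ((1 + ?v) * e) / a * r powr (- a) + (1 + ?v) * e * r powr (- a)"
    by linarith
  also have "\<dots> = (1 + 1 / a) * (1 + ?v) * e * r powr (- a)"
    by (simp add: algebra_simps add_divide_distrib)
  finally show ?thesis by (simp add: F_def)
qed

lemma integral_bump_pos: "0 < (LINT y:cball (0::'a::euclidean_space) 1|lborel. bump k y)"
proof -
  have "(3/4) ^ k * measure lborel (cball (0::'a) (1/2)) \<le> (LINT y:cball (0::'a) 1|lborel. bump k y)"
  proof (rule set_integral_ge_cball)
    fix y :: 'a assume "y \<in> cball 0 (1/2)"
    then have "(norm y)\<^sup>2 \<le> (1/2)\<^sup>2"
      by (intro power_mono) auto
    then have "y \<bullet> y \<le> 1/4"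
      unfolding power2_norm_eq_inner by (simp add: power2_eq_square)
    then show "(3/4) ^ k \<le> bump k y"
      unfolding bump_def by (intro power_mono) auto
  qed (auto intro!: set_integrable_compact continuous_on_bump simp: bump_nonneg)
  moreover have "0 < (3/4) ^ k * measure lborel (cball (0::'a) (1/2))"
    by (simp add: measure_cball_pos)
  ultimately show ?thesis by linarith
qed

text \<open>Three radii with separate roles: the energy is measured on \<open>R\<close>, the
  Laplacian is bounded on \<open>s\<close>, and \<open>r\<close> stays free. A small
  \<open>r\<close> makes the Laplacian term absorbable, at the price \<open>r^-a\<close> in the
  energy term.\<close>

lemma pointwise_bound_by_energy_and_laplacian:
  assumes a: "a = (real DIM('a::euclidean_space) - 2) / 2" "0 < a"
  obtains C where "0 < C" and
    "\<And>(f::'a \<Rightarrow> real) Df Lf S x R s B r e.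
      \<lbrakk>has_laplacian_on f Df Lf S; open S; cball x R \<subseteq> S; s \<le> R;
       \<And>y. y \<in> cball x s \<Longrightarrow> \<bar>Lf y\<bar> \<le> B; 0 < r; r \<le> s; 0 < e;
       (LINT z:cball x R|lborel. (norm (Df z))\<^sup>2) \<le> e\<^sup>2;
       (LINT z:cball x R|lborel. (f z)\<^sup>2) \<le> (R * e)\<^sup>2\<rbrakk>
      \<Longrightarrow> \<bar>f x\<bar> \<le> C * e * r powr (- a) + C * B * r\<^sup>2"
proof -
  let ?v = "measure lborel (cball (0::'a) 1)"
  define c where "c = (LINT y:cball (0::'a) 1|lborel. bump 3 y)"
  have c: "c > 0" unfolding c_def by (rule integral_bump_pos)
  define k where "k = (1 + 1 / a) * (1 + ?v)"
  have k: "?v \<le> k" "0 < k"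
    using a by (auto simp: k_def algebra_simps intro!: add_pos_nonneg divide_nonneg_nonneg)
  show ?thesis
  proof (rule that[of "k / c"])
    fix f :: "'a \<Rightarrow> real" and Df Lf S x R s B r e
    assume *: "has_laplacian_on f Df Lf S" "open S" "cball x R \<subseteq> S" "s \<le> R"
      "\<And>y. y \<in> cball x s \<Longrightarrow> \<bar>Lf y\<bar> \<le> B" "0 < r" "r \<le> s" "0 < e"
      "(LINT z:cball x R|lborel. (norm (Df z))\<^sup>2) \<le> e\<^sup>2"
      "(LINT z:cball x R|lborel. (f z)\<^sup>2) \<le> (R * e)\<^sup>2"
    have B: "0 \<le> B" using *(5)[of x] *(6,7) by simp
    have sub: "cball x s \<subseteq> S" using *(3,4) by auto
    have 1: "\<bar>f x * c - (LINT y:cball 0 1|lborel. f (x + r *\<^sub>R y) * bump 3 y)\<bar> \<le> ?v * B * r\<^sup>2"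
      unfolding c_def by (rule mean_value_laplacian_bound[OF *(1,2) sub]) (use * in auto)
    have 2: "\<bar>LINT y:cball 0 1|lborel. f (x + r *\<^sub>R y) * bump 3 y\<bar> \<le> k * e * r powr (- a)"
      unfolding k_def using * by (intro weighted_mean_energy_bound[OF a _ *(3)]) (auto simp: has_laplacian_on_def)
    have "\<bar>f x\<bar> * c = \<bar>f x * c\<bar>"
      using c by (simp add: abs_mult)
    also have "\<dots> \<le> k * e * r powr (- a) + ?v * B * r\<^sup>2"
      using 1 2 by linarith
    also have "\<dots> \<le> k * e * r powr (- a) + k * B * r\<^sup>2"
      using k B by (intro add_left_mono mult_right_mono) auto
    finally show "\<bar>f x\<bar> \<le> k / c * e * r powr (- a) + k / c * B * r\<^sup>2"
      using c by (simp add: field_simps)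
  qed (use k c in auto)
qed

section \<open>Small-energy regularity and the gradient estimate\<close>

text \<open>Point picking: at a maximum of \<open>(R - |y - x|)\<^sup>a |f y|\<close> the function is comparable to its
  value there on a ball of the relevant radius, so the mean value estimate applies.\<close>

lemma small_energy_regularity:
  fixes L :: real
  assumes a: "a = (real DIM('a::euclidean_space) - 2) / 2" "0 < a" and L: "0 \<le> L"
  obtains C where "0 < C" and
    "\<And>(f::'a \<Rightarrow> real) Df Lf S x R e.
      \<lbrakk>has_laplacian_on f Df Lf S; open S; cball x (2 * R) \<subseteq> S; 0 < R; 0 < e; C * e < 1;
       \<And>y. y \<in> cball x R \<Longrightarrow> \<bar>Lf y\<bar> \<le> L / R\<^sup>2 * \<bar>f y\<bar> + \<bar>f y\<bar> powr (1 + 2 / a);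
       (LINT z:cball x (2 * R)|lborel. (norm (Df z))\<^sup>2) \<le> e\<^sup>2;
       (LINT z:cball x (2 * R)|lborel. (f z)\<^sup>2) \<le> (R * e)\<^sup>2\<rbrakk>
      \<Longrightarrow> R powr a * \<bar>f x\<bar> \<le> C * e"
proof -
  obtain K where K: "0 < K" and est: "\<And>(f::'a \<Rightarrow> real) Df Lf S x R s B r e.
      \<lbrakk>has_laplacian_on f Df Lf S; open S; cball x R \<subseteq> S; s \<le> R;
       \<And>y. y \<in> cball x s \<Longrightarrow> \<bar>Lf y\<bar> \<le> B; 0 < r; r \<le> s; 0 < e;
       (LINT z:cball x R|lborel. (norm (Df z))\<^sup>2) \<le> e\<^sup>2;
       (LINT z:cball x R|lborel. (f z)\<^sup>2) \<le> (R * e)\<^sup>2\<rbrakk>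
      \<Longrightarrow> \<bar>f x\<bar> \<le> K * e * r powr (- a) + K * B * r\<^sup>2"
    using pointwise_bound_by_energy_and_laplacian[OF a] by blast
  \<comment> \<open>\<open>D\<close> is the loss when the distance to the sphere of radius
    \<open>R\<close> is halved. \<open>Q\<close> collects both terms of the Laplacian bound for a
    function of size at most \<open>D M\<close>, and \<open>\<theta>\<close> is small enough that
    the resulting term is at most half of \<open>M\<close>.\<close>
  define D where "D = 2 powr a"
  define Q where "Q = L * D + D powr (1 + 2 / a)"
  define \<theta> where "\<theta> = sqrt (1 / (2 * (1 + K * Q)))"
  define C where "C = 2 * K / \<theta> powr a * D"
  have D: "1 \<le> D" using a by (simp add: D_def ge_one_powr_ge_zero)
  have Q: "0 \<le> Q" using L D by (simp add: Q_def)
  have pos: "0 < 1 + K * Q" using K Q by (simp add: add_pos_nonneg)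
  have \<theta>: "0 < \<theta>" "\<theta> \<le> 1" and \<theta>2: "K * Q * \<theta>\<^sup>2 \<le> 1 / 2"
  proof -
    show "0 < \<theta>" using pos by (simp add: \<theta>_def)
    show "\<theta> \<le> 1"
      unfolding \<theta>_def by (rule real_le_lsqrt) (use K Q pos in auto)
    have "\<theta>\<^sup>2 = 1 / (2 * (1 + K * Q))"
      unfolding \<theta>_def using pos by simp
    then have "\<theta>\<^sup>2 * (1 + K * Q) = 1 / 2"
      using pos by simp
    then have "K * Q * \<theta>\<^sup>2 = 1 / 2 - \<theta>\<^sup>2"
      by (simp add: algebra_simps)
    then show "K * Q * \<theta>\<^sup>2 \<le> 1 / 2"
      by simp
  qed
  show ?thesis
  proof (rule that[of C])
    show "0 < C" using K \<theta> D by (simp add: C_def)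
  next
    fix f :: "'a \<Rightarrow> real" and Df Lf S x R e
    assume f: "has_laplacian_on f Df Lf S" and S: "open S" and sub: "cball x (2 * R) \<subseteq> S"
      and R: "0 < R" and e: "0 < e" "C * e < 1"
      and Lf: "\<And>y. y \<in> cball x R \<Longrightarrow> \<bar>Lf y\<bar> \<le> L / R\<^sup>2 * \<bar>f y\<bar> + \<bar>f y\<bar> powr (1 + 2 / a)"
      and E1: "(LINT z:cball x (2 * R)|lborel. (norm (Df z))\<^sup>2) \<le> e\<^sup>2"
      and E2: "(LINT z:cball x (2 * R)|lborel. (f z)\<^sup>2) \<le> (R * e)\<^sup>2"
    have cS: "continuous_on S f" "continuous_on S Df"
      using f has_grad_on_continuous has_grad_on_continuous_grad by (auto simp: has_laplacian_on_def)
    have c2: "continuous_on (cball x (2 * R)) f" "continuous_on (cball x (2 * R)) Df"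
      using cS sub continuous_on_subset by blast+
    show "R powr a * \<bar>f x\<bar> \<le> C * e"
    proof (cases "f x = 0")
      case True
      then show ?thesis using e K \<theta> D by (simp add: C_def)
    next
      case False
      define g where "g y = (R - dist x y) powr a * \<bar>f y\<bar>" for y
      have "continuous_on (cball x R) g"
        unfolding g_def using a R
        by (intro continuous_intros continuous_on_powr' continuous_on_subset[OF c2(1)]) auto
      then obtain y0 where y0: "y0 \<in> cball x R" "\<And>y. y \<in> cball x R \<Longrightarrow> g y \<le> g y0"
        using continuous_attains_sup[OF compact_cball, of x R g] R by auto
      have g0: "R powr a * \<bar>f x\<bar> \<le> g y0"
        using y0(2)[of x] R by (simp add: g_def)
      define s where "s = (R - dist x y0) / 2"
      define M where "M = \<bar>f y0\<bar>"
      have "0 < g y0"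
        using g0 R False by (smt (verit) mult_pos_pos powr_gt_zero zero_less_abs_iff)
      then have "R - dist x y0 \<noteq> 0" "0 < M"
        unfolding g_def M_def by (auto simp: zero_less_mult_iff)
      then have M: "0 < M" and "dist x y0 < R"
        using y0(1) by auto
      then have s: "0 < s" "s \<le> R" and s2: "R - dist x y0 = 2 * s"
        using R zero_le_dist[of x y0] unfolding s_def by (simp_all add: field_simps del: zero_le_dist)
      have gy0: "g y0 = D * (M * s powr a)"
        unfolding g_def s2 M_def[symmetric] D_def using s by (simp add: powr_mult)
      have fy: "\<bar>f y\<bar> \<le> D * M" and yR: "y \<in> cball x R" if "y \<in> cball y0 s" for y
      proof -
        have d: "dist x y \<le> R - s"
          using that s2 dist_triangle[of x y y0] by simp
        then show "y \<in> cball x R" using s by simp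
        then have "g y \<le> D * (M * s powr a)"
          using y0(2) gy0 by simp
        moreover have "s powr a * \<bar>f y\<bar> \<le> g y"
          unfolding g_def using d s a by (intro mult_right_mono powr_mono2) auto
        ultimately have "s powr a * \<bar>f y\<bar> \<le> s powr a * (D * M)"
          by (simp add: mult_ac)
        then show "\<bar>f y\<bar> \<le> D * M"
          using s by simp
      qed
      define B where "B = L / R\<^sup>2 * (D * M) + (D * M) powr (1 + 2 / a)"
      have B: "\<bar>Lf y\<bar> \<le> B" if "y \<in> cball y0 s" for y
        unfolding B_def
        by (rule order_trans[OF Lf[OF yR[OF that]]])
          (use fy[OF that] L a in \<open>intro add_mono mult_left_mono powr_mono2, auto\<close>)
      \<comment> \<open>The natural length of a solution of height \<open>M\<close>:
        \<open>M^(1 + 2/a) q^2 = M\<close>. Taking \<open>r\<close> below \<open>\<theta> q\<close>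
        controls the power term, and below \<open>\<theta> s\<close>, hence below
        \<open>\<theta> R\<close>, the linear term.\<close>
      define q where "q = M powr (- 1 / a)"
      have q: "0 < q" using M by (simp add: q_def)
      define r where "r = \<theta> * min s q"
      have r: "0 < r" "r \<le> s" "r \<le> \<theta> * q" "r \<le> \<theta> * R"
        using \<theta> s q by (auto simp: r_def mult_le_one min_le_iff_disj intro: mult_left_le_one_le order_trans[OF mult_right_mono[OF \<theta>(2)]])
      have subR: "cball y0 R \<subseteq> cball x (2 * R)"
      proof
        fix y assume "y \<in> cball y0 R"
        then show "y \<in> cball x (2 * R)"
          using y0(1) dist_triangle[of x y y0] by simp
      qed
      have main: "\<bar>f y0\<bar> \<le> K * e * r powr (- a) + K * B * r\<^sup>2"
      proof (rule est[OF f S _ s(2) B r(1,2) e(1)])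
        show "cball y0 R \<subseteq> S" using subR sub by blast
        show "(LINT z:cball y0 R|lborel. (norm (Df z))\<^sup>2) \<le> e\<^sup>2"
          by (rule order_trans[OF set_integral_mono_set_compact E1])
            (use subR c2 in \<open>auto intro!: continuous_intros\<close>)
        show "(LINT z:cball y0 R|lborel. (f z)\<^sup>2) \<le> (R * e)\<^sup>2"
          by (rule order_trans[OF set_integral_mono_set_compact E2])
            (use subR c2 in \<open>auto intro!: continuous_intros\<close>)
      qed
      have "B * r\<^sup>2 \<le> Q * \<theta>\<^sup>2 * M"
      proof -
        have "r\<^sup>2 \<le> \<theta>\<^sup>2 * R\<^sup>2"
          using r(1,4) by (metis less_imp_le power_mono power_mult_distrib)
        then have 1: "L / R\<^sup>2 * (D * M) * r\<^sup>2 \<le> L / R\<^sup>2 * (D * M) * (\<theta>\<^sup>2 * R\<^sup>2)"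
          using L D M by (intro mult_left_mono) auto
        have "r\<^sup>2 \<le> \<theta>\<^sup>2 * q\<^sup>2"
          using r(1,3) by (metis less_imp_le power_mono power_mult_distrib)
        then have 2: "(D * M) powr (1 + 2 / a) * r\<^sup>2 \<le> (D * M) powr (1 + 2 / a) * (\<theta>\<^sup>2 * q\<^sup>2)"
          by (intro mult_left_mono) auto
        have "q\<^sup>2 = M powr (- 2 / a)"
          using M by (simp add: q_def powr_power)
        then have "M powr (1 + 2 / a) * q\<^sup>2 = M powr (1 + 2 / a + - 2 / a)"
          by (simp only: powr_add)
        then have "M powr (1 + 2 / a) * q\<^sup>2 = M"
          using M by simp
        then have 3: "(D * M) powr (1 + 2 / a) * (\<theta>\<^sup>2 * q\<^sup>2) = D powr (1 + 2 / a) * \<theta>\<^sup>2 * M"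
          using D M by (simp add: powr_mult mult_ac)
        have 4: "L / R\<^sup>2 * (D * M) * (\<theta>\<^sup>2 * R\<^sup>2) = L * D * \<theta>\<^sup>2 * M"
          using R by simp
        show ?thesis
          using 1 2 unfolding 3 4 by (simp add: B_def Q_def algebra_simps)
      qed
      then have "K * (B * r\<^sup>2) \<le> K * (Q * \<theta>\<^sup>2 * M)"
        using K by (intro mult_left_mono) auto
      also have "\<dots> = (K * Q * \<theta>\<^sup>2) * M" by simp
      also have "\<dots> \<le> 1 / 2 * M"
        using \<theta>2 M by (intro mult_right_mono) auto
      finally have "M \<le> 2 * K * e * r powr (- a)"
        using main by (simp add: M_def mult_ac)
      then have "M * r powr a \<le> 2 * K * e * r powr (- a) * r powr a"
        by (intro mult_right_mono) auto
      also have "\<dots> = 2 * K * e"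
        using r by (simp add: powr_minus)
      finally have "M * r powr a \<le> 2 * K * e" .
      moreover have "r powr a = \<theta> powr a * min s q powr a"
        using \<theta> s q by (simp add: r_def powr_mult)
      ultimately have "M * min s q powr a \<le> 2 * K / \<theta> powr a * e"
        using \<theta> by (simp add: field_simps)
      then have "D * (M * min s q powr a) \<le> D * (2 * K / \<theta> powr a * e)"
        using D by (intro mult_left_mono) auto
      then have *: "D * (M * min s q powr a) \<le> C * e"
        by (simp add: C_def mult_ac)
      \<comment> \<open>Here small energy decides. If \<open>q\<close> were the smaller length, then
        \<open>M q^a = 1\<close> and the estimate would read \<open>D \<le> C * e < 1\<close>,
        although \<open>D\<close> is at least \<open>1\<close>.\<close>
      have "s \<le> q"
      proof (rule ccontr)
        assume "\<not> s \<le> q"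
        then have "min s q powr a = M powr (- 1 / a * a)"
          by (simp add: q_def powr_powr min_def)
        also have "\<dots> = 1 / M"
          using M a(2) by (simp add: powr_minus_divide)
        finally have "min s q powr a = 1 / M" .
        then have "D \<le> C * e" using * M by simp
        then show False using D e by simp
      qed
      then have "g y0 \<le> C * e"
        using * gy0 by (simp add: min_def)
      then show ?thesis using g0 by simp
    qed
  qed
qed

text \<open>The weighted mean of \<open>Df \<bullet> b\<close> is \<open>Df x \<bullet> b\<close>
  times a constant at radius \<open>0\<close>, and at radius \<open>R\<close> one integration by
  parts expresses it through \<open>f\<close>. Its change in between involves all second derivatives
  of \<open>f\<close>; the point is to rewrite that change through the Laplacian only, without third
  derivatives of \<open>f\<close>.\<close>

lemma gradient_estimate_direction:
  fixes f :: "'a::euclidean_space \<Rightarrow> real"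
  assumes f: "has_laplacian_on f Df Lf S" and S: "open S" and sub: "cball x R \<subseteq> S" and R: "0 < R"
    and A: "\<And>y. y \<in> cball x R \<Longrightarrow> \<bar>f y\<bar> \<le> A" and B: "\<And>y. y \<in> cball x R \<Longrightarrow> \<bar>Lf y\<bar> \<le> B"
    and b: "norm b = 1"
  shows "\<bar>Df x \<bullet> b\<bar> * (LINT y:cball (0::'a) 1|lborel. bump 3 y)
    \<le> (6 * A / R + B * R) * measure lborel (cball (0::'a) 1)"
proof -
  have grad: "has_grad_on f Df S" and div: "has_div_on Df Lf S"
    using f by (auto simp: has_laplacian_on_def)
  let ?v = "measure lborel (cball (0::'a) 1)"
  let ?N = "real DIM('a)"
  obtain Dg where Dg: "has_grad_on (\<lambda>x. Df x \<bullet> b) Dg S"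
    using has_grad_on_component[OF div] by blast
  define G where "G t = (LINT y:cball 0 1|lborel. (Df (x + t *\<^sub>R y) \<bullet> b) * bump 3 y)" for t
  define G' where "G' t = (LINT y:cball 0 1|lborel. (Dg (x + t *\<^sub>R y) \<bullet> y) * bump 3 y)" for t
  have A0: "0 \<le> A" and B0: "0 \<le> B" using A[of x] B[of x] R by auto
  have G': "(G has_real_derivative G' t) (at t within {0..R})" if "t \<in> {0..R}" for t
    unfolding G_def G'_def using that sub
    by (intro integral_dilation_has_real_derivative[OF Dg] continuous_on_bump norm_eq_1_bump) auto
  have bump3: "has_grad_on (bump 3) (\<lambda>y. (- 6 * bump 2 y) *\<^sub>R y) T" for T :: "'a set"
    using has_grad_on_bump[of 2 T] by simp
  have bump2: "has_grad_on (bump 2) (\<lambda>y. (- 4 * bump 1 y) *\<^sub>R y) T" for T :: "'a set"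
    using has_grad_on_bump[of 1 T] by (simp add: numeral_2_eq_2[symmetric])
  have inc: "x + t *\<^sub>R y \<in> cball x R" if "y \<in> cball 0 1" "t \<in> {0..R}" for y t
    using affine_in_cball[of y t R x] that by auto
  note cb = continuous_on_bump
  note split = set_integral_add[OF set_integrable_compact[OF compact_cball] set_integrable_compact[OF compact_cball]]
  have cont: "continuous_on (cball 0 1) (\<lambda>y. f (x + t *\<^sub>R y))"
      "continuous_on (cball 0 1) (\<lambda>y. Df (x + t *\<^sub>R y))"
      "continuous_on (cball 0 1) (\<lambda>y. Lf (x + t *\<^sub>R y))"
      "continuous_on (cball 0 1) (\<lambda>y. Dg (x + t *\<^sub>R y))" if "t \<in> {0..R}" for t
    by (rule continuous_on_compose2[OF has_grad_on_continuous[OF grad]]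
          continuous_on_compose2[OF has_grad_on_continuous_grad[OF grad]]
          continuous_on_compose2[OF has_div_on_continuous_div[OF div]]
          continuous_on_compose2[OF has_grad_on_continuous_grad[OF Dg]];
        use inc[OF _ that] sub in \<open>auto intro!: continuous_intros\<close>)+
  have G'_eq: "G' t = (LINT y:cball 0 1|lborel. Lf (x + t *\<^sub>R y) * (bump 3 y * (y \<bullet> b)))"
    if t: "t \<in> {0<..R}" for t
  proof -
    let ?S = "{y. x + t *\<^sub>R y \<in> S}"
    have t': "t \<in> {0..R}" "0 < t" using t by auto
    have K: "cball 0 1 \<subseteq> ?S" using inc[OF _ t'(1)] sub by auto
    have oS: "open ?S" by (rule open_affine_vimage[OF S])
    note ibp = integral_by_parts_divergence[OF _ _ oS compact_cball K]
    note c = cont[OF t'(1)]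
    have gf: "has_grad_on (\<lambda>y. f (x + t *\<^sub>R y)) (\<lambda>y. t *\<^sub>R Df (x + t *\<^sub>R y)) ?S"
      by (rule has_grad_on_affine[OF grad]) auto
    have gg: "has_grad_on (\<lambda>y. Df (x + t *\<^sub>R y) \<bullet> b) (\<lambda>y. t *\<^sub>R Dg (x + t *\<^sub>R y)) ?S"
      by (rule has_grad_on_affine[OF Dg]) auto
    have dD: "has_div_on (\<lambda>y. Df (x + t *\<^sub>R y)) (\<lambda>y. t * Lf (x + t *\<^sub>R y)) ?S"
      by (rule has_div_on_affine[OF div]) auto
    \<comment> \<open>With \<open>\<psi> = - bump 4 / 8\<close> these are
      \<open>q = \<Delta> \<psi>\<close>, \<open>m = b \<bullet> \<nabla>\<psi>\<close>,
      \<open>Dm = \<nabla>m\<close>, and \<open>w\<close> is the directional derivative of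
      \<open>q\<close> along \<open>b\<close>. Since that derivative commutes with the Laplacian,
      \<open>w\<close> is also the divergence of \<open>Dm\<close>. So moving two derivatives onto
      the cutoff gives the integral of \<open>f w\<close> both from \<open>t^2 G'\<close> and from
      \<open>t^2\<close> times the integral of \<open>Lf m\<close>. The exponent \<open>3\<close>
      leaves \<open>w\<close> continuous.\<close>
    define q where "q y = ?N * bump 3 y - 6 * bump 2 y * (y \<bullet> y)" for y :: 'a
    define m where "m y = bump 3 y * (y \<bullet> b)" for y :: 'a
    define Dm where "Dm y = bump 3 y *\<^sub>R b + (y \<bullet> b) *\<^sub>R ((- 6 * bump 2 y) *\<^sub>R y)" for y :: 'a
    define w where "w y = (y \<bullet> b) * (24 * bump 1 y * (y \<bullet> y) - (6 * ?N + 12) * bump 2 y)" for y :: 'a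
    have cq: "continuous_on T q" "continuous_on T m" "continuous_on T w" "continuous_on T Dm" for T
      unfolding q_def m_def w_def Dm_def by (intro continuous_intros cb)+
    have dY: "has_div_on (\<lambda>y. bump 3 y *\<^sub>R y) q ?S"
      by (rule has_div_on_cong[OF has_div_on_scaleR[OF bump3 has_div_on_id]]) (simp add: q_def)
    have gq: "has_grad_on q (\<lambda>y. (24 * bump 1 y * (y \<bullet> y) - (6 * ?N + 12) * bump 2 y) *\<^sub>R y) ?S"
    proof -
      have "has_grad_on (\<lambda>y. ?N * bump 3 y - 6 * (bump 2 y * (y \<bullet> y)))
        (\<lambda>y. ?N *\<^sub>R ((- 6 * bump 2 y) *\<^sub>R y) - 6 *\<^sub>R (bump 2 y *\<^sub>R (2 *\<^sub>R y) + (y \<bullet> y) *\<^sub>R ((- 4 * bump 1 y) *\<^sub>R y))) ?S"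
        by (intro has_grad_on_diff has_grad_on_cmult has_grad_on_mult bump3 bump2 has_grad_on_inner_self)
      then have "has_grad_on q
        (\<lambda>y. ?N *\<^sub>R ((- 6 * bump 2 y) *\<^sub>R y) - 6 *\<^sub>R (bump 2 y *\<^sub>R (2 *\<^sub>R y) + (y \<bullet> y) *\<^sub>R ((- 4 * bump 1 y) *\<^sub>R y))) ?S"
        by (simp add: q_def[abs_def] mult.assoc)
      then show ?thesis
        by (rule has_grad_on_cong) (simp add: algebra_simps flip: scaleR_add_left)
    qed
    have dqb: "has_div_on (\<lambda>y. q y *\<^sub>R b) w ?S"
      by (rule has_div_on_cong[OF has_div_on_scaleR[OF gq has_div_on_const]]) (simp add: w_def)
    have gm: "has_grad_on m Dm ?S"
      unfolding m_def Dm_def by (intro has_grad_on_mult bump3 has_grad_on_inner_right)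
    have dDm: "has_div_on Dm w ?S"
    proof -
      have "has_div_on (\<lambda>y. (- 6 * bump 2 y) *\<^sub>R y) (\<lambda>y. (- 6 * bump 2 y) * ?N + ((- 6) *\<^sub>R ((- 4 * bump 1 y) *\<^sub>R y)) \<bullet> y) ?S"
        by (intro has_div_on_scaleR has_grad_on_cmult bump2 has_div_on_id)
      from has_div_on_add[OF has_div_on_scaleR[OF bump3 has_div_on_const[of b]] has_div_on_scaleR[OF has_grad_on_inner_right[of b] this]]
      show ?thesis
        unfolding Dm_def by (rule has_div_on_cong) (simp add: w_def inner_commute algebra_simps)
    qed
    have "(LINT y:cball 0 1|lborel. (Df (x + t *\<^sub>R y) \<bullet> b) * q y + (t *\<^sub>R Dg (x + t *\<^sub>R y)) \<bullet> (bump 3 y *\<^sub>R y)) = 0"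
      by (rule ibp[OF gg dY]) (auto simp: bump_eq_0)
    then have 1: "(LINT y:cball 0 1|lborel. (Df (x + t *\<^sub>R y) \<bullet> b) * q y)
        + (LINT y:cball 0 1|lborel. (t *\<^sub>R Dg (x + t *\<^sub>R y)) \<bullet> (bump 3 y *\<^sub>R y)) = 0"
      by (subst (asm) split) (intro continuous_intros c cq cb)+
    have "(LINT y:cball 0 1|lborel. (t *\<^sub>R Dg (x + t *\<^sub>R y)) \<bullet> (bump 3 y *\<^sub>R y)) = t * G' t"
      unfolding G'_def by (simp add: mult_ac flip: set_integral_mult_right)
    with 1 have 1: "t * G' t = - (LINT y:cball 0 1|lborel. (Df (x + t *\<^sub>R y) \<bullet> b) * q y)" by simp
    have "(LINT y:cball 0 1|lborel. f (x + t *\<^sub>R y) * w y + (t *\<^sub>R Df (x + t *\<^sub>R y)) \<bullet> (q y *\<^sub>R b)) = 0"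
      by (rule ibp[OF gf dqb]) (auto simp: q_def bump_eq_0)
    then have 2: "(LINT y:cball 0 1|lborel. f (x + t *\<^sub>R y) * w y)
        + (LINT y:cball 0 1|lborel. (t *\<^sub>R Df (x + t *\<^sub>R y)) \<bullet> (q y *\<^sub>R b)) = 0"
      by (subst (asm) split) (intro continuous_intros c cq cb)+
    have "(LINT y:cball 0 1|lborel. (t *\<^sub>R Df (x + t *\<^sub>R y)) \<bullet> (q y *\<^sub>R b)) = t * (LINT y:cball 0 1|lborel. (Df (x + t *\<^sub>R y) \<bullet> b) * q y)"
      by (simp add: mult_ac flip: set_integral_mult_right)
    with 1 2 have A: "t * (t * G' t) = (LINT y:cball 0 1|lborel. f (x + t *\<^sub>R y) * w y)" by simp
    have "(LINT y:cball 0 1|lborel. m y * (t * Lf (x + t *\<^sub>R y)) + Dm y \<bullet> Df (x + t *\<^sub>R y)) = 0"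
      by (rule ibp[OF gm dD]) (auto simp: m_def bump_eq_0)
    then have 3: "(LINT y:cball 0 1|lborel. m y * (t * Lf (x + t *\<^sub>R y)))
       + (LINT y:cball 0 1|lborel. Dm y \<bullet> Df (x + t *\<^sub>R y)) = 0"
      by (subst (asm) split) (intro continuous_intros c cq cb)+
    have "(LINT y:cball 0 1|lborel. m y * (t * Lf (x + t *\<^sub>R y))) = t * (LINT y:cball 0 1|lborel. Lf (x + t *\<^sub>R y) * m y)"
      by (simp add: mult_ac flip: set_integral_mult_right)
    with 3 have 3: "t * (LINT y:cball 0 1|lborel. Lf (x + t *\<^sub>R y) * m y)
       = - (LINT y:cball 0 1|lborel. Dm y \<bullet> Df (x + t *\<^sub>R y))" by simp
    have "(LINT y:cball 0 1|lborel. f (x + t *\<^sub>R y) * w y + (t *\<^sub>R Df (x + t *\<^sub>R y)) \<bullet> Dm y) = 0"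
      by (rule ibp[OF gf dDm]) (auto simp: Dm_def bump_eq_0)
    then have 4: "(LINT y:cball 0 1|lborel. f (x + t *\<^sub>R y) * w y)
      + (LINT y:cball 0 1|lborel. (t *\<^sub>R Df (x + t *\<^sub>R y)) \<bullet> Dm y) = 0"
      by (subst (asm) split) (intro continuous_intros c cq cb)+
    have "(LINT y:cball 0 1|lborel. (t *\<^sub>R Df (x + t *\<^sub>R y)) \<bullet> Dm y)
      = t * (LINT y:cball 0 1|lborel. Dm y \<bullet> Df (x + t *\<^sub>R y))"
      by (subst inner_commute) (simp only: inner_scaleR_right set_integral_mult_right)
    note 5 = this
    have "t * (t * (LINT y:cball 0 1|lborel. Lf (x + t *\<^sub>R y) * m y)) = (LINT y:cball 0 1|lborel. f (x + t *\<^sub>R y) * w y)"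
      unfolding 3 mult_minus_right using 4 5 by linarith
    with A have "t * (t * G' t) = t * (t * (LINT y:cball 0 1|lborel. Lf (x + t *\<^sub>R y) * m y))"
      by (simp only:)
    with t'(2) show ?thesis by (simp add: m_def)
  qed
  have bG': "\<bar>G' t\<bar> \<le> B * ?v" if t: "t \<in> {0<..R}" for t
    unfolding G'_eq[OF t]
  proof (rule set_integral_abs_le_compact)
    show "continuous_on (cball 0 1) (\<lambda>y. Lf (x + t *\<^sub>R y) * (bump 3 y * (y \<bullet> b)))"
      using t by (intro continuous_intros cb cont) auto
    fix y :: 'a assume y: "y \<in> cball 0 1"
    have "\<bar>y \<bullet> b\<bar> \<le> 1"
      using Cauchy_Schwarz_ineq2[of y b] y b by simp
    then have "\<bar>bump 3 y * (y \<bullet> b)\<bar> \<le> 1 * 1"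
      unfolding abs_mult using bump_le_1[of 3 y] bump_nonneg[of 3 y] by (intro mult_mono) auto
    moreover have "\<bar>Lf (x + t *\<^sub>R y)\<bar> \<le> B"
      using B[OF inc[OF y]] t by auto
    ultimately show "\<bar>Lf (x + t *\<^sub>R y) * (bump 3 y * (y \<bullet> b))\<bar> \<le> B"
      unfolding abs_mult[of "Lf (x + t *\<^sub>R y)"] using mult_mono[of "\<bar>Lf (x + t *\<^sub>R y)\<bar>" B "\<bar>bump 3 y * (y \<bullet> b)\<bar>" 1] B0 by simp
  qed auto
  have diff: "\<bar>G R - G 0\<bar> \<le> B * ?v * R"
  proof -
    have "continuous_on {0..R} G"
      using DERIV_continuous_on G' by blast
    moreover have "(G has_real_derivative G' t) (at t)" if "0 < t" "t < R" for t
      using G'[of t] that by (simp add: at_within_Icc_at)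
    ultimately obtain t where "0 < t" "t < R" "G R - G 0 = (R - 0) * G' t"
      using MVT[OF R, of G] by (metis DERIV_unique real_differentiable_def)
    then show ?thesis
      using bG'[of t] R by (simp add: abs_mult mult.commute)
  qed
  \<comment> \<open>The factor \<open>6\<close> is from the gradient of \<open>bump 3\<close>, and
    \<open>1 / R\<close> is the cost of moving the derivative off the rescaled function.\<close>
  have GR: "\<bar>G R\<bar> \<le> 6 * A / R * ?v"
  proof -
    let ?S = "{y. x + R *\<^sub>R y \<in> S}"
    have K: "cball 0 1 \<subseteq> ?S" using inc[of _ R] sub R by auto
    have gf: "has_grad_on (\<lambda>y. f (x + R *\<^sub>R y)) (\<lambda>y. R *\<^sub>R Df (x + R *\<^sub>R y)) ?S"
      by (rule has_grad_on_affine[OF grad]) auto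
    have d: "has_div_on (\<lambda>y. bump 3 y *\<^sub>R b) (\<lambda>y. - 6 * bump 2 y * (y \<bullet> b)) ?S"
      by (rule has_div_on_cong[OF has_div_on_scaleR[OF bump3 has_div_on_const]]) simp
    have c: "continuous_on (cball 0 1) (\<lambda>y. f (x + R *\<^sub>R y))" "continuous_on (cball 0 1) (\<lambda>y. Df (x + R *\<^sub>R y))"
      using cont[of R] R by auto
    have "(LINT y:cball 0 1|lborel. f (x + R *\<^sub>R y) * (- 6 * bump 2 y * (y \<bullet> b)) + (R *\<^sub>R Df (x + R *\<^sub>R y)) \<bullet> (bump 3 y *\<^sub>R b)) = 0"
      by (rule integral_by_parts_divergence[OF gf d open_affine_vimage[OF S] compact_cball K]) (auto simp: bump_eq_0)
    then have 1: "(LINT y:cball 0 1|lborel. f (x + R *\<^sub>R y) * (- 6 * bump 2 y * (y \<bullet> b)))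
       + (LINT y:cball 0 1|lborel. (R *\<^sub>R Df (x + R *\<^sub>R y)) \<bullet> (bump 3 y *\<^sub>R b)) = 0"
      by (subst (asm) split) (intro continuous_intros c cb)+
    have "(LINT y:cball 0 1|lborel. (R *\<^sub>R Df (x + R *\<^sub>R y)) \<bullet> (bump 3 y *\<^sub>R b)) = R * G R"
      unfolding G_def by (simp add: mult_ac flip: set_integral_mult_right)
    with 1 have "\<bar>R * G R\<bar> = \<bar>LINT y:cball 0 1|lborel. f (x + R *\<^sub>R y) * (- 6 * bump 2 y * (y \<bullet> b))\<bar>"
      by simp
    also have "\<dots> \<le> 6 * A * ?v"
    proof (rule set_integral_abs_le_compact)
      fix y :: 'a assume y: "y \<in> cball 0 1"
      have "\<bar>y \<bullet> b\<bar> \<le> 1"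
        using Cauchy_Schwarz_ineq2[of y b] y b by simp
      then have "\<bar>bump 2 y * (y \<bullet> b)\<bar> \<le> 1 * 1"
        unfolding abs_mult using bump_le_1[of 2 y] bump_nonneg[of 2 y] by (intro mult_mono) auto
      moreover have "\<bar>f (x + R *\<^sub>R y)\<bar> \<le> A"
        using A[OF inc[OF y]] R by auto
      ultimately have "\<bar>f (x + R *\<^sub>R y)\<bar> * \<bar>bump 2 y * (y \<bullet> b)\<bar> \<le> A * 1"
        using A0 by (intro mult_mono) auto
      then show "\<bar>f (x + R *\<^sub>R y) * (- 6 * bump 2 y * (y \<bullet> b))\<bar> \<le> 6 * A"
        by (simp add: abs_mult)
    qed (auto intro!: continuous_intros c cb)
    finally show ?thesis
      using R by (simp add: abs_mult field_simps)
  qed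
  have "\<bar>Df x \<bullet> b\<bar> * (LINT y:cball (0::'a) 1|lborel. bump 3 y) = \<bar>G 0\<bar>"
    using integral_bump_pos[of 3, where 'a='a] by (simp add: G_def abs_mult)
  also have "\<dots> \<le> 6 * A / R * ?v + B * ?v * R"
    using diff GR by linarith
  finally show ?thesis
    by (simp add: algebra_simps)
qed

lemma gradient_estimate:
  obtains C where "0 < C" and
    "\<And>(f::'a::euclidean_space \<Rightarrow> real) Df Lf S x R A B.
      \<lbrakk>has_laplacian_on f Df Lf S; open S; cball x R \<subseteq> S; 0 < R;
       \<And>y. y \<in> cball x R \<Longrightarrow> \<bar>f y\<bar> \<le> A; \<And>y. y \<in> cball x R \<Longrightarrow> \<bar>Lf y\<bar> \<le> B\<rbrakk>
      \<Longrightarrow> norm (Df x) \<le> C * (A / R + B * R)"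
proof -
  let ?v = "measure lborel (cball (0::'a) 1)"
  define c where "c = (LINT y:cball (0::'a) 1|lborel. bump 3 y)"
  have c: "c > 0" unfolding c_def by (rule integral_bump_pos)
  have v: "?v > 0" by (simp add: measure_cball_pos)
  show ?thesis
  proof (rule that[of "6 * ?v / c"])
    fix f :: "'a \<Rightarrow> real" and Df Lf S x R A B
    assume *: "has_laplacian_on f Df Lf S" "open S" "cball x R \<subseteq> S" "0 < R"
       "\<And>y. y \<in> cball x R \<Longrightarrow> \<bar>f y\<bar> \<le> A" "\<And>y. y \<in> cball x R \<Longrightarrow> \<bar>Lf y\<bar> \<le> B"
    have pos: "0 \<le> A" "0 \<le> B" using *(5)[of x] *(6)[of x] *(4) by auto
    show "norm (Df x) \<le> 6 * ?v / c * (A / R + B * R)"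
    proof (cases "Df x = 0")
      case True
      then show ?thesis using c v pos *(4) by simp
    next
      case False
      have "\<bar>Df x \<bullet> sgn (Df x)\<bar> * c \<le> (6 * A / R + B * R) * ?v"
        unfolding c_def by (rule gradient_estimate_direction[OF *]) (use False in \<open>auto simp: norm_sgn\<close>)
      moreover have "Df x \<bullet> sgn (Df x) = norm (Df x)"
        using False by (simp add: sgn_div_norm power2_norm_eq_inner[symmetric] power2_eq_square)
      ultimately have "norm (Df x) * c \<le> (6 * A / R + B * R) * ?v" by simp
      also have "\<dots> \<le> (6 * (A / R + B * R)) * ?v"
        using pos *(4) by (intro mult_right_mono) (auto simp: algebra_simps)
      finally show ?thesis using c by (simp add: field_simps)
    qed
  qed (use c v in simp)
qed

section \<open>Smooth bump functions\<close>

text \<open>The classical function \<open>exp (-1/t)\<close> is \<open>flat 0\<close>; the negative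
  powers are included because its derivatives are linear combinations of members of this
  family.\<close>

definition flat :: "nat \<Rightarrow> real \<Rightarrow> real" where
  "flat m t = (if 0 < t then exp (- 1 / t) / t ^ m else 0)"

lemma power_le_fact_mult_exp:
  fixes y :: real
  assumes "0 \<le> y"
  shows "y ^ n \<le> fact n * exp y"
proof -
  have "(\<Sum>k\<in>{n}. y ^ k /\<^sub>R fact k) \<le> (\<Sum>k. y ^ k /\<^sub>R fact k)"
    by (rule sum_le_suminf[OF summable_exp_generic]) (use assms in auto)
  then have "inverse (fact n) * y ^ n \<le> exp y"
    by (simp add: exp_def)
  then show ?thesis
    by (simp add: inverse_eq_divide pos_divide_le_eq mult.commute)
qed

text \<open>One term of the exponential series at \<open>1/t\<close> beats the power
  \<open>t^-(m+1)\<close>. Applied to \<open>m + 1\<close>, the bound shows that the difference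
  quotient of \<open>flat m\<close> at \<open>0\<close> tends to \<open>0\<close>.\<close>

lemma abs_flat_le: "\<bar>flat m t\<bar> \<le> fact (Suc m) * \<bar>t\<bar>"
proof (cases "0 < t")
  case True
  have "(1 / t) ^ Suc m \<le> fact (Suc m) * exp (1 / t)"
    using True by (intro power_le_fact_mult_exp) auto
  then have "exp (- (1 / t)) * ((1 / t) ^ Suc m) \<le> exp (- (1 / t)) * (fact (Suc m) * exp (1 / t))"
    by (intro mult_left_mono) auto
  also have "\<dots> = fact (Suc m)"
    by (simp add: exp_minus)
  finally have "exp (- (1 / t)) * (1 / t) ^ Suc m * t \<le> fact (Suc m) * t"
    using True by (intro mult_right_mono) auto
  moreover have "exp (- (1 / t)) * (1 / t) ^ Suc m * t = flat m t"
    using True by (simp add: flat_def power_divide)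
  moreover have "0 \<le> flat m t"
    using True by (simp add: flat_def)
  ultimately show ?thesis
    using True by simp
next
  case False
  then have "flat m t = 0" by (simp add: flat_def)
  then show ?thesis by (metis abs_ge_zero abs_zero fact_ge_zero mult_nonneg_nonneg)
qed

lemma has_real_derivative_flat:
  "(flat m has_real_derivative flat (m + 2) t - real m * flat (m + 1) t) (at t)"
proof -
  consider "t > 0" | "t < 0" | "t = 0" by linarith
  then show ?thesis
  proof cases
    case 1
    have "((\<lambda>t. exp (- 1 / t) / t ^ m) has_real_derivative flat (m + 2) t - real m * flat (m + 1) t) (at t)"
    proof (cases m)
      case 0
      then show ?thesis
        using 1 by (auto intro!: derivative_eq_intros simp: flat_def power2_eq_square)
    next
      case (Suc k)
      have "k \<noteq> 0 \<Longrightarrow> t ^ k = t * t ^ (k - Suc 0)"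
        by (cases k) auto
      then show ?thesis
        using 1 unfolding Suc
        by (auto intro!: derivative_eq_intros simp: flat_def power2_eq_square field_simps)
          (rule ccontr, simp)
    qed
    then show ?thesis
      by (rule has_field_derivative_transform_within_open[where S = "{0<..}"])
        (use 1 in \<open>auto simp: flat_def\<close>)
  next
    case 2
    have "((\<lambda>t. 0) has_real_derivative flat (m + 2) t - real m * flat (m + 1) t) (at t)"
      using 2 by (auto simp: flat_def)
    then show ?thesis
      by (rule has_field_derivative_transform_within_open[where S = "{..<0}"])
        (use 2 in \<open>auto simp: flat_def\<close>)
  next
    case 3
    have "((\<lambda>h. flat m h / h) \<longlongrightarrow> 0) (at 0)"
    proof (rule Lim_null_comparison)
      have eq: "flat m h / h = flat (Suc m) h" for h
        by (simp add: flat_def)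
      show "\<forall>\<^sub>F h in at 0. norm (flat m h / h) \<le> fact (Suc (Suc m)) * \<bar>h\<bar>"
        unfolding eq real_norm_def by (intro always_eventually allI abs_flat_le)
      have "((\<lambda>h::real. fact (Suc (Suc m)) * \<bar>h\<bar>) \<longlongrightarrow> fact (Suc (Suc m)) * \<bar>0\<bar>) (at 0)"
        by (intro tendsto_intros)
      then show "((\<lambda>h::real. fact (Suc (Suc m)) * \<bar>h\<bar>) \<longlongrightarrow> 0) (at 0)"
        by simp
    qed
    then show ?thesis
      using 3 by (simp add: DERIV_def flat_def)
  qed
qed

lemma pd_eq:
  fixes f :: "real^'n \<Rightarrow> real"
  assumes "(f has_derivative f') (at x)"
  shows "pd f i x = f' (axis i 1)"
proof -
  have "((\<lambda>t::real. x + t *\<^sub>R axis i 1) has_derivative (\<lambda>t. t *\<^sub>R axis i 1)) (at 0)"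
    by (auto intro!: derivative_eq_intros)
  from has_derivative_compose[OF this, of f f'] assms
  have "((\<lambda>t. f (x + t *\<^sub>R axis i 1)) has_derivative (\<lambda>t. f' (t *\<^sub>R axis i 1))) (at 0)"
    by simp
  moreover have "f' (t *\<^sub>R axis i 1) = t * f' (axis i 1)" for t
    using assms by (simp add: has_derivative_def bounded_linear.linear linear_scale)
  ultimately have "((\<lambda>t. f (x + t *\<^sub>R axis i 1)) has_real_derivative f' (axis i 1)) (at 0)"
    by (auto simp: has_field_derivative_def mult.commute elim!: has_derivative_eq_rhs)
  then show ?thesis
    unfolding pd_def by (rule DERIV_imp_deriv)
qed

text \<open>An algebra of functions that contains the bump, consists of differentiable functions
  and is closed under partial derivatives.\<close>

inductive bump_alg :: "real^'n \<Rightarrow> real \<Rightarrow> (real^'n \<Rightarrow> real) \<Rightarrow> bool" for z d where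
  flat: "bump_alg z d (\<lambda>x. flat m (d\<^sup>2 - (x - z) \<bullet> (x - z)))"
| coord: "bump_alg z d (\<lambda>x. (x - z) $ i)"
| const: "bump_alg z d (\<lambda>x. c)"
| add: "bump_alg z d f \<Longrightarrow> bump_alg z d g \<Longrightarrow> bump_alg z d (\<lambda>x. f x + g x)"
| mult: "bump_alg z d f \<Longrightarrow> bump_alg z d g \<Longrightarrow> bump_alg z d (\<lambda>x. f x * g x)"

lemma bump_alg_derivative:
  fixes f :: "real^'n \<Rightarrow> real"
  assumes "bump_alg z d f"
  shows "\<exists>f'. (\<forall>x. (f has_derivative f' x) (at x)) \<and> (\<forall>i. bump_alg z d (\<lambda>x. f' x (axis i 1)))"
  using assms
proof induction
  case (flat m)
  let ?s = "\<lambda>x. d\<^sup>2 - (x - z) \<bullet> (x - z)"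
  let ?f' = "\<lambda>x h. (flat (m + 2) (?s x) - real m * flat (m + 1) (?s x)) * (- 2 * ((x - z) \<bullet> h))"
  have "((\<lambda>x. flat m (?s x)) has_derivative ?f' x) (at x)" for x
  proof -
    have "(?s has_derivative (\<lambda>h. - 2 * ((x - z) \<bullet> h))) (at x)"
      by (auto intro!: derivative_eq_intros simp: inner_commute algebra_simps)
    from has_derivative_compose[OF this has_real_derivative_flat[unfolded has_field_derivative_def]]
    show ?thesis by simp
  qed
  \<comment> \<open>The difference is written as a sum with a constant factor, since the algebra is
    generated by sums and products.\<close>
  moreover have "bump_alg z d (\<lambda>x. (flat (m + 2) (?s x) + (- real m) * flat (m + 1) (?s x)) * (- 2 * (x - z) $ i))" for i
    by (intro bump_alg.intros)
  moreover have "(\<lambda>x. ?f' x (axis i 1)) = (\<lambda>x. (flat (m + 2) (?s x) + (- real m) * flat (m + 1) (?s x)) * (- 2 * (x - z) $ i))" for i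
    by (simp add: inner_axis fun_eq_iff)
  ultimately show ?case
    by (intro exI[of _ ?f']) auto
next
  case (coord i)
  have "((\<lambda>x. (x - z) $ i) has_derivative (\<lambda>h. h $ i)) (at x)" for x
    using has_derivative_diff[OF bounded_linear_imp_has_derivative[OF bounded_linear_vec_nth] has_derivative_const[of "z $ i"]]
    by simp
  then show ?case
    by (intro exI[of _ "\<lambda>x h. h $ i"]) (auto intro: bump_alg.const)
next
  case (const c)
  show ?case
    by (intro exI[of _ "\<lambda>x h. 0"]) (auto intro: bump_alg.const)
next
  case (add f g)
  then obtain f' g' where "\<And>x. (f has_derivative f' x) (at x)" "\<And>i. bump_alg z d (\<lambda>x. f' x (axis i 1))"
    "\<And>x. (g has_derivative g' x) (at x)" "\<And>i. bump_alg z d (\<lambda>x. g' x (axis i 1))"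
    by blast
  then show ?case
    by (intro exI[of _ "\<lambda>x h. f' x h + g' x h"]) (auto intro!: has_derivative_add bump_alg.intros)
next
  case (mult f g)
  then obtain f' g' where "\<And>x. (f has_derivative f' x) (at x)" "\<And>i. bump_alg z d (\<lambda>x. f' x (axis i 1))"
    "\<And>x. (g has_derivative g' x) (at x)" "\<And>i. bump_alg z d (\<lambda>x. g' x (axis i 1))"
    by blast
  with mult.hyps show ?case
    by (intro exI[of _ "\<lambda>x h. f x * g' x h + f' x h * g x"]) (auto intro!: has_derivative_mult bump_alg.intros)
qed

lemma Ck_on_bump_alg:
  fixes f :: "real^'n \<Rightarrow> real"
  assumes "bump_alg z d f"
  shows "Ck_on k UNIV f"
  using assms
proof (induction k arbitrary: f)
  case 0
  then show ?case
    using bump_alg_derivative[OF 0] by (auto intro: continuous_at_imp_continuous_on has_derivative_continuous)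
next
  case (Suc k)
  obtain f' where f': "\<And>x. (f has_derivative f' x) (at x)" "\<And>i. bump_alg z d (\<lambda>x. f' x (axis i 1))"
    using bump_alg_derivative[OF Suc.prems] by blast
  have "pd f i = (\<lambda>x. f' x (axis i 1))" for i
    using pd_eq[OF f'(1)] by auto
  then have "Ck_on k UNIV (pd f i)" for i
    using Suc.IH f'(2) by simp
  moreover have "continuous_on UNIV f"
    using f'(1) by (auto intro: continuous_at_imp_continuous_on has_derivative_continuous)
  moreover have "f differentiable_on UNIV"
    using f'(1) by (auto simp: differentiable_on_def differentiable_def)
  ultimately show ?case by simp
qed

text \<open>Serves to localise the weak formulation, whose test functions are smooth to all orders;
  the polynomial cutoffs are only finitely often differentiable.\<close>

lemma smooth_bump_exists:
  fixes z :: "real^'n"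
  assumes "0 < d"
  obtains \<phi> m where "smooth_on UNIV \<phi>" "\<And>x. 0 \<le> \<phi> x" "\<And>x. x \<notin> cball z d \<Longrightarrow> \<phi> x = 0"
    "0 < m" "\<And>x. x \<in> cball z (d / 2) \<Longrightarrow> m \<le> \<phi> x"
proof
  let ?\<phi> = "\<lambda>x. flat 0 (d\<^sup>2 - (x - z) \<bullet> (x - z))"
  show "smooth_on UNIV ?\<phi>"
    unfolding smooth_on_def by (intro allI Ck_on_bump_alg[of z d] bump_alg.flat)
  show "0 \<le> ?\<phi> x" for x
    by (simp add: flat_def)
  show "?\<phi> x = 0" if "x \<notin> cball z d" for x
  proof -
    have "d < norm (x - z)"
      using that by (simp add: dist_norm norm_minus_commute)
    then have "d\<^sup>2 < (norm (x - z))\<^sup>2"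
      using assms by (intro power_strict_mono) auto
    then show ?thesis
      by (simp add: flat_def power2_norm_eq_inner)
  qed
  \<comment> \<open>Within distance \<open>d / 2\<close> of the centre the argument of
    \<open>flat 0\<close> is at least \<open>d^2 - d^2/4\<close>.\<close>
  show "0 < exp (- 1 / (3 / 4 * d\<^sup>2))" by simp
  show "exp (- 1 / (3 / 4 * d\<^sup>2)) \<le> ?\<phi> x" if "x \<in> cball z (d / 2)" for x
  proof -
    have "norm (x - z) \<le> d / 2"
      using that by (simp add: dist_norm norm_minus_commute)
    then have "(norm (x - z))\<^sup>2 \<le> (d / 2)\<^sup>2"
      by (intro power_mono) auto
    then have s: "3 / 4 * d\<^sup>2 \<le> d\<^sup>2 - (x - z) \<bullet> (x - z)"
      unfolding power2_norm_eq_inner by (simp add: power_divide)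
    have p: "0 < 3 / 4 * d\<^sup>2" using assms by simp
    have "1 / (d\<^sup>2 - (x - z) \<bullet> (x - z)) \<le> 1 / (3 / 4 * d\<^sup>2)"
      using s p by (intro frac_le) auto
    then have "exp (- 1 / (3 / 4 * d\<^sup>2)) \<le> exp (- 1 / (d\<^sup>2 - (x - z) \<bullet> (x - z)))"
      by simp
    moreover have "0 < d\<^sup>2 - (x - z) \<bullet> (x - z)"
      using s p by linarith
    ultimately show ?thesis
      by (simp add: flat_def)
  qed
qed

section \<open>The hyperbolic ball\<close>

lemma Basis_real_vec: "(Basis :: (real^'n) set) = range (\<lambda>i. axis i 1)"
  by (auto simp: Basis_vec_def)

lemma sum_Basis_real_vec: "(\<Sum>b\<in>Basis. g b) = (\<Sum>i\<in>UNIV. g (axis i 1))" for g :: "real^'n \<Rightarrow> real"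
  unfolding Basis_real_vec by (subst sum.reindex) (auto simp: inj_on_def axis_eq_axis)

lemma egrad_inner:
  fixes f :: "real^'n \<Rightarrow> real"
  assumes "(f has_derivative f') (at x)"
  shows "egrad f x \<bullet> h = f' h"
proof -
  have lin: "linear f'" using assms by (simp add: has_derivative_def bounded_linear.linear)
  have "f' h = f' (\<Sum>i\<in>UNIV. h $ i *\<^sub>R axis i 1)"
    using basis_expansion[of h] by (simp add: scalar_mult_eq_scaleR)
  also have "\<dots> = (\<Sum>i\<in>UNIV. h $ i * f' (axis i 1))"
    by (simp add: linear_sum[OF lin] linear_scale[OF lin])
  finally show ?thesis
    by (simp add: egrad_def inner_vec_def pd_eq[OF assms] mult.commute)
qed

lemma Ck_on_Suc_imp_has_grad_on:
  fixes f :: "real^'n \<Rightarrow> real"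
  assumes f: "Ck_on (Suc k) S f" and S: "open S"
  shows "has_grad_on f (egrad f) S"
  unfolding has_grad_on_def
proof (intro conjI ballI)
  fix x assume "x \<in> S"
  have "f differentiable_on S" using f by simp
  then have "f differentiable (at x)"
    using S \<open>x \<in> S\<close> by (simp add: differentiable_on_eq_differentiable_at)
  then obtain f' where f': "(f has_derivative f') (at x)"
    unfolding differentiable_def by blast
  moreover have "(\<lambda>h. egrad f x \<bullet> h) = f'"
    by (intro ext) (rule egrad_inner[OF f'])
  ultimately show "(f has_derivative (\<lambda>h. egrad f x \<bullet> h)) (at x)" by simp
next
  have "continuous_on S (pd f i)" for i
    using f by (cases k) auto
  then show "continuous_on S (egrad f)"
    unfolding egrad_def by (intro continuous_on_vec_lambda)
qed

lemma Ck_on_2_imp_has_laplacian_on: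
  fixes f :: "real^'n \<Rightarrow> real"
  assumes f: "Ck_on 2 S f" and S: "open S"
  shows "has_laplacian_on f (egrad f) (\<lambda>x. \<Sum>i\<in>UNIV. pd (pd f i) i x) S"
proof -
  have g: "has_grad_on f (egrad f) S" and gi: "has_grad_on (pd f i) (egrad (pd f i)) S" for i
  proof -
    have f2: "Ck_on (Suc (Suc 0)) S f"
      using f by (simp only: numeral_2_eq_2)
    then show "has_grad_on f (egrad f) S"
      using S by (rule Ck_on_Suc_imp_has_grad_on)
    have "Ck_on (Suc 0) S (pd f i)"
      using f2 by (subst (asm) Ck_on.simps) blast
    then show "has_grad_on (pd f i) (egrad (pd f i)) S"
      using S by (rule Ck_on_Suc_imp_has_grad_on)
  qed
  \<comment> \<open>The Hessian, assembled from the gradients of the partial derivatives; its trace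
    is the sum of the pure second derivatives.\<close>
  define D where "D x h = (\<chi> i. egrad (pd f i) x \<bullet> h)" for x h
  have 1: "(egrad f has_derivative D x) (at x)" if "x \<in> S" for x
    unfolding has_derivative_componentwise_within[of "egrad f"]
  proof
    fix b :: "real^'n" assume "b \<in> Basis"
    then obtain i where b: "b = axis i 1" by (auto simp: Basis_real_vec)
    show "((\<lambda>x. egrad f x \<bullet> b) has_derivative (\<lambda>h. D x h \<bullet> b)) (at x)"
      using has_grad_onD[OF gi[of i] that] by (simp add: b D_def egrad_def inner_axis)
  qed
  have 2: "continuous_on S (\<lambda>x. D x b)" for b
    unfolding D_def
    by (intro continuous_on_vec_lambda continuous_intros has_grad_on_continuous_grad[OF gi])
  have 3: "(\<Sum>i\<in>UNIV. pd (pd f i) i x) = (\<Sum>b\<in>Basis. D x b \<bullet> b)" for x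
    by (simp add: sum_Basis_real_vec D_def inner_axis egrad_def)
  show ?thesis
    unfolding has_laplacian_on_def has_div_on_def
    by (intro conjI g exI[of _ D]) (use 1 2 3 in auto)
qed

lemma open_ballN: "open (ballN :: (real^'n) set)"
  by (simp add: ballN_def)

lemma rho_alt: "rho x = (1 - x \<bullet> x) / 2"
  by (simp add: rho_def power2_norm_eq_inner)

lemma rho_pos: "x \<in> ballN \<Longrightarrow> 0 < rho x"
  by (simp add: rho_def ballN_def abs_square_less_1)

lemma rho_le: "rho x \<le> 1 / 2"
  by (simp add: rho_def)

lemma inner_self_rho: "x \<bullet> x = 1 - 2 * rho x"
  by (simp add: rho_alt field_simps)

lemma has_grad_on_rho: "has_grad_on rho (\<lambda>x. - x) S"
proof -
  have 1: "has_grad_on (\<lambda>x. 1 / 2 - 1 / 2 * (x \<bullet> x)) (\<lambda>x. 0 - (1 / 2) *\<^sub>R (2 *\<^sub>R x)) S"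
    by (intro has_grad_on_diff has_grad_on_cmult has_grad_on_const has_grad_on_inner_self)
  have 2: "rho = (\<lambda>x. 1 / 2 - 1 / 2 * (x \<bullet> x))"
    by (auto simp: rho_alt field_simps)
  show ?thesis
    unfolding 2 by (rule has_grad_on_cong[OF 1]) simp
qed

lemma continuous_on_rho: "continuous_on S rho"
  by (rule has_grad_on_continuous[OF has_grad_on_rho])

lemma has_grad_on_rho_powr:
  "has_grad_on (\<lambda>x. rho x powr c) (\<lambda>x. (- c * rho x powr (c - 1)) *\<^sub>R x) (ballN :: (real^'n) set)"
proof -
  have "has_grad_on (\<lambda>x. rho x powr c) (\<lambda>x. (c * rho x powr (c - 1)) *\<^sub>R (- x)) (ballN :: (real^'n) set)"
  proof (rule has_grad_on_compose[OF has_grad_on_rho, where \<phi> = "\<lambda>s. s powr c" and \<phi>' = "\<lambda>s. c * s powr (c - 1)"])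
    show "((\<lambda>s. s powr c) has_real_derivative c * rho x powr (c - 1)) (at (rho x))" if "x \<in> ballN" for x :: "real^'n"
      using rho_pos[OF that] by (rule has_real_derivative_powr)
    show "continuous_on (rho ` (ballN :: (real^'n) set)) (\<lambda>s. c * s powr (c - 1))"
      by (intro continuous_intros) (use rho_pos in force)
  qed
  then show ?thesis
    by (rule has_grad_on_cong) simp
qed

lemma has_laplacian_on_rho_powr:
  "has_laplacian_on (\<lambda>x. rho x powr c) (\<lambda>x. (- c * rho x powr (c - 1)) *\<^sub>R x)
     (\<lambda>x. c * (c - 1) * rho x powr (c - 2) * (x \<bullet> x) - c * real CARD('n) * rho x powr (c - 1))
     (ballN :: (real^'n) set)"
proof -
  have "has_grad_on (\<lambda>x. - c * rho x powr (c - 1)) (\<lambda>x. (- c) *\<^sub>R ((- (c - 1) * rho x powr (c - 1 - 1)) *\<^sub>R x)) ballN"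
    by (intro has_grad_on_cmult has_grad_on_rho_powr)
  from has_div_on_scaleR[OF this has_div_on_id]
  have "has_div_on (\<lambda>x. (- c * rho x powr (c - 1)) *\<^sub>R x)
     (\<lambda>x. c * (c - 1) * rho x powr (c - 2) * (x \<bullet> x) - c * real CARD('n) * rho x powr (c - 1))
     (ballN :: (real^'n) set)"
    by (rule has_div_on_cong) (simp add: algebra_simps)
  then show ?thesis
    unfolding has_laplacian_on_def using has_grad_on_rho_powr by blast
qed

section \<open>From the weak formulation to the pointwise equation\<close>

lemma vol_dens_eq: "x \<in> ballN \<Longrightarrow> vol_dens x = rho x powr (- real CARD('n))" for x :: "real^'n"
proof -
  assume x: "x \<in> ballN"
  have "vol_dens x = (1 / rho x) ^ CARD('n)"
    by (simp add: vol_dens_def rho_def)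
  also have "\<dots> = rho x powr (- real CARD('n))"
    using rho_pos[OF x] by (simp add: powr_minus powr_realpow power_one_over inverse_eq_divide)
  finally show ?thesis .
qed

lemma egrad_eq_0:
  fixes f :: "real^'n \<Rightarrow> real"
  assumes "closed K" "\<And>x. x \<notin> K \<Longrightarrow> f x = 0" "x \<notin> K"
  shows "egrad f x = 0"
proof -
  have "((\<lambda>x. 0::real) has_derivative (\<lambda>h. 0)) (at x)" by simp
  then have "(f has_derivative (\<lambda>h. 0)) (at x)"
    by (rule has_derivative_transform_within_open[where s = "- K"]) (use assms in auto)
  from pd_eq[OF this] show ?thesis
    by (simp add: egrad_def vec_eq_iff)
qed

text \<open>Integration by parts shows that the continuous function \<open>q\<close>, the equation
  multiplied by \<open>rho^-N\<close>, has zero integral against every test function. A smooth bump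
  around a point where \<open>q\<close> were nonzero would contradict this.\<close>

lemma weak_solution_imp_equation:
  fixes u :: "real^'n \<Rightarrow> real"
  assumes u: "has_laplacian_on u (egrad u) Lu ballN" and sol: "weak_solution lam u" and z: "z \<in> ballN"
    and N: "3 \<le> CARD('n)"
  shows "(rho z)\<^sup>2 * Lu z + (real CARD('n) - 2) * rho z * (z \<bullet> egrad u z) + lam * u z
    + \<bar>u z\<bar> powr (4 / (real CARD('n) - 2)) * u z = 0"
proof -
  let ?N = "real CARD('n)"
  let ?B = "ballN :: (real^'n) set"
  let ?p = "4 / (?N - 2)"
  have gu: "has_grad_on u (egrad u) ?B" and du: "has_div_on (egrad u) Lu ?B"
    using u by (auto simp: has_laplacian_on_def)
  \<comment> \<open>The weight joins \<open>rho^2\<close> from the metric with the density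
    \<open>rho^-N\<close>, so that \<open>rho^N dX\<close> is the hyperbolic Laplacian of
    \<open>u\<close>.\<close>
  define X where "X x = rho x powr (2 - ?N) *\<^sub>R egrad u x" for x :: "real^'n"
  define dX where "dX x = rho x powr (2 - ?N) * Lu x + (?N - 2) * rho x powr (1 - ?N) * (x \<bullet> egrad u x)" for x
  have X: "has_div_on X dX ?B"
    unfolding X_def dX_def
    by (rule has_div_on_cong[OF has_div_on_scaleR[OF has_grad_on_rho_powr du]]) (simp add: algebra_simps)
  define n where "n x = (lam * u x + \<bar>u x\<bar> powr ?p * u x) * rho x powr (- ?N)" for x
  define q where "q x = dX x + n x" for x
  have cu: "continuous_on ?B u" using has_grad_on_continuous[OF gu] .
  have cr: "continuous_on ?B (\<lambda>x. rho x powr c)" for c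
    by (rule has_grad_on_continuous[OF has_grad_on_rho_powr])
  have p: "0 < ?p" using N by simp
  have cn: "continuous_on ?B n"
    unfolding n_def using p by (intro continuous_intros continuous_on_powr' cu cr) auto
  have cX: "continuous_on ?B X" "continuous_on ?B dX"
    using X has_div_on_continuous has_div_on_continuous_div by blast+
  have cq: "continuous_on ?B q"
    unfolding q_def by (intro continuous_intros cn cX)
  have int0: "(LINT x:K|lborel. \<phi> x * q x) = 0"
    if \<phi>: "smooth_on UNIV \<phi>" and K: "compact K" "K \<subseteq> ?B" "\<And>x. x \<notin> K \<Longrightarrow> \<phi> x = 0" for \<phi> K
  proof -
    have "Ck_on (Suc 0) UNIV \<phi>" using \<phi> by (simp only: smooth_on_def)
    then have g\<phi>: "has_grad_on \<phi> (egrad \<phi>) UNIV"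
      by (rule Ck_on_Suc_imp_has_grad_on) simp
    have c\<phi>: "continuous_on T \<phi>" "continuous_on T (egrad \<phi>)" for T
      using has_grad_on_continuous[OF g\<phi>] has_grad_on_continuous_grad[OF g\<phi>] continuous_on_subset by blast+
    note cK = continuous_on_subset[OF cX(1) K(2)] continuous_on_subset[OF cX(2) K(2)]
      continuous_on_subset[OF cn K(2)]
    have "test_fun \<phi>" using \<phi> K unfolding test_fun_def by blast
    then have "(LINT x:?B|lborel. (hgrad_inner u \<phi> x - lam * u x * \<phi> x
          - \<bar>u x\<bar> powr ?p * u x * \<phi> x) * vol_dens x) = 0"
      using sol unfolding weak_solution_def by blast
    moreover have "indicat_real ?B x *\<^sub>R ((hgrad_inner u \<phi> x - lam * u x * \<phi> x
          - \<bar>u x\<bar> powr ?p * u x * \<phi> x) * vol_dens x)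
        = indicat_real K x *\<^sub>R (egrad \<phi> x \<bullet> X x - \<phi> x * n x)" for x
    proof (cases "x \<in> K")
      case True
      then have xB: "x \<in> ?B" using K by auto
      have e: "(rho x)\<^sup>2 * rho x powr (- ?N) = rho x powr (2 - ?N)"
        using rho_pos[OF xB] powr_add[of "rho x" 2 "- ?N"] by simp
      have "(hgrad_inner u \<phi> x) * rho x powr (- ?N) = ((rho x)\<^sup>2 * rho x powr (- ?N)) * (egrad u x \<bullet> egrad \<phi> x)"
        by (simp add: hgrad_inner_def)
      also have "\<dots> = egrad \<phi> x \<bullet> X x"
        unfolding e by (simp add: X_def inner_commute)
      finally have "(hgrad_inner u \<phi> x) * rho x powr (- ?N) = egrad \<phi> x \<bullet> X x" .
      then show ?thesis
        using True xB by (simp add: vol_dens_eq n_def algebra_simps)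
    next
      case False
      have "egrad \<phi> x = 0"
        using egrad_eq_0[OF compact_imp_closed[OF K(1)] K(3) False] .
      then show ?thesis
        using False K(3)[OF False] by (simp add: hgrad_inner_def)
    qed
    ultimately have 1: "(LINT x:K|lborel. egrad \<phi> x \<bullet> X x - \<phi> x * n x) = 0"
      by (simp add: set_lebesgue_integral_def)
    have 2: "(LINT x:K|lborel. \<phi> x * dX x + egrad \<phi> x \<bullet> X x) = 0"
      by (rule integral_by_parts_divergence[OF has_grad_on_subset[OF g\<phi>] X open_ballN K(1,2)])
        (use K(3) in auto)
    have "(LINT x:K|lborel. \<phi> x * q x)
       = (LINT x:K|lborel. (\<phi> x * dX x + egrad \<phi> x \<bullet> X x) - (egrad \<phi> x \<bullet> X x - \<phi> x * n x))"
      by (simp add: q_def algebra_simps)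
    also have "\<dots> = (LINT x:K|lborel. \<phi> x * dX x + egrad \<phi> x \<bullet> X x) - (LINT x:K|lborel. egrad \<phi> x \<bullet> X x - \<phi> x * n x)"
      by (intro set_integral_diff set_integrable_compact K continuous_intros c\<phi> cK)
    finally show ?thesis using 1 2 by simp
  qed
  \<comment> \<open>The factor \<open>s\<close> treats both signs at once: near \<open>z\<close> the
    function \<open>s q\<close> stays above half its value at \<open>z\<close>, and a bump supported
    there gives a positive integral.\<close>
  have no_sign: False if s: "s * q z > 0" for s :: real
  proof -
    have "isCont q z"
      using cq z continuous_on_eq_continuous_at[OF open_ballN] by blast
    then have "continuous (at z) (\<lambda>x. s * q x)"
      by (intro continuous_intros)
    then obtain d1 where d1: "d1 > 0" "\<And>x. dist x z < d1 \<Longrightarrow> dist (s * q x) (s * q z) < s * q z / 2"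
      using s unfolding continuous_at_eps_delta by (meson half_gt_zero)
    obtain d2 where d2: "d2 > 0" "cball z d2 \<subseteq> ?B"
      using open_ballN[unfolded open_contains_cball] z by blast
    define d where "d = min (d1 / 2) d2"
    have d: "d > 0" "cball z d \<subseteq> ?B" "d < d1"
      using d1(1) d2 by (auto simp: d_def)
    have qpos: "s * q z / 2 \<le> s * q x" if "x \<in> cball z d" for x
    proof -
      have "dist x z < d1" using that d(3) by (simp add: dist_commute)
      from d1(2)[OF this] show ?thesis
        unfolding dist_real_def by linarith
    qed
    obtain \<phi> m where \<phi>: "smooth_on UNIV \<phi>" "\<And>x. 0 \<le> \<phi> x" "\<And>x. x \<notin> cball z d \<Longrightarrow> \<phi> x = 0"
      "0 < m" "\<And>x. x \<in> cball z (d / 2) \<Longrightarrow> m \<le> \<phi> x"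
      using smooth_bump_exists[OF d(1), of z] by blast
    have "continuous_on UNIV \<phi>" using \<phi>(1) unfolding smooth_on_def by (metis Ck_on.simps(1))
    then have c: "continuous_on (cball z d) (\<lambda>x. s * (\<phi> x * q x))"
      using continuous_on_subset[OF cq d(2)] by (intro continuous_intros) (auto intro: continuous_on_subset)
    have "m * (s * q z / 2) * measure lborel (cball z (d / 2)) \<le> (LINT x:cball z d|lborel. s * (\<phi> x * q x))"
    proof (rule set_integral_ge_cball[OF set_integrable_compact[OF compact_cball c]])
      fix x assume x: "x \<in> cball z d"
      have "0 \<le> s * q x"
        using qpos[OF x] s by linarith
      then have "0 \<le> \<phi> x * (s * q x)"
        using \<phi>(2)[of x] by (rule mult_nonneg_nonneg[rotated])
      then show "0 \<le> s * (\<phi> x * q x)" by (simp add: mult_ac)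
    next
      show "cball z (d / 2) \<subseteq> cball z d" using d(1) by (intro subset_cball) simp
      fix x assume x: "x \<in> cball z (d / 2)"
      then have "x \<in> cball z d" using d(1) by simp
      then have "m * (s * q z / 2) \<le> \<phi> x * (s * q x)"
        using \<phi>(2,4) \<phi>(5)[OF x] qpos s by (intro mult_mono) auto
      then show "m * (s * q z / 2) \<le> s * (\<phi> x * q x)" by (simp add: mult_ac)
    qed
    also have "\<dots> = s * (LINT x:cball z d|lborel. \<phi> x * q x)"
      by simp
    also have "\<dots> = 0"
      using int0[OF \<phi>(1) compact_cball d(2) \<phi>(3)] by simp
    finally have "m * (s * q z / 2) * measure lborel (cball z (d / 2)) \<le> 0" .
    moreover have "0 < m * (s * q z / 2) * measure lborel (cball z (d / 2))"
      using \<phi>(4) half_gt_zero[OF s] d(1) by (intro mult_pos_pos measure_cball_pos) auto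
    ultimately show False by linarith
  qed
  have "q z = 0"
    using no_sign[of 1] no_sign[of "-1"] by (cases "q z" "0::real" rule: linorder_cases) auto
  moreover have "(rho z)\<^sup>2 * Lu z + (?N - 2) * rho z * (z \<bullet> egrad u z) + lam * u z + \<bar>u z\<bar> powr ?p * u z
     = rho z powr ?N * q z"
  proof -
    have r: "0 < rho z" by (rule rho_pos[OF z])
    have "rho z powr ?N * rho z powr (2 - ?N) = rho z powr 2"
      "rho z powr ?N * rho z powr (1 - ?N) = rho z powr 1" "rho z powr ?N * rho z powr (- ?N) = rho z powr 0"
      unfolding powr_add[symmetric] by simp_all
    then have e: "rho z powr ?N * rho z powr (2 - ?N) = (rho z)\<^sup>2"
      "rho z powr ?N * rho z powr (1 - ?N) = rho z" "rho z powr ?N * rho z powr (- ?N) = 1"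
      using r by simp_all
    have "rho z powr ?N * q z = (rho z powr ?N * rho z powr (2 - ?N)) * Lu z
       + (?N - 2) * (rho z powr ?N * rho z powr (1 - ?N)) * (z \<bullet> egrad u z)
       + (lam * u z + \<bar>u z\<bar> powr ?p * u z) * (rho z powr ?N * rho z powr (- ?N))"
      unfolding q_def dX_def n_def by (simp only: algebra_simps)
    then show ?thesis unfolding e by simp
  qed
  ultimately show ?thesis by simp
qed

text \<open>The exponent is left open because two choices are needed. For \<open>c = (N-2)/2\<close>
  the first-order term disappears, which gives a Euclidean equation. For \<open>c = (N-1)/2\<close>
  its coefficient is \<open>-1\<close>, which gives the divergence form
  \<open>rho div (rho \<nabla>g)\<close>, and \<open>c (N - 1 - c)\<close> is maximal.\<close>

lemma conformal_laplacian:
  fixes f :: "real^'n \<Rightarrow> real" and c :: real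
  assumes f: "has_laplacian_on f Df Lf ballN"
  defines "g \<equiv> \<lambda>x. rho x powr (- c) * f x"
    and "Dg \<equiv> \<lambda>x. rho x powr (- c) *\<^sub>R Df x + (c * rho x powr (- c - 1) * f x) *\<^sub>R x"
  obtains Lg where "has_laplacian_on g Dg Lg ballN"
    and "\<And>x. x \<in> ballN \<Longrightarrow>
      rho x powr c * ((rho x)\<^sup>2 * Lg x + (real CARD('n) - 2 - 2 * c) * rho x * (x \<bullet> Dg x))
      = (rho x)\<^sup>2 * Lf x + (real CARD('n) - 2) * rho x * (x \<bullet> Df x)
        + (c * (real CARD('n) - 1 - c) - c * (real CARD('n) - 2 - 2 * c) * rho x) * f x"
proof -
  let ?N = "real CARD('n)"
  define Lr where "Lr x = c * (c + 1) * rho x powr (- c - 2) * (x \<bullet> x) + c * ?N * rho x powr (- c - 1)" for x :: "real^'n"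
  define Lg where "Lg x = rho x powr (- c) * Lf x + f x * Lr x + 2 * c * rho x powr (- c - 1) * (x \<bullet> Df x)" for x
  have "has_laplacian_on (\<lambda>x. rho x powr (- c) * f x)
     (\<lambda>x. rho x powr (- c) *\<^sub>R Df x + f x *\<^sub>R ((- (- c) * rho x powr (- c - 1)) *\<^sub>R x))
     (\<lambda>x. rho x powr (- c) * Lf x + f x * ((- c) * (- c - 1) * rho x powr (- c - 2) * (x \<bullet> x) - (- c) * ?N * rho x powr (- c - 1))
        + 2 * (((- (- c) * rho x powr (- c - 1)) *\<^sub>R x) \<bullet> Df x)) ballN"
    by (rule has_laplacian_on_mult[OF has_laplacian_on_rho_powr f])
  moreover have "f x *\<^sub>R ((- (- c) * rho x powr (- c - 1)) *\<^sub>R x) = (c * rho x powr (- c - 1) * f x) *\<^sub>R x" for x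
    by (simp add: mult_ac)
  moreover have "rho x powr (- c) * Lf x + f x * ((- c) * (- c - 1) * rho x powr (- c - 2) * (x \<bullet> x) - (- c) * ?N * rho x powr (- c - 1))
        + 2 * (((- (- c) * rho x powr (- c - 1)) *\<^sub>R x) \<bullet> Df x) = Lg x" for x
    by (simp add: Lg_def Lr_def algebra_simps)
  ultimately have lap: "has_laplacian_on g Dg Lg ballN"
    by (simp only: g_def Dg_def)
  have eq: "rho x powr c * ((rho x)\<^sup>2 * Lg x + (?N - 2 - 2 * c) * rho x * (x \<bullet> Dg x))
      = (rho x)\<^sup>2 * Lf x + (?N - 2) * rho x * (x \<bullet> Df x)
        + (c * (?N - 1 - c) - c * (?N - 2 - 2 * c) * rho x) * f x" if x: "x \<in> ballN" for x
  proof -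
    define R where "R = rho x"
    define P where "P = R powr (- c)"
    define Q where "Q = R powr c"
    define d where "d = x \<bullet> Df x"
    have R: "0 < R" using rho_pos[OF x] by (simp add: R_def)
    have QP: "Q * P = 1" using R by (simp add: Q_def P_def powr_minus)
    have P1: "R powr (- c - 1) = P / R" and P2: "R powr (- c - 2) = P / R\<^sup>2"
      using R by (auto simp: P_def powr_diff)
    have s: "x \<bullet> x = 1 - 2 * R" by (simp add: R_def inner_self_rho)
    have 1: "R\<^sup>2 * Lg x = P * (R\<^sup>2 * Lf x + f x * (c * (c + 1) * (1 - 2 * R) + c * ?N * R) + 2 * c * R * d)"
      unfolding Lg_def Lr_def R_def[symmetric] P1 P2 P_def[symmetric] s d_def[symmetric]
      using R by (simp add: field_simps power2_eq_square)
    have 2: "R * (x \<bullet> Dg x) = P * (R * d + c * f x * (1 - 2 * R))"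
      unfolding Dg_def R_def[symmetric] P1 P2 P_def[symmetric] inner_add_right inner_scaleR_right s d_def[symmetric]
      using R by (simp add: field_simps)
    have "Q * (R\<^sup>2 * Lg x + (?N - 2 - 2 * c) * R * (x \<bullet> Dg x)) = Q * (R\<^sup>2 * Lg x + (?N - 2 - 2 * c) * (R * (x \<bullet> Dg x)))"
      by simp
    also have "\<dots> = (Q * P) * (R\<^sup>2 * Lf x + f x * (c * (c + 1) * (1 - 2 * R) + c * ?N * R) + 2 * c * R * d
        + (?N - 2 - 2 * c) * (R * d + c * f x * (1 - 2 * R)))"
      unfolding 1 2 by algebra
    also have "\<dots> = R\<^sup>2 * Lf x + (?N - 2) * R * d + (c * (?N - 1 - c) - c * (?N - 2 - 2 * c) * R) * f x"
      unfolding QP by algebra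
    finally show ?thesis
      by (simp only: R_def Q_def d_def)
  qed
  show ?thesis
    by (rule that[OF lap eq])
qed

section \<open>The energy density and its tail near the sphere\<close>

lemma norm_lt_1_ballN: "x \<in> ballN \<longleftrightarrow> norm x < 1"
  by (simp add: ballN_def)

lemma energy_density_nonneg: "x \<in> ballN \<Longrightarrow> 0 \<le> (hgrad_sq u x + (u x)\<^sup>2) * vol_dens x" for x :: "real^'n"
  by (simp add: hgrad_sq_def vol_dens_eq)

lemma energy_density_eq:
  fixes x :: "real^'n"
  assumes "x \<in> ballN"
  shows "(hgrad_sq u x + (u x)\<^sup>2) * vol_dens x
    = rho x powr (2 - real CARD('n)) * (norm (egrad u x))\<^sup>2 + rho x powr (- real CARD('n)) * (u x)\<^sup>2"
proof -
  have "(rho x)\<^sup>2 * rho x powr (- real CARD('n)) = rho x powr (2 - real CARD('n))"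
    using rho_pos[OF assms] powr_add[of "rho x" 2 "- real CARD('n)"] by simp
  then show ?thesis
    using assms by (simp add: vol_dens_eq hgrad_sq_def algebra_simps)
qed

lemma continuous_on_energy_density:
  fixes u :: "real^'n \<Rightarrow> real"
  assumes u: "has_grad_on u (egrad u) ballN" and L: "L \<subseteq> ballN"
  shows "continuous_on L (\<lambda>x. (hgrad_sq u x + (u x)\<^sup>2) * vol_dens x)"
proof (rule continuous_on_eq)
  show "continuous_on L (\<lambda>x. rho x powr (2 - real CARD('n)) * (norm (egrad u x))\<^sup>2 + rho x powr (- real CARD('n)) * (u x)\<^sup>2)"
    by (intro continuous_intros continuous_on_subset[OF has_grad_on_continuous[OF has_grad_on_rho_powr] L]
        continuous_on_subset[OF has_grad_on_continuous[OF u] L] continuous_on_subset[OF has_grad_on_continuous_grad[OF u] L])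
qed (use L in \<open>auto simp: energy_density_eq\<close>)

text \<open>An approximating test function vanishes outside a compact set. Near the sphere its
  \<open>H^1\<close> distance to \<open>u\<close> is therefore the energy of \<open>u\<close>
  itself.\<close>

lemma H1_energy_tail:
  fixes u :: "real^'n \<Rightarrow> real"
  assumes u: "has_grad_on u (egrad u) ballN" and H1: "in_H1 u" and e: "0 < e"
  obtains t where "0 \<le> t" "t < 1" and "\<And>L. compact L \<Longrightarrow> (\<And>x. x \<in> L \<Longrightarrow> t < norm x \<and> norm x < 1) \<Longrightarrow>
     (LINT x:L|lborel. (hgrad_sq u x + (u x)\<^sup>2) * vol_dens x) \<le> e"
proof -
  obtain \<phi> where \<phi>: "\<And>k. test_fun (\<phi> k)" "(\<lambda>k. H1_normsq (\<lambda>x. u x - \<phi> k x)) \<longlonglongrightarrow> 0"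
    using H1 unfolding in_H1_def by blast
  have "\<forall>\<^sub>F k in sequentially. H1_normsq (\<lambda>x. u x - \<phi> k x) < ennreal e"
    using order_tendstoD(2)[OF \<phi>(2), of "ennreal e"] e by simp
  then obtain k where k: "H1_normsq (\<lambda>x. u x - \<phi> k x) < ennreal e"
    by (auto simp: eventually_sequentially)
  obtain K where K: "compact K" "K \<subseteq> ballN" "\<And>x. x \<notin> K \<Longrightarrow> \<phi> k x = 0"
    using \<phi>(1)[of k] unfolding test_fun_def by blast
  obtain t where t: "0 \<le> t" "t < 1" "\<And>x. x \<in> K \<Longrightarrow> norm x \<le> t"
  proof (cases "K = {}")
    case True
    then show ?thesis using that[of 0] by auto
  next
    case False
    obtain y where y: "y \<in> K" "\<And>x. x \<in> K \<Longrightarrow> norm x \<le> norm y"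
      using continuous_attains_sup[OF K(1) False, of norm] by (auto intro: continuous_on_norm_id)
    then show ?thesis
      using that[of "norm y"] K(2) by (auto simp: norm_lt_1_ballN)
  qed
  show ?thesis
  proof (rule that[OF t(1,2)])
    fix L :: "(real^'n) set"
    assume L: "compact L" "\<And>x. x \<in> L \<Longrightarrow> t < norm x \<and> norm x < 1"
    have LB: "L \<subseteq> ballN" and LK: "\<And>x. x \<in> L \<Longrightarrow> x \<notin> K"
      using L(2) t(3) by (force simp: norm_lt_1_ballN)+
    let ?E = "\<lambda>x. (hgrad_sq u x + (u x)\<^sup>2) * vol_dens x"
    have cE: "continuous_on L ?E"
      by (rule continuous_on_energy_density[OF u LB])
    have int: "integrable lborel (\<lambda>x. indicat_real L x * ?E x)"
      using borel_integrable_compact[OF L(1) cE] by simp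
    have "ennreal (\<integral>x. indicat_real L x * ?E x \<partial>lborel) = (\<integral>\<^sup>+x. ennreal (indicat_real L x * ?E x) \<partial>lborel)"
      by (rule nn_integral_eq_integral[OF int, symmetric])
        (use LB energy_density_nonneg in \<open>auto simp: indicator_def intro!: AE_I2\<close>)
    also have "\<dots> \<le> H1_normsq (\<lambda>x. u x - \<phi> k x)"
      unfolding H1_normsq_def
    proof (rule nn_integral_mono)
      fix x :: "real^'n"
      show "ennreal (indicat_real L x * ?E x)
        \<le> indicator ballN x * ennreal ((hgrad_sq (\<lambda>x. u x - \<phi> k x) x + (u x - \<phi> k x)\<^sup>2) * vol_dens x)"
      proof (cases "x \<in> L")
        case True
        then have xB: "x \<in> ballN" and xK: "x \<in> - K" using LB LK by auto
        have "(u has_derivative (\<lambda>h. egrad u x \<bullet> h)) (at x)"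
          by (rule has_grad_onD[OF u xB])
        then have "((\<lambda>x. u x - \<phi> k x) has_derivative (\<lambda>h. egrad u x \<bullet> h)) (at x)"
          by (rule has_derivative_transform_within_open[where s = "- K"])
            (use K xK in \<open>auto simp: compact_imp_closed\<close>)
        from pd_eq[OF this] have "egrad (\<lambda>x. u x - \<phi> k x) x = egrad u x"
          by (simp add: egrad_def vec_eq_iff inner_axis)
        then show ?thesis
          using True xB K(3)[of x] xK by (simp add: hgrad_sq_def)
      qed simp
    qed
    finally have "ennreal (\<integral>x. indicat_real L x * ?E x \<partial>lborel) \<le> ennreal e"
      using k by simp
    then have "(\<integral>x. indicat_real L x * ?E x \<partial>lborel) \<le> e"
      using e by (simp add: ennreal_le_iff)
    then show "(LINT x:L|lborel. ?E x) \<le> e"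
      by (simp add: set_lebesgue_integral_def)
  qed
qed

section \<open>Decay at the boundary\<close>

definition hyp_solution :: "real \<Rightarrow> (real^'n \<Rightarrow> real) \<Rightarrow> (real^'n \<Rightarrow> real) \<Rightarrow> bool" where
  "hyp_solution lam u Lu \<longleftrightarrow> has_laplacian_on u (egrad u) Lu ballN \<and>
    (\<forall>x\<in>ballN. (rho x)\<^sup>2 * Lu x + (real CARD('n) - 2) * rho x * (x \<bullet> egrad u x) + lam * u x
       + \<bar>u x\<bar> powr (4 / (real CARD('n) - 2)) * u x = 0)"

text \<open>Here \<open>a (a + 1) = N (N - 2) / 4\<close>. The potential is kept as
  \<open>|u|^(2/a) / rho^2\<close>, which equals \<open>|w|^(2/a)\<close>: small-energy regularity
  needs the second form, while the gradient bound uses the first together with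
  \<open>|u| \<le> 1\<close>.\<close>

lemma hyp_solution_conformal:
  fixes u :: "real^'n \<Rightarrow> real"
  assumes u: "hyp_solution lam u Lu" and a: "a = (real CARD('n) - 2) / 2"
  obtains Lw where
    "has_laplacian_on (\<lambda>x. rho x powr (- a) * u x)
       (\<lambda>x. rho x powr (- a) *\<^sub>R egrad u x + (a * rho x powr (- a - 1) * u x) *\<^sub>R x) Lw ballN"
    "\<And>x. x \<in> ballN \<Longrightarrow> \<bar>Lw x\<bar> \<le> (\<bar>a * (a + 1) - lam\<bar> + \<bar>u x\<bar> powr (2 / a)) / (rho x)\<^sup>2 * \<bar>rho x powr (- a) * u x\<bar>"
proof -
  let ?N = "real CARD('n)"
  have lap: "has_laplacian_on u (egrad u) Lu ballN"
    using u by (simp add: hyp_solution_def)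
  obtain Lw where Lw: "has_laplacian_on (\<lambda>x. rho x powr (- a) * u x)
       (\<lambda>x. rho x powr (- a) *\<^sub>R egrad u x + (a * rho x powr (- a - 1) * u x) *\<^sub>R x) Lw ballN"
    and eq: "\<And>x. x \<in> ballN \<Longrightarrow>
      rho x powr a * ((rho x)\<^sup>2 * Lw x + (?N - 2 - 2 * a) * rho x * (x \<bullet> (rho x powr (- a) *\<^sub>R egrad u x + (a * rho x powr (- a - 1) * u x) *\<^sub>R x)))
      = (rho x)\<^sup>2 * Lu x + (?N - 2) * rho x * (x \<bullet> egrad u x)
        + (a * (?N - 1 - a) - a * (?N - 2 - 2 * a) * rho x) * u x"
    using conformal_laplacian[OF lap, of a] by blast
  have a1: "?N - 2 - 2 * a = 0" "?N - 1 - a = a + 1" "4 / (?N - 2) = 2 / a"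
    unfolding a by argo+ simp
  have "\<bar>Lw x\<bar> \<le> (\<bar>a * (a + 1) - lam\<bar> + \<bar>u x\<bar> powr (2 / a)) / (rho x)\<^sup>2 * \<bar>rho x powr (- a) * u x\<bar>"
    if x: "x \<in> ballN" for x
  proof -
    have r: "0 < rho x" by (rule rho_pos[OF x])
    have sol: "(rho x)\<^sup>2 * Lu x + (?N - 2) * rho x * (x \<bullet> egrad u x) + lam * u x + \<bar>u x\<bar> powr (2 / a) * u x = 0"
      using u x unfolding hyp_solution_def a1 by blast
    have "rho x powr a * ((rho x)\<^sup>2 * Lw x) = (a * (a + 1) - lam - \<bar>u x\<bar> powr (2 / a)) * u x"
      using eq[OF x] sol unfolding a1 by (simp add: algebra_simps)
    then have "rho x powr (- a) * (rho x powr a * ((rho x)\<^sup>2 * Lw x))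
        = (a * (a + 1) - lam - \<bar>u x\<bar> powr (2 / a)) * (rho x powr (- a) * u x)"
      by simp
    moreover have "rho x powr (- a) * (rho x powr a * ((rho x)\<^sup>2 * Lw x)) = (rho x)\<^sup>2 * Lw x"
      using r by (simp add: powr_minus)
    ultimately have e: "(rho x)\<^sup>2 * Lw x = (a * (a + 1) - lam - \<bar>u x\<bar> powr (2 / a)) * (rho x powr (- a) * u x)"
      by (simp only:)
    have "Lw x = ((rho x)\<^sup>2 * Lw x) / (rho x)\<^sup>2"
      using r by simp
    then have "Lw x = (a * (a + 1) - lam - \<bar>u x\<bar> powr (2 / a)) / (rho x)\<^sup>2 * (rho x powr (- a) * u x)"
      unfolding e by simp
    then have "\<bar>Lw x\<bar> = \<bar>a * (a + 1) - lam - \<bar>u x\<bar> powr (2 / a)\<bar> / (rho x)\<^sup>2 * \<bar>rho x powr (- a) * u x\<bar>"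
      by (simp only: abs_mult abs_divide) simp
    also have "\<dots> \<le> (\<bar>a * (a + 1) - lam\<bar> + \<bar>u x\<bar> powr (2 / a)) / (rho x)\<^sup>2 * \<bar>rho x powr (- a) * u x\<bar>"
      using abs_triangle_ineq4[of "a * (a + 1) - lam" "\<bar>u x\<bar> powr (2 / a)"]
      by (intro mult_right_mono divide_right_mono) auto
    finally show ?thesis .
  qed
  with Lw show ?thesis by (rule that)
qed

lemma rho_bounds:
  assumes "norm x < 1"
  shows "rho x \<le> 1 - norm x" "1 - norm x \<le> 2 * rho x"
proof -
  have "1 - (norm x)\<^sup>2 = (1 - norm x) * (1 + norm x)"
    by (simp add: power2_eq_square algebra_simps)
  moreover have "(1 - norm x) * (1 + norm x) \<le> (1 - norm x) * 2" "(1 - norm x) * 1 \<le> (1 - norm x) * (1 + norm x)"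
    using assms by (intro mult_left_mono; simp)+
  ultimately show "rho x \<le> 1 - norm x" "1 - norm x \<le> 2 * rho x"
    by (auto simp: rho_def)
qed

text \<open>The radius is \<open>2 R\<close> with \<open>R\<close> a quarter of the distance to the
  sphere, so at most half of that distance is used up: \<open>1 - |y|\<close> stays between
  \<open>2 R\<close> and \<open>6 R\<close>, and \<open>rho y\<close> between \<open>R\<close> and
  \<open>6 R\<close>.\<close>

lemma rho_on_cball:
  assumes x: "norm x < 1" and y: "y \<in> cball x (2 * ((1 - norm x) / 4))"
  shows "(1 - norm x) / 4 \<le> rho y" "rho y \<le> 6 * ((1 - norm x) / 4)" "norm y < 1"
    "norm y \<ge> norm x - (1 - norm x) / 2"
proof -
  have d: "norm (y - x) \<le> (1 - norm x) / 2"
    using y by (simp add: dist_norm norm_minus_commute)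
  have 1: "norm y \<le> norm x + (1 - norm x) / 2" "norm y \<ge> norm x - (1 - norm x) / 2"
    using d norm_triangle_ineq2[of y x] norm_triangle_ineq3[of y x] by linarith+
  then show "norm y < 1" "norm y \<ge> norm x - (1 - norm x) / 2"
    using x by argo+
  then show "(1 - norm x) / 4 \<le> rho y" "rho y \<le> 6 * ((1 - norm x) / 4)"
    using 1 rho_bounds[of y] by argo+
qed

text \<open>These compare densities pointwise, so they can be integrated over any compact set. The
  factor \<open>rho^2\<close> in the second one supplies the \<open>R^2\<close> that small-energy
  regularity allows in its \<open>L^2\<close> hypothesis.\<close>

lemma conformal_energy_le:
  fixes u :: "real^'n \<Rightarrow> real"
  assumes a: "a = (real CARD('n) - 2) / 2" and x: "x \<in> ballN"
  shows "(norm (rho x powr (- a) *\<^sub>R egrad u x + (a * rho x powr (- a - 1) * u x) *\<^sub>R x))\<^sup>2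
      \<le> (2 + 2 * a\<^sup>2) * ((hgrad_sq u x + (u x)\<^sup>2) * vol_dens x)" (is "?A \<le> _")
    and "(rho x powr (- a) * u x)\<^sup>2 \<le> (rho x)\<^sup>2 * ((hgrad_sq u x + (u x)\<^sup>2) * vol_dens x)"
proof -
  let ?N = "real CARD('n)"
  have r: "0 < rho x" by (rule rho_pos[OF x])
  have p1: "(rho x powr (- a))\<^sup>2 = rho x powr (2 - ?N)"
    unfolding power2_eq_square powr_add[symmetric] by (rule arg_cong[where f = "\<lambda>c. rho x powr c"]) (simp add: a)
  have p2: "(rho x powr (- a - 1))\<^sup>2 = rho x powr (- ?N)"
    unfolding power2_eq_square powr_add[symmetric] by (rule arg_cong[where f = "\<lambda>c. rho x powr c"]) (simp add: a)
  have p3: "(rho x)\<^sup>2 * rho x powr (- ?N) = rho x powr (2 - ?N)"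
    using r powr_add[of "rho x" 2 "- ?N"] by simp
  let ?g = "rho x powr (2 - ?N) * (norm (egrad u x))\<^sup>2" and ?h = "rho x powr (- ?N) * (u x)\<^sup>2"
  have nonneg: "0 \<le> ?g" "0 \<le> ?h" by auto
  have nx: "(norm x)\<^sup>2 \<le> 1"
    using x by (simp add: norm_lt_1_ballN abs_square_le_1 less_imp_le)
  have "?A \<le> (norm (rho x powr (- a) *\<^sub>R egrad u x) + norm ((a * rho x powr (- a - 1) * u x) *\<^sub>R x))\<^sup>2"
    by (intro power_mono norm_triangle_ineq) auto
  also have "\<dots> \<le> 2 * (norm (rho x powr (- a) *\<^sub>R egrad u x))\<^sup>2 + 2 * (norm ((a * rho x powr (- a - 1) * u x) *\<^sub>R x))\<^sup>2"
    using sum_squares_ge_zero[of "norm (rho x powr (- a) *\<^sub>R egrad u x) - norm ((a * rho x powr (- a - 1) * u x) *\<^sub>R x)" 0]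
    by (simp add: power2_eq_square algebra_simps)
  also have "(norm (rho x powr (- a) *\<^sub>R egrad u x))\<^sup>2 = ?g"
    by (simp add: power_mult_distrib p1)
  also have "(norm ((a * rho x powr (- a - 1) * u x) *\<^sub>R x))\<^sup>2 = a\<^sup>2 * ?h * (norm x)\<^sup>2"
    by (simp add: power_mult_distrib p2)
  also have "a\<^sup>2 * ?h * (norm x)\<^sup>2 \<le> a\<^sup>2 * ?h"
    using nx by (intro mult_left_le) auto
  also have "2 * ?g + 2 * (a\<^sup>2 * ?h) \<le> (2 + 2 * a\<^sup>2) * (?g + ?h)"
    using nonneg by (simp add: algebra_simps)
  finally show "?A \<le> (2 + 2 * a\<^sup>2) * ((hgrad_sq u x + (u x)\<^sup>2) * vol_dens x)"
    by (simp add: energy_density_eq[OF x])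
  have "(rho x powr (- a) * u x)\<^sup>2 = (rho x)\<^sup>2 * ?h"
    by (simp add: power_mult_distrib p1 p3[symmetric])
  also have "\<dots> \<le> (rho x)\<^sup>2 * (?g + ?h)"
    using nonneg by (intro mult_left_mono) auto
  finally show "(rho x powr (- a) * u x)\<^sup>2 \<le> (rho x)\<^sup>2 * ((hgrad_sq u x + (u x)\<^sup>2) * vol_dens x)"
    by (simp add: energy_density_eq[OF x])
qed

lemma solution_tends_to_0:
  fixes u :: "real^'n \<Rightarrow> real"
  assumes N: "3 \<le> CARD('n)" and u: "hyp_solution lam u Lu" and H1: "in_H1 u" and eps: "0 < eps"
  obtains t where "0 \<le> t" "t < 1" "\<And>x. t < norm x \<Longrightarrow> norm x < 1 \<Longrightarrow> \<bar>u x\<bar> < eps"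
proof -
  define a where "a = (real CARD('n) - 2) / 2"
  have a: "0 < a" "a = (real DIM(real^'n) - 2) / 2" using N by (auto simp: a_def)
  have gu: "has_grad_on u (egrad u) ballN"
    using u by (simp add: hyp_solution_def has_laplacian_on_def)
  define w where "w x = rho x powr (- a) * u x" for x
  define Dw where "Dw x = rho x powr (- a) *\<^sub>R egrad u x + (a * rho x powr (- a - 1) * u x) *\<^sub>R x" for x
  obtain Lw where w: "has_laplacian_on w Dw Lw ballN"
    and Lw: "\<And>x. x \<in> ballN \<Longrightarrow> \<bar>Lw x\<bar> \<le> (\<bar>a * (a + 1) - lam\<bar> + \<bar>u x\<bar> powr (2 / a)) / (rho x)\<^sup>2 * \<bar>w x\<bar>"
    using hyp_solution_conformal[OF u a_def] unfolding w_def[abs_def] Dw_def[abs_def] by blast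
  define L where "L = \<bar>a * (a + 1) - lam\<bar>"
  obtain C where C: "0 < C" and reg: "\<And>(f::real^'n \<Rightarrow> real) Df Lf S x R e.
      \<lbrakk>has_laplacian_on f Df Lf S; open S; cball x (2 * R) \<subseteq> S; 0 < R; 0 < e; C * e < 1;
       \<And>y. y \<in> cball x R \<Longrightarrow> \<bar>Lf y\<bar> \<le> L / R\<^sup>2 * \<bar>f y\<bar> + \<bar>f y\<bar> powr (1 + 2 / a);
       (LINT z:cball x (2 * R)|lborel. (norm (Df z))\<^sup>2) \<le> e\<^sup>2;
       (LINT z:cball x (2 * R)|lborel. (f z)\<^sup>2) \<le> (R * e)\<^sup>2\<rbrakk>
      \<Longrightarrow> R powr a * \<bar>f x\<bar> \<le> C * e"
    using small_energy_regularity[OF a(2,1), of L] unfolding L_def by (metis abs_ge_zero)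
  \<comment> \<open>The first entry gives \<open>C * e < 1\<close>; the second leaves room for the
    factor \<open>4^a\<close> lost in passing from \<open>R^a\<close> to \<open>rho^a\<close>, as
    \<open>rho x \<le> 4 * R\<close>.\<close>
  define e where "e = min (1 / (2 * C)) (eps / (2 * 4 powr a * C))"
  have e: "0 < e" "C * e < 1" "4 powr a * (C * e) < eps"
  proof -
    show "0 < e" using C eps by (simp add: e_def)
    have "C * e \<le> C * (1 / (2 * C))" using C by (intro mult_left_mono) (auto simp: e_def)
    then show "C * e < 1" using C by simp
    have "(4 powr a * C) * e \<le> (4 powr a * C) * (eps / (2 * 4 powr a * C))"
      using C by (intro mult_left_mono) (auto simp: e_def)
    also have "\<dots> = eps / 2" using C by simp
    finally show "4 powr a * (C * e) < eps" using eps by (simp add: mult.assoc)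
  qed
  \<comment> \<open>The denominator dominates both losses: \<open>2 + 2 a^2\<close> for the gradient
    of \<open>w\<close>, and \<open>36\<close> from \<open>rho \<le> 6 R\<close> for its
    square.\<close>
  define e1 where "e1 = e\<^sup>2 / (36 + 2 * a\<^sup>2)"
  have e1: "0 < e1" using e by (simp add: e1_def add_pos_nonneg)
  have e1': "(2 + 2 * a\<^sup>2) * e1 \<le> e\<^sup>2" "36 * e1 \<le> e\<^sup>2"
  proof -
    have "(36 + 2 * a\<^sup>2) * e1 = e\<^sup>2"
      using zero_le_power2[of a] by (simp add: e1_def add_nonneg_eq_0_iff del: zero_le_power2)
    moreover have "(2 + 2 * a\<^sup>2) * e1 \<le> (36 + 2 * a\<^sup>2) * e1" "36 * e1 \<le> (36 + 2 * a\<^sup>2) * e1"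
      using e1 by (intro mult_right_mono; simp)+
    ultimately show "(2 + 2 * a\<^sup>2) * e1 \<le> e\<^sup>2" "36 * e1 \<le> e\<^sup>2" by auto
  qed
  obtain t where t: "0 \<le> t" "t < 1" and tail: "\<And>L. compact L \<Longrightarrow> (\<And>x. x \<in> L \<Longrightarrow> t < norm x \<and> norm x < 1) \<Longrightarrow>
     (LINT x:L|lborel. (hgrad_sq u x + (u x)\<^sup>2) * vol_dens x) \<le> e1"
    using H1_energy_tail[OF gu H1 e1] by blast
  let ?E = "\<lambda>x. (hgrad_sq u x + (u x)\<^sup>2) * vol_dens x"
  \<comment> \<open>The threshold is the condition \<open>|x| - (1 - |x|) / 2 > t\<close>, which
    keeps the whole ball of radius \<open>2 R\<close> in the region of small energy.\<close>
  have "\<bar>u x\<bar> < eps" if x: "(1 + 2 * t) / 3 < norm x" "norm x < 1" for x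
  proof -
    define R where "R = (1 - norm x) / 4"
    have R: "0 < R" using x by (simp add: R_def)
    note b = rho_on_cball[OF x(2), folded R_def]
    have tx: "t < norm y" if "y \<in> cball x (2 * R)" for y
    proof -
      have "norm x - (1 - norm x) / 2 > t" using x(1) by argo
      then show ?thesis using b(4)[OF that] by linarith
    qed
    have sub: "cball x (2 * R) \<subseteq> ballN"
      using b(3) by (auto simp: norm_lt_1_ballN)
    have cE: "continuous_on (cball x (2 * R)) ?E"
      by (rule continuous_on_energy_density[OF gu sub])
    have tailE: "(LINT z:cball x (2 * R)|lborel. ?E z) \<le> e1"
      by (rule tail) (use tx b(3) in auto)
    have cw: "continuous_on (cball x (2 * R)) w" "continuous_on (cball x (2 * R)) Dw"
      using w sub has_grad_on_continuous has_grad_on_continuous_grad continuous_on_subset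
      unfolding has_laplacian_on_def by metis+
    have "R powr a * \<bar>w x\<bar> \<le> C * e"
    proof (rule reg[OF w open_ballN sub R e(1,2)])
      fix y assume y: "y \<in> cball x R"
      then have y2: "y \<in> cball x (2 * R)" using R by simp
      have yB: "y \<in> ballN" using sub y2 by blast
      have r: "0 < rho y" by (rule rho_pos[OF yB])
      have "\<bar>u y\<bar> = rho y powr a * \<bar>w y\<bar>"
        using r by (simp add: w_def abs_mult powr_minus)
      then have "\<bar>u y\<bar> powr (2 / a) = (rho y powr a) powr (2 / a) * \<bar>w y\<bar> powr (2 / a)"
        by (simp add: powr_mult)
      also have "(rho y powr a) powr (2 / a) = (rho y)\<^sup>2"
        using r a(1) by (simp add: powr_powr)
      finally have "\<bar>u y\<bar> powr (2 / a) / (rho y)\<^sup>2 * \<bar>w y\<bar> = \<bar>w y\<bar> powr (2 / a) * \<bar>w y\<bar>"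
        using r by simp
      also have "\<dots> = \<bar>w y\<bar> powr (1 + 2 / a)"
        by (cases "w y = 0") (simp_all add: powr_add)
      finally have 1: "\<bar>u y\<bar> powr (2 / a) / (rho y)\<^sup>2 * \<bar>w y\<bar> = \<bar>w y\<bar> powr (1 + 2 / a)" .
      have "L / (rho y)\<^sup>2 * \<bar>w y\<bar> \<le> L / R\<^sup>2 * \<bar>w y\<bar>"
        using b(1)[OF y2] R by (intro mult_right_mono divide_left_mono power_mono) (auto simp: L_def)
      with Lw[OF yB] 1 show "\<bar>Lw y\<bar> \<le> L / R\<^sup>2 * \<bar>w y\<bar> + \<bar>w y\<bar> powr (1 + 2 / a)"
        unfolding L_def[symmetric] add_divide_distrib distrib_right by linarith
    next
      have "(LINT z:cball x (2 * R)|lborel. (norm (Dw z))\<^sup>2) \<le> (LINT z:cball x (2 * R)|lborel. (2 + 2 * a\<^sup>2) * ?E z)"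
        by (intro set_integral_mono set_integrable_compact compact_cball continuous_on_power continuous_on_norm
              continuous_on_mult_left cw cE)
          (use conformal_energy_le(1)[OF a_def] sub in \<open>auto simp: Dw_def\<close>)
      also have "\<dots> = (2 + 2 * a\<^sup>2) * (LINT z:cball x (2 * R)|lborel. ?E z)"
        by simp
      also have "\<dots> \<le> (2 + 2 * a\<^sup>2) * e1"
        using tailE by (intro mult_left_mono) auto
      finally show "(LINT z:cball x (2 * R)|lborel. (norm (Dw z))\<^sup>2) \<le> e\<^sup>2"
        using e1' by simp
    next
      have "(LINT z:cball x (2 * R)|lborel. (w z)\<^sup>2) \<le> (LINT z:cball x (2 * R)|lborel. (36 * R\<^sup>2) * ?E z)"
      proof (intro set_integral_mono set_integrable_compact compact_cball continuous_on_power
          continuous_on_mult_left cw cE)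
        fix z assume z: "z \<in> cball x (2 * R)"
        then have zB: "z \<in> ballN" using sub by blast
        have "(rho z)\<^sup>2 \<le> (6 * R)\<^sup>2"
          using b(2)[OF z] rho_pos[OF zB] by (intro power_mono) auto
        then have "(rho z)\<^sup>2 * ?E z \<le> (36 * R\<^sup>2) * ?E z"
          using energy_density_nonneg[OF zB, of u] by (intro mult_right_mono) (auto simp: power_mult_distrib)
        then show "(w z)\<^sup>2 \<le> (36 * R\<^sup>2) * ?E z"
          using conformal_energy_le(2)[OF a_def zB, of u] by (simp add: w_def)
      qed
      also have "\<dots> = R\<^sup>2 * (36 * (LINT z:cball x (2 * R)|lborel. ?E z))"
        by simp
      also have "\<dots> \<le> R\<^sup>2 * (36 * e1)"
        using tailE by (intro mult_left_mono) auto
      also have "\<dots> \<le> R\<^sup>2 * e\<^sup>2"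
        using e1' by (intro mult_left_mono) auto
      finally show "(LINT z:cball x (2 * R)|lborel. (w z)\<^sup>2) \<le> (R * e)\<^sup>2"
        by (simp add: power_mult_distrib)
    qed
    moreover have "\<bar>u x\<bar> \<le> 4 powr a * (R powr a * \<bar>w x\<bar>)"
    proof -
      have r: "0 < rho x" using x by (intro rho_pos) (simp add: norm_lt_1_ballN)
      have "\<bar>u x\<bar> = rho x powr a * \<bar>w x\<bar>"
        using r by (simp add: w_def abs_mult powr_minus)
      also have "\<dots> \<le> (4 * R) powr a * \<bar>w x\<bar>"
        using r rho_bounds(1)[OF x(2)] a(1) by (intro mult_right_mono powr_mono2) (auto simp: R_def)
      finally show ?thesis using R by (simp add: powr_mult)
    qed
    moreover have "4 powr a * (R powr a * \<bar>w x\<bar>) \<le> 4 powr a * (C * e)"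
      using \<open>R powr a * \<bar>w x\<bar> \<le> C * e\<close> by (intro mult_left_mono) auto
    ultimately show ?thesis using e(3) by linarith
  qed
  then show ?thesis
    by (intro that[of "(1 + 2 * t) / 3"]) (use t in auto)
qed

text \<open>If \<open>|u| \<le> \<delta>\<close> near \<open>x\<close>, then \<open>w\<close> is at
  most \<open>\<delta> R^-a\<close> and its Laplacian is of order \<open>\<delta> R^(-a-2)\<close>,
  so the gradient estimate gives \<open>\<delta> R^(-a-1)\<close>, a power that
  \<open>rho^(a+1)\<close> cancels. The constant is fixed before \<open>t\<close> and
  \<open>\<delta>\<close>, so \<open>\<delta>\<close> can be sent to \<open>0\<close>.\<close>

lemma gradient_tends_to_0:
  fixes u :: "real^'n \<Rightarrow> real"
  assumes N: "3 \<le> CARD('n)" and u: "hyp_solution lam u Lu"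
  obtains C where "0 < C" and "\<And>t \<delta> x. 0 < \<delta> \<Longrightarrow> \<delta> \<le> 1 \<Longrightarrow>
      (\<And>y. t < norm y \<Longrightarrow> norm y < 1 \<Longrightarrow> \<bar>u y\<bar> \<le> \<delta>) \<Longrightarrow>
      (1 + 2 * t) / 3 < norm x \<Longrightarrow> norm x < 1 \<Longrightarrow> rho x * norm (egrad u x) \<le> C * \<delta>"
proof -
  define a where "a = (real CARD('n) - 2) / 2"
  have a: "0 < a" using N by (auto simp: a_def)
  define w where "w x = rho x powr (- a) * u x" for x
  define Dw where "Dw x = rho x powr (- a) *\<^sub>R egrad u x + (a * rho x powr (- a - 1) * u x) *\<^sub>R x" for x
  obtain Lw where w: "has_laplacian_on w Dw Lw ballN"
    and Lw: "\<And>x. x \<in> ballN \<Longrightarrow> \<bar>Lw x\<bar> \<le> (\<bar>a * (a + 1) - lam\<bar> + \<bar>u x\<bar> powr (2 / a)) / (rho x)\<^sup>2 * \<bar>w x\<bar>"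
    using hyp_solution_conformal[OF u a_def] unfolding w_def[abs_def] Dw_def[abs_def] by blast
  define L where "L = \<bar>a * (a + 1) - lam\<bar>"
  have L: "0 \<le> L" by (simp add: L_def)
  obtain K where K: "0 < K" and grad: "\<And>(f::real^'n \<Rightarrow> real) Df Lf S x R A B.
      \<lbrakk>has_laplacian_on f Df Lf S; open S; cball x R \<subseteq> S; 0 < R;
       \<And>y. y \<in> cball x R \<Longrightarrow> \<bar>f y\<bar> \<le> A; \<And>y. y \<in> cball x R \<Longrightarrow> \<bar>Lf y\<bar> \<le> B\<rbrakk>
      \<Longrightarrow> norm (Df x) \<le> K * (A / R + B * R)"
    using gradient_estimate by blast
  \<comment> \<open>\<open>2 + L\<close> adds the contributions \<open>1\<close> of \<open>w\<close>
    and \<open>L + 1\<close> of its Laplacian, the power of \<open>4\<close> comes from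
    \<open>rho x \<le> 4 * R\<close>, and the summand \<open>a\<close> from differentiating
    \<open>rho^-a\<close> in \<open>w\<close>.\<close>
  define C where "C = 4 powr (a + 1) * (K * (2 + L)) + a"
  show ?thesis
  proof (rule that[of C])
    show "0 < C" using K L a by (simp add: C_def add_nonneg_pos)
  next
    fix t \<delta> :: real and x :: "real^'n"
    assume \<delta>: "0 < \<delta>" "\<delta> \<le> 1" and small: "\<And>y::real^'n. t < norm y \<Longrightarrow> norm y < 1 \<Longrightarrow> \<bar>u y\<bar> \<le> \<delta>"
      and x: "(1 + 2 * t) / 3 < norm x" "norm x < 1"
    define R where "R = (1 - norm x) / 4"
    have R: "0 < R" using x by (simp add: R_def)
    note b = rho_on_cball[OF x(2), folded R_def]
    have in2: "y \<in> cball x (2 * R)" if "y \<in> cball x R" for y using that R by simp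
    have tx: "\<bar>u y\<bar> \<le> \<delta>" if "y \<in> cball x R" for y
    proof -
      have "norm x - (1 - norm x) / 2 > t" using x(1) by argo
      then have "t < norm y" using b(4)[OF in2[OF that]] by linarith
      then show ?thesis using small b(3)[OF in2[OF that]] by blast
    qed
    have sub: "cball x R \<subseteq> ballN"
      using b(3) in2 by (auto simp: norm_lt_1_ballN)
    define A where "A = \<delta> * R powr (- a)"
    have A0: "0 \<le> A" using \<delta> by (simp add: A_def)
    have wA: "\<bar>w y\<bar> \<le> A" if y: "y \<in> cball x R" for y
    proof -
      have "rho y powr (- a) \<le> R powr (- a)"
        using b(1)[OF in2[OF y]] R a by (intro powr_mono2') auto
      then have "rho y powr (- a) * \<bar>u y\<bar> \<le> R powr (- a) * \<delta>"
        using tx[OF y] by (intro mult_mono) auto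
      then show ?thesis by (simp add: w_def A_def abs_mult mult.commute)
    qed
    have LB: "\<bar>Lw y\<bar> \<le> (L + 1) / R\<^sup>2 * A" if y: "y \<in> cball x R" for y
    proof -
      have "\<bar>u y\<bar> powr (2 / a) \<le> 1"
        using tx[OF y] \<delta> a by (intro powr_le1) auto
      moreover have "R\<^sup>2 \<le> (rho y)\<^sup>2"
        using b(1)[OF in2[OF y]] R by (intro power_mono) auto
      ultimately have "(L + \<bar>u y\<bar> powr (2 / a)) / (rho y)\<^sup>2 \<le> (L + 1) / R\<^sup>2"
        using L R by (intro frac_le) auto
      then have "(L + \<bar>u y\<bar> powr (2 / a)) / (rho y)\<^sup>2 * \<bar>w y\<bar> \<le> (L + 1) / R\<^sup>2 * A"
        using wA[OF y] L by (intro mult_mono) auto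
      then show ?thesis
        using Lw[of y] sub y unfolding L_def[symmetric] by (meson order_trans subsetD)
    qed
    have "norm (Dw x) \<le> K * (A / R + (L + 1) / R\<^sup>2 * A * R)"
      by (rule grad[OF w open_ballN sub R wA LB])
    also have "\<dots> = K * (2 + L) * \<delta> * (R powr (- a) / R)"
      using R by (simp add: A_def power2_eq_square field_simps)
    also have "R powr (- a) / R = R powr (- (a + 1))"
      using R by (simp add: powr_diff)
    finally have Dw: "norm (Dw x) \<le> K * (2 + L) * \<delta> * R powr (- (a + 1))" .
    have xB: "x \<in> ballN" using x by (simp add: norm_lt_1_ballN)
    have r: "0 < rho x" by (rule rho_pos[OF xB])
    have "rho x *\<^sub>R egrad u x = rho x powr (a + 1) *\<^sub>R Dw x - (a * u x) *\<^sub>R x"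
    proof -
      have "rho x powr (a + 1) * rho x powr (- a) = rho x"
        unfolding powr_add[symmetric] using r by simp
      moreover have "rho x powr (a + 1) * rho x powr (- a - 1) = 1"
        unfolding powr_add[symmetric] using r by simp
      ultimately show ?thesis
        by (simp add: Dw_def scaleR_add_right algebra_simps)
    qed
    then have "rho x * norm (egrad u x) = norm (rho x powr (a + 1) *\<^sub>R Dw x - (a * u x) *\<^sub>R x)"
      using r by (metis abs_of_pos norm_scaleR)
    also have "\<dots> \<le> norm (rho x powr (a + 1) *\<^sub>R Dw x) + norm ((a * u x) *\<^sub>R x)"
      by (rule norm_triangle_ineq4)
    also have "\<dots> \<le> 4 powr (a + 1) * (K * (2 + L)) * \<delta> + a * \<delta>"
    proof (rule add_mono)
      have "rho x powr (a + 1) \<le> (4 * R) powr (a + 1)"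
        using r rho_bounds(1)[OF x(2)] a by (intro powr_mono2) (auto simp: R_def)
      then have "rho x powr (a + 1) * norm (Dw x) \<le> (4 * R) powr (a + 1) * (K * (2 + L) * \<delta> * R powr (- (a + 1)))"
        using Dw by (intro mult_mono) auto
      also have "\<dots> = 4 powr (a + 1) * (K * (2 + L)) * \<delta> * (R powr (a + 1) * R powr (- (a + 1)))"
        using R by (simp add: powr_mult mult_ac)
      also have "R powr (a + 1) * R powr (- (a + 1)) = 1"
        unfolding powr_add[symmetric] using R by simp
      finally show "norm (rho x powr (a + 1) *\<^sub>R Dw x) \<le> 4 powr (a + 1) * (K * (2 + L)) * \<delta>"
        by simp
      have "\<bar>u x\<bar> * norm x \<le> \<delta> * 1"
        using tx[of x] R x by (intro mult_mono) auto
      then show "norm ((a * u x) *\<^sub>R x) \<le> a * \<delta>"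
        using a by (simp add: abs_mult mult.assoc)
    qed
    also have "\<dots> = C * \<delta>"
      by (simp add: C_def algebra_simps)
    finally show "rho x * norm (egrad u x) \<le> C * \<delta>" .
  qed
qed

lemma solution_and_gradient_tend_to_0:
  fixes u :: "real^'n \<Rightarrow> real"
  assumes N: "3 \<le> CARD('n)" and u: "hyp_solution lam u Lu" and H1: "in_H1 u" and eps: "0 < eps"
  shows "\<exists>\<delta>>0. \<forall>x\<in>ballN. 1 - \<delta> < norm x \<longrightarrow> \<bar>u x\<bar> + hgrad_sq u x < eps"
proof -
  obtain C where C: "0 < C" and grad: "\<And>t \<delta> x. 0 < \<delta> \<Longrightarrow> \<delta> \<le> 1 \<Longrightarrow>
      (\<And>y. t < norm y \<Longrightarrow> norm y < 1 \<Longrightarrow> \<bar>u y\<bar> \<le> \<delta>) \<Longrightarrow>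
      (1 + 2 * t) / 3 < norm x \<Longrightarrow> norm x < 1 \<Longrightarrow> rho x * norm (egrad u x) \<le> C * \<delta>"
    using gradient_tends_to_0[OF N u] by blast
  \<comment> \<open>Since \<open>d \<le> 1\<close>, the squared gradient is at most
    \<open>C^2 d\<close>, and the two contributions together stay below
    \<open>(1 + C^2) d\<close>.\<close>
  define d where "d = min 1 (eps / 2 / (1 + C\<^sup>2))"
  have pos: "0 < 1 + C\<^sup>2" by (simp add: add_pos_nonneg)
  have d: "0 < d" "d \<le> 1" using eps pos by (auto simp: d_def)
  have "(1 + C\<^sup>2) * d \<le> (1 + C\<^sup>2) * (eps / 2 / (1 + C\<^sup>2))"
    using pos by (intro mult_left_mono) (auto simp: d_def)
  also have "\<dots> = eps / 2" using pos by (metis less_irrefl nonzero_mult_div_cancel_left times_divide_eq_right)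
  finally have d2: "(1 + C\<^sup>2) * d < eps" using eps by simp
  obtain t where t: "0 \<le> t" "t < 1" "\<And>x. t < norm x \<Longrightarrow> norm x < 1 \<Longrightarrow> \<bar>u x\<bar> < d"
    using solution_tends_to_0[OF N u H1 d(1)] by blast
  have "\<bar>u x\<bar> + hgrad_sq u x < eps" if x: "(1 + 2 * t) / 3 < norm x" "norm x < 1" for x
  proof -
    have "t \<le> (1 + 2 * t) / 3" using t by simp
    then have 1: "\<bar>u x\<bar> < d" using t(3) x by simp
    have r: "0 < rho x" using x by (intro rho_pos) (simp add: norm_lt_1_ballN)
    have "rho x * norm (egrad u x) \<le> C * d"
      by (rule grad[OF d]) (use t(3) x less_imp_le in blast)+
    then have "hgrad_sq u x \<le> (C * d)\<^sup>2"
      unfolding hgrad_sq_def power_mult_distrib[symmetric] using r by (intro power_mono) auto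
    also have "\<dots> = C\<^sup>2 * d * d"
      by (simp add: power2_eq_square)
    also have "\<dots> \<le> C\<^sup>2 * d"
      using d by (intro mult_left_le) auto
    finally show ?thesis using 1 d2 by (simp add: algebra_simps)
  qed
  then show ?thesis
    by (intro exI[of _ "1 - (1 + 2 * t) / 3"]) (use t in \<open>auto simp: norm_lt_1_ballN\<close>)
qed

section \<open>Comparison with barriers\<close>

text \<open>Quadratic at \<open>0\<close>, so that it is C^1, but of linear growth. The positive
  part itself has a corner, and its square violates the inequality \<open>ramp_sq_le\<close> for
  large arguments.\<close>

definition ramp :: "real \<Rightarrow> real" where
  "ramp s = (max 0 s)\<^sup>2 / (1 + max 0 s)"

definition ramp' :: "real \<Rightarrow> real" where
  "ramp' s = (2 * max 0 s + (max 0 s)\<^sup>2) / (1 + max 0 s)\<^sup>2"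

lemma has_real_derivative_ramp: "(ramp has_real_derivative ramp' s) (at s)"
proof -
  consider "s > 0" | "s < 0" | "s = 0" by linarith
  then show ?thesis
  proof cases
    case 1
    have "((\<lambda>s. s\<^sup>2 / (1 + s)) has_real_derivative ramp' s) (at s)"
      using 1 by (auto intro!: derivative_eq_intros simp: ramp'_def power2_eq_square field_simps)
    then show ?thesis
      by (rule has_field_derivative_transform_within_open[where S = "{0<..}"]) (use 1 in \<open>auto simp: ramp_def\<close>)
  next
    case 2
    have "((\<lambda>s. 0) has_real_derivative ramp' s) (at s)"
      using 2 by (auto simp: ramp'_def)
    then show ?thesis
      by (rule has_field_derivative_transform_within_open[where S = "{..<0}"]) (use 2 in \<open>auto simp: ramp_def\<close>)
  next
    case 3
    have "((\<lambda>h. ramp h / h) \<longlongrightarrow> 0) (at 0)"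
    proof (rule Lim_null_comparison)
      have "\<bar>ramp h / h\<bar> \<le> \<bar>h\<bar>" for h
      proof (cases "0 < h")
        case True
        then have "ramp h / h = h / (1 + h)"
          by (simp add: ramp_def power2_eq_square)
        also have "\<dots> \<le> h"
          using True by (simp add: divide_le_eq distrib_left)
        finally show ?thesis
          using True by (simp add: ramp_def)
      qed (simp add: ramp_def)
      then show "\<forall>\<^sub>F h in at 0. norm (ramp h / h) \<le> \<bar>h\<bar>"
        by (simp add: always_eventually)
      show "((\<lambda>h::real. \<bar>h\<bar>) \<longlongrightarrow> 0) (at 0)"
        using tendsto_rabs_zero[OF tendsto_ident_at[of "0::real" UNIV]] by simp
    qed
    then show ?thesis
      using 3 by (simp add: DERIV_def ramp_def ramp'_def)
  qed
qed

lemma continuous_on_ramp': "continuous_on S ramp'"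
proof -
  have "1 + max 0 s \<noteq> 0" for s :: real by simp
  then show ?thesis
    unfolding ramp'_def by (intro continuous_intros) auto
qed

lemma ramp_nonneg: "0 \<le> ramp s"
  by (simp add: ramp_def)

lemma ramp'_nonneg: "0 \<le> ramp' s"
  by (simp add: ramp'_def)

lemma ramp_pos: "0 < s \<Longrightarrow> 0 < ramp s"
  by (simp add: ramp_def)

text \<open>The absorption inequality: it bounds \<open>ramp h\<close> by
  \<open>sqrt (ramp' h)\<close> times the positive part of \<open>h\<close>, so a product of
  \<open>ramp h\<close> and the gradient splits into the good term \<open>ramp' h\<close> times the
  squared gradient and a multiple of \<open>h^2\<close>.\<close>

lemma ramp_sq_le: "(ramp s)\<^sup>2 \<le> ramp' s * (max 0 s)\<^sup>2"
proof -
  define m where "m = max 0 s"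
  have m: "0 \<le> m" by (simp add: m_def)
  have "m\<^sup>2 * m\<^sup>2 \<le> (2 * m + m\<^sup>2) * m\<^sup>2"
    using m by (intro mult_right_mono) auto
  then show ?thesis
    unfolding ramp_def ramp'_def m_def[symmetric]
    by (simp add: power_divide divide_right_mono power2_eq_square)
qed

lemma set_integral_subset_Un_le:
  fixes g :: "'a::euclidean_space \<Rightarrow> real"
  assumes K: "compact K" "compact L1" "compact L2" "K \<subseteq> L1 \<union> L2"
    and g: "continuous_on (L1 \<union> L2) g" "\<And>x. x \<in> L1 \<union> L2 \<Longrightarrow> 0 \<le> g x"
  shows "(LINT x:K|lborel. g x) \<le> (LINT x:L1|lborel. g x) + (LINT x:L2|lborel. g x)"
proof -
  have i: "integrable lborel (\<lambda>x. indicat_real M x *\<^sub>R g x)" if "compact M" "M \<subseteq> L1 \<union> L2" for M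
    by (rule borel_integrable_compact[OF that(1) continuous_on_subset[OF g(1) that(2)]])
  have "(LINT x:K|lborel. g x) \<le> (\<integral>x. indicat_real L1 x *\<^sub>R g x + indicat_real L2 x *\<^sub>R g x \<partial>lborel)"
    unfolding set_lebesgue_integral_def
  proof (rule integral_mono)
    show "integrable lborel (\<lambda>x. indicat_real L1 x *\<^sub>R g x + indicat_real L2 x *\<^sub>R g x)"
      by (intro Bochner_Integration.integrable_add i K) auto
    show "indicat_real K x *\<^sub>R g x \<le> indicat_real L1 x *\<^sub>R g x + indicat_real L2 x *\<^sub>R g x" for x
      using K(4) g(2)[of x] by (auto simp: indicator_def)
  qed (use i K in auto)
  also have "\<dots> = (LINT x:L1|lborel. g x) + (LINT x:L2|lborel. g x)"
    unfolding set_lebesgue_integral_def by (rule Bochner_Integration.integral_add) (use i K in auto)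
  finally show ?thesis .
qed

lemma compact_rho_ge: "compact {x :: real^'n. t \<le> rho x}"
proof -
  have "closed {x :: real^'n. t \<le> rho x}"
    by (intro closed_Collect_le continuous_on_const continuous_on_rho)
  moreover have "norm x \<le> 1 + (1 + \<bar>t\<bar>)" if "t \<le> rho x" for x :: "real^'n"
  proof (rule ccontr)
    assume *: "\<not> norm x \<le> 1 + (1 + \<bar>t\<bar>)"
    then have "norm x * 1 \<le> norm x * norm x" by (intro mult_left_mono) auto
    moreover have "(norm x)\<^sup>2 \<le> 1 - 2 * t" using that by (simp add: rho_def)
    moreover have "2 * norm x \<le> norm x * norm x" using * by (intro mult_right_mono) auto
    ultimately show False using * unfolding power2_eq_square by linarith
  qed
  then have "bounded {x :: real^'n. t \<le> rho x}"
    by (auto simp: bounded_iff)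
  ultimately show ?thesis
    by (simp add: compact_eq_bounded_closed)
qed

lemma rho_ge_subset_ballN:
  assumes "0 < t"
  shows "{x :: real^'n. t \<le> rho x} \<subseteq> ballN"
proof
  fix x :: "real^'n" assume "x \<in> {x. t \<le> rho x}"
  then have "(norm x)\<^sup>2 < 1" using assms by (simp add: rho_def)
  then show "x \<in> ballN" by (simp add: norm_lt_1_ballN abs_square_less_1)
qed

text \<open>Testing \<open>div (rho Dh)\<close> with \<open>ramp h\<close> times the square of the cutoff
  \<open>max 0 (1 - t / rho)\<close>; \<open>ramp\<close> is a smoothed positive part for which Young's inequality still
  absorbs the gradient term, and only a bound on \<open>h\<^sup>2\<close> is needed for the remaining one.\<close>

lemma comparison_integral_inequality:
  fixes h :: "real^'n \<Rightarrow> real"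
  assumes h: "has_laplacian_on h Dh Lh ballN"
    and sub: "\<And>x. x \<in> ballN \<Longrightarrow> 0 < h x \<Longrightarrow> q * h x \<le> rho x * (rho x * Lh x - x \<bullet> Dh x)"
    and q: "0 < q" and t: "0 < t"
  shows "q * (LINT x:{x. t \<le> rho x}|lborel. ramp (h x) * h x * (1 - t / rho x)\<^sup>2 / rho x)
    \<le> (LINT x:{x. t \<le> rho x}|lborel. (max 0 (h x))\<^sup>2 / rho x * (t / rho x)\<^sup>2)"
proof -
  let ?B = "ballN :: (real^'n) set"
  let ?K = "{x :: real^'n. t \<le> rho x}"
  have gh: "has_grad_on h Dh ?B" and dh: "has_div_on Dh Lh ?B"
    using h by (auto simp: has_laplacian_on_def)
  have KB: "?K \<subseteq> ?B"
    by (rule rho_ge_subset_ballN[OF t])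
  \<comment> \<open>The cutoff vanishes where \<open>rho \<le> t\<close> and its gradient has length
    at most \<open>t / rho^2\<close>; its square is C^1.\<close>
  define eta where "eta x = max 0 (1 - t * rho x powr (- 1))" for x :: "real^'n"
  have eta: "eta x = 1 - t / rho x" "0 \<le> eta x" if "x \<in> ?K" for x
    using that t by (auto simp: eta_def powr_minus_divide)
  have g1: "has_grad_on (\<lambda>x. 1 - t * rho x powr (- 1)) (\<lambda>x. 0 - t *\<^sub>R ((- (- 1) * rho x powr (- 1 - 1)) *\<^sub>R x)) ?B"
    by (intro has_grad_on_diff has_grad_on_const has_grad_on_cmult has_grad_on_rho_powr)
  have g2: "has_grad_on (\<lambda>x. (eta x)\<^sup>2) (\<lambda>x. (- 2 * eta x * (t * rho x powr (- 2))) *\<^sub>R x) ?B"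
  proof -
    have "has_grad_on (\<lambda>x. max 0 (1 - t * rho x powr (- 1)) ^ Suc 1)
      (\<lambda>x. (real (Suc 1) * max 0 (1 - t * rho x powr (- 1)) ^ 1) *\<^sub>R (0 - t *\<^sub>R ((- (- 1) * rho x powr (- 1 - 1)) *\<^sub>R x))) ?B"
    proof (rule has_grad_on_compose[OF g1, where \<phi> = "\<lambda>s. max 0 s ^ Suc 1" and \<phi>' = "\<lambda>s. real (Suc 1) * max 0 s ^ 1"])
      show "((\<lambda>s. max 0 s ^ Suc 1) has_real_derivative real (Suc 1) * max 0 s ^ 1) (at s)" for s :: real
        by (rule has_real_derivative_max_0_power) simp
    qed (intro continuous_intros)
    then have "has_grad_on (\<lambda>x. (eta x)\<^sup>2)
      (\<lambda>x. (real (Suc 1) * max 0 (1 - t * rho x powr (- 1)) ^ 1) *\<^sub>R (0 - t *\<^sub>R ((- (- 1) * rho x powr (- 1 - 1)) *\<^sub>R x))) ?B"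
      by (simp add: eta_def numeral_2_eq_2)
    then show ?thesis
      by (rule has_grad_on_cong) (simp add: eta_def mult_ac)
  qed
  have g3: "has_grad_on (\<lambda>x. ramp (h x)) (\<lambda>x. ramp' (h x) *\<^sub>R Dh x) ?B"
    by (rule has_grad_on_compose[OF gh has_real_derivative_ramp continuous_on_ramp'])
  define f where "f x = ramp (h x) * (eta x)\<^sup>2" for x
  define Df where "Df x = ramp (h x) *\<^sub>R ((- 2 * eta x * (t * rho x powr (- 2))) *\<^sub>R x) + (eta x)\<^sup>2 *\<^sub>R (ramp' (h x) *\<^sub>R Dh x)" for x
  define X where "X x = rho x *\<^sub>R Dh x" for x
  define dX where "dX x = rho x * Lh x - x \<bullet> Dh x" for x
  have gf: "has_grad_on f Df ?B"
    unfolding f_def Df_def by (rule has_grad_on_mult[OF g3 g2])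
  have X: "has_div_on X dX ?B"
    unfolding X_def dX_def by (rule has_div_on_cong[OF has_div_on_scaleR[OF has_grad_on_rho dh]]) simp
  have ibp: "(LINT x:?K|lborel. f x * dX x + Df x \<bullet> X x) = 0"
  proof (rule integral_by_parts_divergence[OF gf X open_ballN compact_rho_ge KB])
    fix x assume x: "x \<in> ?B - ?K"
    then have "0 < rho x" "rho x < t" using rho_pos by auto
    then have "eta x = 0" by (auto simp: eta_def powr_minus_divide)
    then show "f x *\<^sub>R X x = 0" by (simp add: f_def)
  qed
  define P where "P x = ramp (h x) * h x * (1 - t / rho x)\<^sup>2 / rho x" for x
  define Q where "Q x = (max 0 (h x))\<^sup>2 / rho x * (t / rho x)\<^sup>2" for x
  have cB: "continuous_on ?K h" "continuous_on ?K (\<lambda>x. ramp (h x))"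
    using continuous_on_subset[OF has_grad_on_continuous KB] gh g3 by blast+
  have r0: "\<forall>x\<in>?K. rho x \<noteq> 0" using t by auto
  have cP: "continuous_on ?K P" "continuous_on ?K Q"
    unfolding P_def Q_def by (intro continuous_intros cB continuous_on_rho r0)+
  have cF: "continuous_on ?K (\<lambda>x. f x * dX x + Df x \<bullet> X x)"
    by (rule continuous_on_subset[OF _ KB])
      (intro continuous_intros has_grad_on_continuous[OF gf] has_grad_on_continuous_grad[OF gf]
        has_div_on_continuous[OF X] has_div_on_continuous_div[OF X])
  have pw: "q * P x - Q x \<le> f x * dX x + Df x \<bullet> X x" if x: "x \<in> ?K" for x
  proof (cases "0 < h x")
    case False
    then show ?thesis by (simp add: P_def Q_def f_def Df_def ramp_def ramp'_def)
  next
    case True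
    have xB: "x \<in> ?B" using KB x by blast
    define r where "r = rho x"
    have r: "0 < r" using rho_pos[OF xB] by (simp add: r_def)
    define e where "e = eta x"
    have e: "e = 1 - t / r" "0 \<le> e" using eta[OF x] by (simp_all add: e_def r_def)
    define g where "g = ramp (h x)"
    define g' where "g' = ramp' (h x)"
    have g: "0 \<le> g" "0 \<le> g'" by (simp_all add: g_def g'_def ramp_nonneg ramp'_nonneg)
    define D where "D = norm (Dh x)"
    define k where "k = t / r\<^sup>2"
    have k: "0 \<le> k" using t r by (simp add: k_def)
    have 1: "g * e\<^sup>2 * (q * h x / r) \<le> f x * dX x"
    proof -
      have "q * h x / r \<le> dX x"
        using sub[OF xB True] r by (simp add: dX_def r_def[symmetric] field_simps)
      then have "(g * e\<^sup>2) * (q * h x / r) \<le> (g * e\<^sup>2) * dX x"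
        using g by (intro mult_left_mono) auto
      then show ?thesis by (simp add: f_def g_def e_def)
    qed
    have gm: "g \<le> sqrt g' * h x"
    proof -
      have "g\<^sup>2 \<le> g' * (h x)\<^sup>2"
        using ramp_sq_le[of "h x"] True by (simp add: g_def g'_def max_def)
      then have "g \<le> sqrt (g' * (h x)\<^sup>2)" by (rule real_le_rsqrt)
      then show ?thesis using True by (simp add: real_sqrt_mult)
    qed
    have xd: "x \<bullet> Dh x \<le> D"
    proof -
      have "x \<bullet> Dh x \<le> norm x * norm (Dh x)" by (rule norm_cauchy_schwarz)
      also have "\<dots> \<le> 1 * norm (Dh x)"
        using xB by (intro mult_right_mono) (auto simp: norm_lt_1_ballN)
      finally show ?thesis by (simp add: D_def)
    qed
    have Dfx: "Df x \<bullet> X x = r * (e\<^sup>2 * g' * D\<^sup>2 - 2 * g * e * k * (x \<bullet> Dh x))"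
    proof -
      have "rho x powr (- 2) = 1 / r\<^sup>2"
        using r by (simp add: r_def powr_minus_divide)
      then have "Df x \<bullet> X x = (g *\<^sub>R ((- 2 * e * k) *\<^sub>R x) + e\<^sup>2 *\<^sub>R (g' *\<^sub>R Dh x)) \<bullet> (r *\<^sub>R Dh x)"
        by (simp add: Df_def X_def g_def g'_def e_def k_def r_def)
      also have "\<dots> = r * (e\<^sup>2 * g' * (Dh x \<bullet> Dh x) - 2 * g * e * k * (x \<bullet> Dh x))"
        by (simp add: inner_add_left algebra_simps)
      finally show ?thesis by (simp add: D_def power2_norm_eq_inner)
    qed
    \<comment> \<open>Completing the square with \<open>sqrt g' * e * D\<close> and
      \<open>h x * k\<close>: the first square is the good gradient term, and the second, multiplied
      by \<open>r\<close>, is exactly \<open>Q\<close>, because \<open>k = t / r^2\<close>.\<close>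
    have "2 * g * e * k * (x \<bullet> Dh x) \<le> 2 * g * e * k * D"
      using g e k xd by (intro mult_left_mono mult_nonneg_nonneg) auto
    also have "\<dots> = g * (2 * e * k * D)" by simp
    also have "\<dots> \<le> (sqrt g' * h x) * (2 * e * k * D)"
      using gm e k by (intro mult_right_mono mult_nonneg_nonneg) (auto simp: D_def)
    also have "\<dots> \<le> e\<^sup>2 * g' * D\<^sup>2 + (h x)\<^sup>2 * k\<^sup>2"
    proof -
      have "0 \<le> (sqrt g' * e * D - h x * k)\<^sup>2" by simp
      also have "\<dots> = (sqrt g')\<^sup>2 * e\<^sup>2 * D\<^sup>2 + (h x)\<^sup>2 * k\<^sup>2 - (sqrt g' * h x) * (2 * e * k * D)"
        by (simp add: power2_diff power_mult_distrib algebra_simps)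
      finally show ?thesis using g by (simp add: mult_ac)
    qed
    finally have "- ((h x)\<^sup>2 * k\<^sup>2) \<le> e\<^sup>2 * g' * D\<^sup>2 - 2 * g * e * k * (x \<bullet> Dh x)" by simp
    then have "r * (- ((h x)\<^sup>2 * k\<^sup>2)) \<le> Df x \<bullet> X x"
      unfolding Dfx using r by (intro mult_left_mono) auto
    moreover have "r * (- ((h x)\<^sup>2 * k\<^sup>2)) = - Q x"
      using r True by (simp add: Q_def k_def r_def[symmetric] power2_eq_square field_simps)
    moreover have "g * e\<^sup>2 * (q * h x / r) = q * P x"
      by (simp add: P_def e g_def r_def[symmetric])
    ultimately show ?thesis using 1 by linarith
  qed
  have "(LINT x:?K|lborel. q * P x - Q x) \<le> (LINT x:?K|lborel. f x * dX x + Df x \<bullet> X x)"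
    by (intro set_integral_mono set_integrable_compact compact_rho_ge cF continuous_intros cP pw)
  moreover have "(LINT x:?K|lborel. q * P x - Q x) = q * (LINT x:?K|lborel. P x) - (LINT x:?K|lborel. Q x)"
    by (subst set_integral_diff(2)) (intro set_integrable_compact compact_rho_ge continuous_intros cP | simp)+
  ultimately show ?thesis
    using ibp by (simp add: P_def Q_def)
qed

text \<open>As the cutoff level \<open>\<tau>\<close> decreases, the left side of the integral
  inequality stays bounded below because of a ball where \<open>h > 0\<close>. The right side
  becomes small: on an inner ball through the factor \<open>\<tau>^2\<close>, and near the sphere
  because \<open>\<tau> / rho \<le> 1\<close> and the tail of \<open>E\<close> is small.\<close>

lemma comparison_nonpos:
  fixes h :: "real^'n \<Rightarrow> real"
  assumes h: "has_laplacian_on h Dh Lh ballN"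
    and sub: "\<And>x. x \<in> ballN \<Longrightarrow> 0 < h x \<Longrightarrow> q * h x \<le> rho x * (rho x * Lh x - x \<bullet> Dh x)"
    and q: "0 < q"
    and E: "continuous_on ballN E" "\<And>x. x \<in> ballN \<Longrightarrow> 0 \<le> E x"
    and dom: "\<And>x. x \<in> ballN \<Longrightarrow> 0 < h x \<Longrightarrow> (h x)\<^sup>2 / rho x \<le> E x"
    and tail: "\<And>e. 0 < e \<Longrightarrow> \<exists>t<1. \<forall>L. compact L \<longrightarrow> (\<forall>x\<in>L. t < norm x \<and> norm x < 1) \<longrightarrow> (LINT x:L|lborel. E x) \<le> e"
    and z: "z \<in> ballN"
  shows "h z \<le> 0"
proof (rule ccontr)
  assume "\<not> h z \<le> 0"
  then have hz: "0 < h z" by simp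
  let ?B = "ballN :: (real^'n) set"
  have gh: "has_grad_on h Dh ?B" using h by (simp add: has_laplacian_on_def)
  have ch: "continuous_on ?B h" by (rule has_grad_on_continuous[OF gh])
  have cr: "continuous_on ?B (\<lambda>x. ramp (h x))"
    by (rule has_grad_on_continuous[OF has_grad_on_compose[OF gh has_real_derivative_ramp continuous_on_ramp']])
  obtain d where d: "0 < d" "cball z d \<subseteq> ?B" and hpos: "\<And>x. x \<in> cball z d \<Longrightarrow> 0 < h x"
  proof -
    have "open {x \<in> ?B. 0 < h x}"
      using continuous_open_preimage[OF ch open_ballN, of "{0<..}"] by (simp add: vimage_def Int_def)
    then obtain d where "0 < d" "cball z d \<subseteq> {x \<in> ?B. 0 < h x}"
      using z hz unfolding open_contains_cball by blast
    then show ?thesis using that[of d] by blast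
  qed
  have rpos: "\<And>x. x \<in> cball z d \<Longrightarrow> 0 < rho x" using d(2) rho_pos by blast
  have ne: "cball z d \<noteq> {}" using d(1) by simp
  obtain y1 where y1: "y1 \<in> cball z d" "\<And>y. y \<in> cball z d \<Longrightarrow> rho y1 \<le> rho y"
    using continuous_attains_inf[OF compact_cball ne continuous_on_rho] by blast
  define r0 where "r0 = rho y1"
  have r0: "0 < r0" using rpos y1 by (simp add: r0_def)
  have "continuous_on (cball z d) (\<lambda>x. ramp (h x) * h x / rho x)"
    using rpos by (intro continuous_intros continuous_on_subset[OF ch d(2)] continuous_on_subset[OF cr d(2)] continuous_on_rho) force
  then obtain y2 where y2: "y2 \<in> cball z d"
    "\<And>y. y \<in> cball z d \<Longrightarrow> ramp (h y2) * h y2 / rho y2 \<le> ramp (h y) * h y / rho y"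
    using continuous_attains_inf[OF compact_cball ne, of "\<lambda>x. ramp (h x) * h x / rho x"] by blast
  define m0 where "m0 = ramp (h y2) * h y2 / rho y2"
  have m0: "0 < m0" using hpos[OF y2(1)] rpos[OF y2(1)] ramp_pos by (simp add: m0_def)
  define v where "v = measure lborel (cball z d)"
  have v: "0 < v" using d(1) by (simp add: v_def measure_cball_pos)
  \<comment> \<open>Normalised so that the lower bound equals \<open>4 * e\<close>, whereas the
    inner and outer parts of the upper bound contribute at most \<open>e\<close> each.\<close>
  define e where "e = q * (m0 / 4 * v) / 4"
  have e: "0 < e" using q m0 v by (simp add: e_def)
  obtain t where t: "t < 1"
    and tailt: "\<forall>L. compact L \<longrightarrow> (\<forall>x\<in>L. t < norm x \<and> norm x < 1) \<longrightarrow> (LINT x:L|lborel. E x) \<le> e"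
    using tail[OF e] by (elim exE conjE)
  \<comment> \<open>Strictly beyond \<open>t\<close>, so that the compact outer part
    \<open>|x| \<ge> t1\<close> lies where the tail estimate applies.\<close>
  define t1 where "t1 = (1 + t) / 2"
  have t1: "t < t1" "t1 < 1" using t by (auto simp: t1_def)
  have L1: "cball 0 t1 \<subseteq> ?B" using t1 by (auto simp: norm_lt_1_ballN)
  define J where "J = (LINT x:cball 0 t1|lborel. E x / (rho x)\<^sup>2)"
  have cEr: "continuous_on ?B (\<lambda>x. E x / (rho x)\<^sup>2)"
    by (intro continuous_intros E continuous_on_rho) (use rho_pos in force)
  \<comment> \<open>The bound \<open>r0 / 2\<close> keeps the ball around \<open>z\<close> inside
    the cutoff region with cutoff at least \<open>1 / 2\<close>. The other two bounds give
    \<open>\<tau>^2 * J \<le> e\<close>, where \<open>J\<close> is already fixed.\<close>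
  define \<tau> where "\<tau> = min (r0 / 2) (min 1 (e / (\<bar>J\<bar> + 1)))"
  have \<tau>: "0 < \<tau>" "\<tau> \<le> r0 / 2" "\<tau> \<le> 1"
  proof -
    show "0 < \<tau>" using r0 e by (simp add: \<tau>_def add_nonneg_pos)
    show "\<tau> \<le> r0 / 2" unfolding \<tau>_def by (rule min.cobounded1)
    show "\<tau> \<le> 1" by (simp add: \<tau>_def min_le_iff_disj)
  qed
  have \<tau>J: "\<tau>\<^sup>2 * J \<le> e"
  proof -
    have "\<tau> \<le> e / (\<bar>J\<bar> + 1)"
      unfolding \<tau>_def by (rule order_trans[OF min.cobounded2 min.cobounded2])
    moreover have "0 < \<bar>J\<bar> + 1" by (rule add_nonneg_pos) auto
    ultimately have "\<tau> * (\<bar>J\<bar> + 1) \<le> e"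
      using pos_le_divide_eq by blast
    have "\<tau>\<^sup>2 * J \<le> \<tau>\<^sup>2 * (\<bar>J\<bar> + 1)" by (intro mult_left_mono) auto
    also have "\<dots> = \<tau> * (\<tau> * (\<bar>J\<bar> + 1))" by (simp add: power2_eq_square)
    also have "\<dots> \<le> 1 * e"
      using \<open>\<tau> * (\<bar>J\<bar> + 1) \<le> e\<close> \<tau> by (intro mult_mono) auto
    finally show ?thesis by simp
  qed
  let ?K = "{x :: real^'n. \<tau> \<le> rho x}"
  have KB: "?K \<subseteq> ?B"
    by (rule rho_ge_subset_ballN[OF \<tau>(1)])
  have rK: "\<forall>x\<in>?K. rho x \<noteq> 0" using \<tau> by auto
  have low: "m0 / 4 * v \<le> (LINT x:?K|lborel. ramp (h x) * h x * (1 - \<tau> / rho x)\<^sup>2 / rho x)"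
    unfolding v_def
  proof (rule set_integral_ge_cball)
    show "set_integrable lborel ?K (\<lambda>x. ramp (h x) * h x * (1 - \<tau> / rho x)\<^sup>2 / rho x)"
      by (intro set_integrable_compact compact_rho_ge continuous_intros rK continuous_on_rho
          continuous_on_subset[OF ch KB] continuous_on_subset[OF cr KB])
    show "0 \<le> ramp (h x) * h x * (1 - \<tau> / rho x)\<^sup>2 / rho x" if "x \<in> ?K" for x
    proof (cases "0 < h x")
      case True
      then show ?thesis using that \<tau> ramp_nonneg[of "h x"] by auto
    next
      case False
      then show ?thesis by (simp add: ramp_def)
    qed
    show "cball z d \<subseteq> ?K" using y1 \<tau> r0 by (force simp: r0_def)
    fix x assume x: "x \<in> cball z d"
    have rx: "0 < rho x" "r0 \<le> rho x" using rpos x y1 by (auto simp: r0_def)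
    then have "\<tau> / rho x \<le> 1 / 2" using \<tau> by (simp add: divide_le_eq)
    then have "(1 / 2)\<^sup>2 \<le> (1 - \<tau> / rho x)\<^sup>2" by (intro power_mono) auto
    then have "m0 * (1 / 4) \<le> (ramp (h x) * h x / rho x) * (1 - \<tau> / rho x)\<^sup>2"
      using y2(2)[OF x] m0 by (intro mult_mono) (auto simp: m0_def power2_eq_square)
    then show "m0 / 4 \<le> ramp (h x) * h x * (1 - \<tau> / rho x)\<^sup>2 / rho x" by simp
  qed
  define L2 where "L2 = ?K \<inter> {x. t1 \<le> norm x}"
  have "closed {x :: real^'n. t1 \<le> norm x}"
    by (intro closed_Collect_le continuous_on_const continuous_on_norm_id)
  then have L2: "compact L2" "L2 \<subseteq> ?B"
    unfolding L2_def using compact_Int_closed[OF compact_rho_ge] KB by blast+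
  have up: "(LINT x:?K|lborel. (max 0 (h x))\<^sup>2 / rho x * (\<tau> / rho x)\<^sup>2) \<le> \<tau>\<^sup>2 * J + e"
  proof -
    have cKr: "continuous_on M (\<lambda>x. \<tau>\<^sup>2 * (E x / (rho x)\<^sup>2))" if "M \<subseteq> ?B" for M
      by (intro continuous_on_mult_left continuous_on_subset[OF cEr that])
    have "(LINT x:?K|lborel. (max 0 (h x))\<^sup>2 / rho x * (\<tau> / rho x)\<^sup>2) \<le> (LINT x:?K|lborel. \<tau>\<^sup>2 * (E x / (rho x)\<^sup>2))"
    proof (intro set_integral_mono set_integrable_compact compact_rho_ge cKr KB)
      show "continuous_on ?K (\<lambda>x. (max 0 (h x))\<^sup>2 / rho x * (\<tau> / rho x)\<^sup>2)"
        by (intro continuous_intros rK continuous_on_rho continuous_on_subset[OF ch KB])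
      fix x assume x: "x \<in> ?K"
      then have xB: "x \<in> ?B" using KB by blast
      have "(max 0 (h x))\<^sup>2 / rho x \<le> E x"
        using dom[OF xB] E(2)[OF xB] by (cases "0 < h x") auto
      then have "(max 0 (h x))\<^sup>2 / rho x * (\<tau> / rho x)\<^sup>2 \<le> E x * (\<tau> / rho x)\<^sup>2"
        by (intro mult_right_mono) auto
      then show "(max 0 (h x))\<^sup>2 / rho x * (\<tau> / rho x)\<^sup>2 \<le> \<tau>\<^sup>2 * (E x / (rho x)\<^sup>2)"
        by (simp add: power_divide mult.commute)
    qed
    also have "\<dots> \<le> (LINT x:cball 0 t1|lborel. \<tau>\<^sup>2 * (E x / (rho x)\<^sup>2)) + (LINT x:L2|lborel. \<tau>\<^sup>2 * (E x / (rho x)\<^sup>2))"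
    proof (rule set_integral_subset_Un_le[OF compact_rho_ge compact_cball L2(1)])
      show "?K \<subseteq> cball 0 t1 \<union> L2" by (auto simp: L2_def)
      show "continuous_on (cball 0 t1 \<union> L2) (\<lambda>x. \<tau>\<^sup>2 * (E x / (rho x)\<^sup>2))"
        by (rule cKr) (use L1 L2(2) in blast)
      show "0 \<le> \<tau>\<^sup>2 * (E x / (rho x)\<^sup>2)" if "x \<in> cball 0 t1 \<union> L2" for x
      proof -
        have "x \<in> ?B" using that L1 L2(2) by blast
        then show ?thesis using E(2) by simp
      qed
    qed
    also have "(LINT x:cball 0 t1|lborel. \<tau>\<^sup>2 * (E x / (rho x)\<^sup>2)) = \<tau>\<^sup>2 * J"
      unfolding J_def by (rule set_integral_mult_right)
    also have "(LINT x:L2|lborel. \<tau>\<^sup>2 * (E x / (rho x)\<^sup>2)) \<le> (LINT x:L2|lborel. E x)"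
    proof (intro set_integral_mono set_integrable_compact L2 cKr continuous_on_subset[OF E(1) L2(2)])
      fix x assume x: "x \<in> L2"
      then have "\<tau> \<le> rho x" "x \<in> ?B" using L2(2) by (auto simp: L2_def)
      then have "(\<tau> / rho x)\<^sup>2 \<le> 1" using \<tau> by (intro power_le_one) auto
      then have "(\<tau> / rho x)\<^sup>2 * E x \<le> 1 * E x"
        using E(2)[OF \<open>x \<in> ?B\<close>] by (intro mult_right_mono) auto
      then show "\<tau>\<^sup>2 * (E x / (rho x)\<^sup>2) \<le> E x" by (simp add: power_divide)
    qed
    also have "(LINT x:L2|lborel. E x) \<le> e"
      by (rule tailt[rule_format, OF L2(1)]) (use t1 L2(2) in \<open>auto simp: L2_def norm_lt_1_ballN\<close>)
    finally show ?thesis by simp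
  qed
  have "q * (m0 / 4 * v) \<le> q * (LINT x:?K|lborel. ramp (h x) * h x * (1 - \<tau> / rho x)\<^sup>2 / rho x)"
    using low q by (intro mult_left_mono) auto
  also have "\<dots> \<le> \<tau>\<^sup>2 * J + e"
    using comparison_integral_inequality[OF h sub q \<tau>(1)] up by linarith
  also have "\<dots> \<le> 2 * e" using \<tau>J by simp
  finally have "4 * e \<le> 2 * e" by (simp add: e_def)
  then show False using e by simp
qed

text \<open>The nonlinearity is read as the potential \<open>|u|^(4/(N-2))\<close> of a linear
  operator, so \<open>u\<close> and \<open>- u\<close> are treated alike through \<open>s\<close>.
  Subtracting the supersolution inequality and conjugating by \<open>rho^b\<close> leaves the
  zero-order coefficient \<open>b^2 + b rho - lam - |u|^(4/(N-2))\<close>, which is at least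
  \<open>q\<close>.\<close>

lemma solution_le_barrier:
  fixes u \<Phi> :: "real^'n \<Rightarrow> real"
  assumes u: "hyp_solution lam u Lu" and H1: "in_H1 u"
    and \<Phi>: "has_laplacian_on \<Phi> D\<Phi> L\<Phi> ballN" and \<Phi>pos: "\<And>x. x \<in> ballN \<Longrightarrow> 0 < \<Phi> x"
    and q: "0 < q" and t: "t < 1"
    and V: "\<And>x. t < norm x \<Longrightarrow> norm x < 1 \<Longrightarrow>
      lam + \<bar>u x\<bar> powr (4 / (real CARD('n) - 2)) + q \<le> ((real CARD('n) - 1) / 2)\<^sup>2"
    and bar: "\<And>x. t < norm x \<Longrightarrow> norm x < 1 \<Longrightarrow>
      (rho x)\<^sup>2 * L\<Phi> x + (real CARD('n) - 2) * rho x * (x \<bullet> D\<Phi> x)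
      + (lam + \<bar>u x\<bar> powr (4 / (real CARD('n) - 2))) * \<Phi> x \<le> 0"
    and s: "\<bar>s\<bar> = (1::real)"
  obtains M where "0 < M" "\<And>x. x \<in> ballN \<Longrightarrow> s * u x \<le> M * \<Phi> x"
proof -
  let ?N = "real CARD('n)"
  let ?B = "ballN :: (real^'n) set"
  define b where "b = (?N - 1) / 2"
  have lu: "has_laplacian_on u (egrad u) Lu ballN"
    using u by (simp add: hyp_solution_def)
  have gu: "has_grad_on u (egrad u) ballN"
    using lu by (simp add: has_laplacian_on_def)
  have cu: "continuous_on ?B u" and c\<Phi>: "continuous_on ?B \<Phi>"
    using lu \<Phi> has_grad_on_continuous by (auto simp: has_laplacian_on_def)
  have sB: "cball 0 t \<subseteq> ?B" using t by (auto simp: norm_lt_1_ballN)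
  have "continuous_on (cball 0 t) (\<lambda>x. s * u x / \<Phi> x)"
    using \<Phi>pos sB by (intro continuous_intros continuous_on_subset[OF cu sB] continuous_on_subset[OF c\<Phi> sB]) force
  then have "bounded ((\<lambda>x. s * u x / \<Phi> x) ` cball 0 t)"
    by (intro compact_imp_bounded compact_continuous_image) auto
  then obtain M0 where "\<forall>y\<in>(\<lambda>x. s * u x / \<Phi> x) ` cball 0 t. norm y \<le> M0"
    unfolding bounded_iff by blast
  then have M0: "\<bar>s * u x / \<Phi> x\<bar> \<le> M0" if "x \<in> cball 0 t" for x
    using imageI[OF that, of "\<lambda>x. s * u x / \<Phi> x"] by (metis real_norm_def)
  \<comment> \<open>Large enough that \<open>f \<le> 0\<close> on the inner ball; the difference can
    then be positive only where the barrier inequality is available.\<close>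
  define M where "M = \<bar>M0\<bar> + 1"
  have M: "0 < M" by (simp add: M_def)
  define f where "f x = s * u x - M * \<Phi> x" for x
  define Df where "Df x = s *\<^sub>R egrad u x - M *\<^sub>R D\<Phi> x" for x
  define Lf where "Lf x = s * Lu x - M * L\<Phi> x" for x
  have lf: "has_laplacian_on f Df Lf ballN"
    unfolding f_def Df_def Lf_def by (intro has_laplacian_on_diff has_laplacian_on_cmult lu \<Phi>)
  define h where "h x = rho x powr (- b) * f x" for x
  define Dh where "Dh x = rho x powr (- b) *\<^sub>R Df x + (b * rho x powr (- b - 1) * f x) *\<^sub>R x" for x
  obtain Lh where lh: "has_laplacian_on h Dh Lh ballN"
    and eqh: "\<And>x. x \<in> ballN \<Longrightarrow> rho x powr b * ((rho x)\<^sup>2 * Lh x + (?N - 2 - 2 * b) * rho x * (x \<bullet> Dh x))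
      = (rho x)\<^sup>2 * Lf x + (?N - 2) * rho x * (x \<bullet> Df x)
        + (b * (?N - 1 - b) - b * (?N - 2 - 2 * b) * rho x) * f x"
    using conformal_laplacian[OF lf, of b] unfolding h_def[abs_def] Dh_def[abs_def] by blast
  have b1: "?N - 2 - 2 * b = - 1" "?N - 1 - b = b" by (auto simp: b_def field_simps)
  have fle: "f x \<le> 0" if "norm x \<le> t" for x
  proof -
    have xB: "x \<in> ?B" using that t by (simp add: norm_lt_1_ballN)
    have "x \<in> cball 0 t" using that by simp
    from M0[OF this] have "s * u x / \<Phi> x \<le> M" unfolding M_def by linarith
    then show ?thesis using \<Phi>pos[OF xB] by (simp add: f_def divide_le_eq)
  qed
  have hf: "0 < h x \<longleftrightarrow> 0 < f x" if "x \<in> ?B" for x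
    using rho_pos[OF that] by (simp add: h_def zero_less_mult_iff)
  have sub: "q * h x \<le> rho x * (rho x * Lh x - x \<bullet> Dh x)" if x: "x \<in> ?B" and hx: "0 < h x" for x
  proof -
    have fx: "0 < f x" using hf[OF x] hx by simp
    then have tx: "t < norm x" "norm x < 1"
      using fle[of x] x by (auto simp: norm_lt_1_ballN not_le[symmetric])
    define V where "V = \<bar>u x\<bar> powr (4 / (?N - 2))"
    define r where "r = rho x"
    have r: "0 < r" using rho_pos[OF x] by (simp add: r_def)
    have eu: "r\<^sup>2 * Lu x + (?N - 2) * r * (x \<bullet> egrad u x) = - (lam + V) * u x"
      using u x by (simp add: hyp_solution_def V_def r_def algebra_simps)
    have e\<Phi>: "r\<^sup>2 * L\<Phi> x + (?N - 2) * r * (x \<bullet> D\<Phi> x) \<le> - (lam + V) * \<Phi> x"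
      using bar[OF tx] by (simp add: V_def r_def algebra_simps)
    have "r\<^sup>2 * Lf x + (?N - 2) * r * (x \<bullet> Df x)
        = s * (r\<^sup>2 * Lu x + (?N - 2) * r * (x \<bullet> egrad u x)) - M * (r\<^sup>2 * L\<Phi> x + (?N - 2) * r * (x \<bullet> D\<Phi> x))"
      by (simp add: Lf_def Df_def inner_diff_right algebra_simps)
    also have "\<dots> \<ge> s * (- (lam + V) * u x) - M * (- (lam + V) * \<Phi> x)"
      unfolding eu using e\<Phi> M by (intro diff_left_mono mult_left_mono) auto
    also have "s * (- (lam + V) * u x) - M * (- (lam + V) * \<Phi> x) = - (lam + V) * f x"
      by (simp add: f_def algebra_simps)
    finally have 1: "- (lam + V) * f x \<le> r\<^sup>2 * Lf x + (?N - 2) * r * (x \<bullet> Df x)" .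
    have "b * b - (lam + V) \<ge> q"
      using V[OF tx] by (simp add: V_def b_def power2_eq_square)
    moreover have "0 \<le> b * r" using r by (simp add: b_def)
    ultimately have "q * f x \<le> (b * b + b * r - (lam + V)) * f x"
      using fx by (intro mult_right_mono) auto
    also have "\<dots> = - (lam + V) * f x + (b * b + b * r) * f x"
      by (simp add: algebra_simps)
    also have "\<dots> \<le> r\<^sup>2 * Lf x + (?N - 2) * r * (x \<bullet> Df x) + (b * b + b * r) * f x"
      using 1 by simp
    also have "\<dots> = r powr b * (r\<^sup>2 * Lh x - r * (x \<bullet> Dh x))"
      using eqh[OF x] unfolding b1 r_def[symmetric] by simp
    finally have "r powr (- b) * (q * f x) \<le> r powr (- b) * (r powr b * (r\<^sup>2 * Lh x - r * (x \<bullet> Dh x)))"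
      by (intro mult_left_mono) auto
    moreover have "r powr (- b) * (r powr b * (r\<^sup>2 * Lh x - r * (x \<bullet> Dh x))) = r * (r * Lh x - x \<bullet> Dh x)"
      using r by (simp add: powr_minus power2_eq_square algebra_simps)
    ultimately show ?thesis by (simp add: h_def r_def mult_ac)
  qed
  let ?E = "\<lambda>x. (hgrad_sq u x + (u x)\<^sup>2) * vol_dens x"
  \<comment> \<open>Because \<open>- 2 b - 1 = - N\<close>, the left side is
    \<open>rho^-N f^2\<close>. Positivity of the barrier gives \<open>0 < f \<le> s u\<close>, so
    this is bounded by the \<open>L^2\<close> part of the energy density.\<close>
  have dom: "(h x)\<^sup>2 / rho x \<le> ?E x" if x: "x \<in> ?B" and hx: "0 < h x" for x
  proof -
    have r: "0 < rho x" by (rule rho_pos[OF x])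
    have fx: "0 < f x" using hf[OF x] hx by simp
    have "f x \<le> s * u x" using M \<Phi>pos[OF x] by (simp add: f_def)
    then have "(f x)\<^sup>2 \<le> (s * u x)\<^sup>2" using fx by (intro power_mono) auto
    also have "(s * u x)\<^sup>2 = (u x)\<^sup>2" using s by (simp add: power_mult_distrib abs_square_eq_1)
    finally have fu: "(f x)\<^sup>2 \<le> (u x)\<^sup>2" .
    have "(rho x powr (- b))\<^sup>2 / rho x = rho x powr (- ?N)"
    proof -
      have "(rho x powr (- b))\<^sup>2 / rho x = rho x powr (- b) * rho x powr (- b) * rho x powr (- 1)"
        using r by (simp add: power2_eq_square powr_minus_divide)
      also have "\<dots> = rho x powr (- b + - b + - 1)"
        by (simp only: powr_add)
      also have "- b + - b + - 1 = - ?N" by (simp add: b_def field_simps)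
      finally show ?thesis .
    qed
    moreover have "(h x)\<^sup>2 / rho x = (rho x powr (- b))\<^sup>2 / rho x * (f x)\<^sup>2"
      by (simp add: h_def power_mult_distrib)
    ultimately have "(h x)\<^sup>2 / rho x = rho x powr (- ?N) * (f x)\<^sup>2"
      by (simp only:)
    also have "\<dots> \<le> rho x powr (- ?N) * (u x)\<^sup>2"
      using fu by (intro mult_left_mono) auto
    also have "\<dots> \<le> ?E x"
      by (simp add: energy_density_eq[OF x])
    finally show ?thesis .
  qed
  have tail: "\<exists>t<1. \<forall>L. compact L \<longrightarrow> (\<forall>x\<in>L. t < norm x \<and> norm x < 1) \<longrightarrow> (LINT x:L|lborel. ?E x) \<le> e" if e: "0 < e" for e
  proof -
    obtain t where "0 \<le> t" "t < 1" "\<And>L. compact L \<Longrightarrow> (\<And>x. x \<in> L \<Longrightarrow> t < norm x \<and> norm x < 1) \<Longrightarrow> (LINT x:L|lborel. ?E x) \<le> e"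
      using H1_energy_tail[OF gu H1 e] by blast
    then show ?thesis by (intro exI[of _ t]) simp
  qed
  have "h x \<le> 0" if "x \<in> ?B" for x
    by (rule comparison_nonpos[OF lh sub q continuous_on_energy_density[OF gu order_refl] energy_density_nonneg dom tail that])
  then have "f x \<le> 0" if "x \<in> ?B" for x
    using hf[OF that] that by (meson not_le)
  then have "s * u x \<le> M * \<Phi> x" if "x \<in> ?B" for x
    using that by (simp add: f_def)
  with M show ?thesis by (rule that)
qed

section \<open>Powers of \<open>rho\<close> as barriers and the decay rate\<close>

lemma hyp_laplacian_rho_powr:
  fixes x :: "real^'n"
  assumes x: "x \<in> ballN"
  shows "(rho x)\<^sup>2 * (c * (c - 1) * rho x powr (c - 2) * (x \<bullet> x) - c * real CARD('n) * rho x powr (c - 1))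
      + (real CARD('n) - 2) * rho x * (x \<bullet> ((- c * rho x powr (c - 1)) *\<^sub>R x))
    = (- c * (real CARD('n) - 1 - c) + c * (real CARD('n) - 2 - 2 * c) * rho x) * rho x powr c"
proof -
  define R where "R = rho x"
  have R: "0 < R" using rho_pos[OF x] by (simp add: R_def)
  have P: "R powr (c - 1) = R powr c / R" "R powr (c - 2) = R powr c / R\<^sup>2"
    using R by (auto simp: powr_diff)
  show ?thesis
    unfolding R_def[symmetric] P inner_scaleR_right inner_self_rho[of x, folded R_def]
    using R by (simp add: field_simps power2_eq_square)
qed

text \<open>Two comparisons are needed because \<open>rho^b\<close> has the strict margin
  \<open>b^2 - lam\<close> and tolerates a potential that is merely small, while the root
  \<open>c\<close> has no margin at leading order and requires a potential that decays at a
  rate.\<close>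

lemma solution_decay:
  fixes u :: "real^'n \<Rightarrow> real"
  assumes N: "3 \<le> CARD('n)" and u: "hyp_solution lam u Lu" and H1: "in_H1 u"
    and lam: "lam < ((real CARD('n) - 1) / 2)\<^sup>2"
    and c: "c = ((real CARD('n) - 1) + sqrt ((real CARD('n) - 1)\<^sup>2 - 4 * lam)) / 2"
  obtains C where "0 < C" "\<And>x. x \<in> ballN \<Longrightarrow> \<bar>u x\<bar> \<le> C * rho x powr c"
proof -
  let ?N = "real CARD('n)"
  let ?B = "ballN :: (real^'n) set"
  define p where "p = 4 / (?N - 2)"
  define b where "b = (?N - 1) / 2"
  have N3: "3 \<le> ?N" using N by simp
  have p: "0 < p" using N3 by (simp add: p_def)
  have b: "0 < b" using N3 by (simp add: b_def)
  define k where "k = b\<^sup>2 - lam"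
  have k: "0 < k" using lam by (simp add: k_def b_def)
  \<comment> \<open>Below this size of \<open>|u|\<close> the potential takes at most half of the
    gap \<open>k\<close>; the other half is the margin passed to the comparison.\<close>
  have eps: "0 < (k / 2) powr (1 / p)" using k by simp
  obtain t where t: "0 \<le> t" "t < 1" and tu: "\<And>x. t < norm x \<Longrightarrow> norm x < 1 \<Longrightarrow> \<bar>u x\<bar> < (k / 2) powr (1 / p)"
    using solution_tends_to_0[OF N u H1 eps] by blast
  have V: "lam + \<bar>u x\<bar> powr (4 / (?N - 2)) + k / 2 \<le> ((?N - 1) / 2)\<^sup>2" if "t < norm x" "norm x < 1" for x
  proof -
    have "\<bar>u x\<bar> powr p \<le> ((k / 2) powr (1 / p)) powr p"
      using tu[OF that] p by (intro powr_mono2) auto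
    also have "\<dots> = k / 2" using p k by (simp add: powr_powr)
    finally have "\<bar>u x\<bar> powr p \<le> k / 2" .
    moreover have "k = ((?N - 1) / 2)\<^sup>2 - lam" by (simp add: k_def b_def)
    ultimately show ?thesis unfolding p_def by argo
  qed
  have k2: "0 < k / 2" using k by simp

  obtain M where M: "0 < M" "\<And>x. x \<in> ?B \<Longrightarrow> \<bar>u x\<bar> \<le> M * rho x powr b"
  proof -
    have pos: "0 < rho x powr b" if "x \<in> ?B" for x using rho_pos[OF that] by simp
    have bar: "(rho x)\<^sup>2 * (b * (b - 1) * rho x powr (b - 2) * (x \<bullet> x) - b * ?N * rho x powr (b - 1))
        + (?N - 2) * rho x * (x \<bullet> ((- b * rho x powr (b - 1)) *\<^sub>R x))
        + (lam + \<bar>u x\<bar> powr (4 / (?N - 2))) * rho x powr b \<le> 0" if tx: "t < norm x" "norm x < 1" for x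
    proof -
      have x: "x \<in> ?B" using tx by (simp add: norm_lt_1_ballN)
      have e: "?N - 1 - b = b" "?N - 2 - 2 * b = - 1" by (auto simp: b_def field_simps)
      have "lam + \<bar>u x\<bar> powr (4 / (?N - 2)) \<le> b * b"
        using V[OF tx] k by (simp add: b_def power2_eq_square)
      moreover have "0 \<le> b * rho x" using b rho_pos[OF x] by simp
      ultimately have "(- b * b + b * (- 1) * rho x + (lam + \<bar>u x\<bar> powr (4 / (?N - 2)))) * rho x powr b \<le> 0"
        by (intro mult_nonpos_nonneg) auto
      then show ?thesis
        unfolding hyp_laplacian_rho_powr[OF x] e by (simp only: distrib_right)
    qed
    obtain M1 where M1: "0 < M1" "\<And>x. x \<in> ?B \<Longrightarrow> 1 * u x \<le> M1 * rho x powr b"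
      by (rule solution_le_barrier[OF u H1 has_laplacian_on_rho_powr pos k2 t(2) V bar, of 1]) auto
    obtain M2 where M2: "0 < M2" "\<And>x. x \<in> ?B \<Longrightarrow> - 1 * u x \<le> M2 * rho x powr b"
      by (rule solution_le_barrier[OF u H1 has_laplacian_on_rho_powr pos k2 t(2) V bar, of "- 1"]) auto
    show ?thesis
    proof (rule that[of "M1 + M2"])
      fix x assume x: "x \<in> ?B"
      have "0 \<le> M1 * rho x powr b" "0 \<le> M2 * rho x powr b" using M1 M2 by auto
      then show "\<bar>u x\<bar> \<le> (M1 + M2) * rho x powr b"
        using M1(2)[OF x] M2(2)[OF x] by (simp add: distrib_right)
    qed (use M1 M2 in simp)
  qed

  define S where "S = sqrt ((?N - 1)\<^sup>2 - 4 * lam)"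
  have S: "0 \<le> S" "S\<^sup>2 = (?N - 1)\<^sup>2 - 4 * lam"
    using lam by (auto simp: S_def power_divide)
  have c2: "c = (?N - 1 + S) / 2" by (simp add: c S_def)
  have cb: "2 * c \<ge> ?N - 1" using S by (simp add: c2)
  have c_pos: "0 < c" using cb N3 by simp
  have croot: "c * (?N - 1 - c) = lam"
  proof -
    have "4 * (c * (?N - 1 - c)) = (?N - 1)\<^sup>2 - S\<^sup>2"
      by (simp add: c2 power2_eq_square field_simps)
    then show ?thesis using S by simp
  qed
  define W where "W = M powr p"
  have W: "0 \<le> W" by (simp add: W_def)
  have VW: "\<bar>u x\<bar> powr (4 / (?N - 2)) \<le> W * rho x" if x: "x \<in> ?B" for x
  proof -
    have r: "0 < rho x" "rho x \<le> 1" using rho_pos[OF x] rho_le[of x] by auto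
    have "\<bar>u x\<bar> powr p \<le> (M * rho x powr b) powr p"
      using M(2)[OF x] p by (intro powr_mono2) auto
    also have "\<dots> = W * rho x powr (b * p)"
      using M r by (simp add: W_def powr_mult powr_powr)
    also have "\<dots> \<le> W * rho x powr 1"
    proof (intro mult_left_mono W powr_mono')
      \<comment> \<open>The product is \<open>2 (N - 1) / (N - 2)\<close>; one full power of
        \<open>rho\<close> already beats the half power gained by the second barrier.\<close>
      show "1 \<le> b * p" using N3 by (simp add: b_def p_def field_simps)
    qed (use r in auto)
    finally show ?thesis using r by (simp add: p_def)
  qed
  \<comment> \<open>\<open>- A\<close> is the coefficient of \<open>rho\<close> produced by the
    correction \<open>rho^(c+1/2)\<close>. In terms of \<open>s = sqrt rho\<close> the error is at
    most \<open>(A + W) s\<close>, to be held below \<open>1 / 4\<close>; \<open>s0\<close> achieves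
    this, and \<open>1 - |x| \<le> s0^2\<close> ensures \<open>s \<le> s0\<close>.\<close>
  define A where "A = (c + 1 / 2) * (2 * c + 3 - ?N)"
  have A: "0 \<le> A" using c_pos cb by (simp add: A_def)
  define s0 where "s0 = 1 / (4 * (A + W + 1))"
  have s0: "0 < s0" using A W by (simp add: s0_def)
  define t2 where "t2 = max t (1 - s0\<^sup>2)"
  have t2: "t2 < 1" using t s0 by (simp add: t2_def)
  define \<Phi> where "\<Phi> x = rho x powr c - rho x powr (c + 1 / 2)" for x :: "real^'n"
  have \<Phi>: "has_laplacian_on \<Phi>
     (\<lambda>x. (- c * rho x powr (c - 1)) *\<^sub>R x - (- (c + 1 / 2) * rho x powr (c + 1 / 2 - 1)) *\<^sub>R x)
     (\<lambda>x. (c * (c - 1) * rho x powr (c - 2) * (x \<bullet> x) - c * ?N * rho x powr (c - 1))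
       - ((c + 1 / 2) * (c + 1 / 2 - 1) * rho x powr (c + 1 / 2 - 2) * (x \<bullet> x) - (c + 1 / 2) * ?N * rho x powr (c + 1 / 2 - 1))) ?B"
    unfolding \<Phi>_def by (intro has_laplacian_on_diff has_laplacian_on_rho_powr)
  have half: "rho x powr (c + 1 / 2) = rho x powr c * sqrt (rho x)" if "x \<in> ?B" for x
    using rho_pos[OF that] by (simp add: powr_add powr_half_sqrt)
  have \<Phi>pos: "0 < \<Phi> x" if x: "x \<in> ?B" for x
  proof -
    have "sqrt (rho x) < 1" using rho_le[of x] by simp
    then have "rho x powr c * sqrt (rho x) < rho x powr c * 1"
      using rho_pos[OF x] by (intro mult_strict_left_mono) auto
    then show ?thesis by (simp add: \<Phi>_def half[OF x])
  qed
  have bar: "(rho x)\<^sup>2 * ((c * (c - 1) * rho x powr (c - 2) * (x \<bullet> x) - c * ?N * rho x powr (c - 1))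
       - ((c + 1 / 2) * (c + 1 / 2 - 1) * rho x powr (c + 1 / 2 - 2) * (x \<bullet> x) - (c + 1 / 2) * ?N * rho x powr (c + 1 / 2 - 1)))
     + (?N - 2) * rho x * (x \<bullet> ((- c * rho x powr (c - 1)) *\<^sub>R x - (- (c + 1 / 2) * rho x powr (c + 1 / 2 - 1)) *\<^sub>R x))
     + (lam + \<bar>u x\<bar> powr (4 / (?N - 2))) * \<Phi> x \<le> 0" (is "?L \<le> 0") if tx: "t2 < norm x" "norm x < 1" for x
  proof -
    have x: "x \<in> ?B" using tx by (simp add: norm_lt_1_ballN)
    define r where "r = rho x"
    define s where "s = sqrt r"
    define P where "P = r powr c"
    define v where "v = \<bar>u x\<bar> powr (4 / (?N - 2))"
    have r: "0 < r" "r \<le> 1 / 2" using rho_pos[OF x] rho_le[of x] by (auto simp: r_def)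
    have s: "0 < s" "s \<le> 1" "r = s * s" using r by (auto simp: s_def)
    have P: "0 < P" using r by (simp add: P_def)
    have v: "0 \<le> v" "v \<le> W * r" using VW[OF x] by (auto simp: v_def r_def)
    have \<Phi>x: "\<Phi> x = P - P * s" by (simp add: \<Phi>_def half[OF x] P_def s_def r_def)
    have split: "(rho x)\<^sup>2 * (A1 - A2) + (?N - 2) * rho x * (x \<bullet> (D1 - D2))
      = ((rho x)\<^sup>2 * A1 + (?N - 2) * rho x * (x \<bullet> D1)) - ((rho x)\<^sup>2 * A2 + (?N - 2) * rho x * (x \<bullet> D2))"
      for A1 A2 :: real and D1 D2 by (simp add: inner_diff_right algebra_simps)
    have "?L = (- c * (?N - 1 - c) + c * (?N - 2 - 2 * c) * r) * P
       - (- (c + 1 / 2) * (?N - 1 - (c + 1 / 2)) + (c + 1 / 2) * (?N - 2 - 2 * (c + 1 / 2)) * r) * (P * s)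
       + (lam + v) * (P - P * s)"
      unfolding split hyp_laplacian_rho_powr[OF x] \<Phi>x half[OF x] by (simp only: r_def s_def P_def v_def)
    \<comment> \<open>The value of \<open>d (N - 1 - d)\<close> at \<open>d = c + 1/2\<close> is
      \<open>lam + (N - 1 - 2 c) / 2 - 1/4\<close>, at most \<open>lam - 1/4\<close> because
      \<open>2 c \<ge> N - 1\<close>. This \<open>- 1/4\<close> is the gain of the correction term;
      the part without \<open>s\<close> cancels since \<open>c\<close> is a root.\<close>
    also have "\<dots> = P * s * (c * (?N - 2 - 2 * c) * s + ((?N - 1 - 2 * c) / 2 - 1 / 4) + A * r) + v * (P - P * s)
        + (lam - c * (?N - 1 - c)) * (P - P * s)"
      unfolding A_def s(3) by (simp add: field_simps)
    also have "\<dots> = P * s * (c * (?N - 2 - 2 * c) * s + ((?N - 1 - 2 * c) / 2 - 1 / 4) + A * r) + v * (P - P * s)"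
      by (simp add: croot)
    also have "\<dots> \<le> P * s * (- (1 / 4) + A * s) + W * (s * s) * P"
    proof (rule add_mono)
      have "c * (?N - 2 - 2 * c) * s \<le> 0"
        using c_pos cb s by (intro mult_nonpos_nonneg mult_nonneg_nonpos) auto
      moreover have "A * r \<le> A * s" using A s by (intro mult_left_mono) (auto simp: mult_left_le)
      ultimately have "c * (?N - 2 - 2 * c) * s + ((?N - 1 - 2 * c) / 2 - 1 / 4) + A * r \<le> - (1 / 4) + A * s"
        using cb by argo
      then show "P * s * (c * (?N - 2 - 2 * c) * s + ((?N - 1 - 2 * c) / 2 - 1 / 4) + A * r) \<le> P * s * (- (1 / 4) + A * s)"
        using P s(1) by (intro mult_left_mono) auto
      have "0 \<le> P * s" "P * s \<le> P" using P s by (auto simp: mult_left_le)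
      then show "v * (P - P * s) \<le> W * (s * s) * P"
        using v s P by (intro mult_mono) auto
    qed
    also have "\<dots> = P * s * ((A + W) * s - 1 / 4)"
      by (simp add: algebra_simps)
    also have "\<dots> \<le> 0"
    proof -
      have "r \<le> 1 - norm x" using rho_bounds(1)[OF tx(2)] by (simp add: r_def)
      also have "\<dots> \<le> s0\<^sup>2" using tx(1) by (simp add: t2_def)
      finally have "s \<le> s0" unfolding s_def using s0 by (intro real_le_lsqrt) auto
      then have "(A + W) * s \<le> (A + W + 1) * s0"
        using A W s by (intro mult_mono) auto
      also have "\<dots> = 1 / 4" using A W by (simp add: s0_def)
      finally show ?thesis using P s by (intro mult_nonneg_nonpos) auto
    qed
    finally show ?thesis .
  qed
  have V2: "lam + \<bar>u x\<bar> powr (4 / (?N - 2)) + k / 2 \<le> ((?N - 1) / 2)\<^sup>2" if "t2 < norm x" "norm x < 1" for x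
    using V[of x] that by (simp add: t2_def)
  obtain M1 where M1: "0 < M1" "\<And>x. x \<in> ?B \<Longrightarrow> 1 * u x \<le> M1 * \<Phi> x"
    by (rule solution_le_barrier[OF u H1 \<Phi> \<Phi>pos k2 t2 V2 bar, of 1]) auto
  obtain M2 where M2: "0 < M2" "\<And>x. x \<in> ?B \<Longrightarrow> - 1 * u x \<le> M2 * \<Phi> x"
    by (rule solution_le_barrier[OF u H1 \<Phi> \<Phi>pos k2 t2 V2 bar, of "- 1"]) auto
  show ?thesis
  proof (rule that[of "M1 + M2"])
    fix x assume x: "x \<in> ?B"
    have "0 \<le> M1 * \<Phi> x" "0 \<le> M2 * \<Phi> x" using M1 M2 \<Phi>pos[OF x] by auto
    then have "\<bar>u x\<bar> \<le> (M1 + M2) * \<Phi> x"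
      using M1(2)[OF x] M2(2)[OF x] unfolding distrib_right by linarith
    also have "\<dots> \<le> (M1 + M2) * rho x powr c"
      using M1 M2 by (intro mult_left_mono) (auto simp: \<Phi>_def)
    finally show "\<bar>u x\<bar> \<le> (M1 + M2) * rho x powr c" .
  qed (use M1 M2 in simp)
qed

theorem theorem2p1:
  fixes u :: "real^'n \<Rightarrow> real" and lam :: real
  assumes N3: "CARD('n) \<ge> 3"
    and lam: "lam < ((real CARD('n) - 1) / 2)\<^sup>2"
    and C2: "Ck_on 2 ballN u"
    and H1: "in_H1 u"
    and sol: "weak_solution lam u"
  shows "(\<forall>\<epsilon>>0. \<exists>\<delta>>0. \<forall>x\<in>ballN. 1 - \<delta> < norm x \<longrightarrow> \<bar>u x\<bar> + hgrad_sq u x < \<epsilon>)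
    \<and> (lam \<le> real CARD('n) * (real CARD('n) - 2) / 4 \<longrightarrow>
         (\<exists>C>0. \<forall>x\<in>ballN. \<bar>u x\<bar> \<le> C * (rho x) powr
            (min (((real CARD('n) - 1) + sqrt ((real CARD('n) - 1)\<^sup>2 - 4 * lam)) / 2)
                 ((real CARD('n) + 2) / 2))))"
proof -
  let ?c = "((real CARD('n) - 1) + sqrt ((real CARD('n) - 1)\<^sup>2 - 4 * lam)) / 2"
  let ?m = "min ?c ((real CARD('n) + 2) / 2)"
  have lap: "has_laplacian_on u (egrad u) (\<lambda>x. \<Sum>i\<in>UNIV. pd (pd u i) i x) ballN"
    by (rule Ck_on_2_imp_has_laplacian_on[OF C2 open_ballN])
  have u: "hyp_solution lam u (\<lambda>x. \<Sum>i\<in>UNIV. pd (pd u i) i x)"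
    unfolding hyp_solution_def using lap weak_solution_imp_equation[OF lap sol _ N3] by blast
  obtain C where C: "0 < C" "\<And>x. x \<in> ballN \<Longrightarrow> \<bar>u x\<bar> \<le> C * rho x powr ?c"
    using solution_decay[OF N3 u H1 lam refl] by blast
  have "\<bar>u x\<bar> \<le> C * rho x powr ?m" if x: "x \<in> ballN" for x
  proof -
    \<comment> \<open>The base is at most \<open>1 / 2\<close>, so lowering the exponent enlarges
      the power.\<close>
    have "rho x powr ?c \<le> rho x powr ?m"
    proof (rule powr_mono')
      show "?m \<le> ?c" by (rule min.cobounded1)
    qed (use rho_pos[OF x] rho_le[of x] in auto)
    then have "C * rho x powr ?c \<le> C * rho x powr ?m"
      using C(1) by (intro mult_left_mono) auto
    with C(2)[OF x] show ?thesis by (rule order_trans)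
  qed
  with C(1) show ?thesis
    using solution_and_gradient_tend_to_0[OF N3 u H1] by blast
qed

end
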